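(* Let $X$ be a connected proper metric measure space of bounded geometry such that the measure on $X$ is non-atomic. Let $D_0\subset X$ be a uniformly discrete subset, let $\{\phi_x\}_{x\in D_0}\subset L^2(X)$ be a $D_0$-compactly supported Wannier basis, and let $p_\phi$ be the corresponding Wannier projection. Then $[p_\phi]=0$ in $K_0(C^*_{\mathbb C}(X))$.
   Context: A proper metric measure space $X$ is a set with a metric $d$ and a measure $m$ defined on the Borel $\sigma$-algebra of the metric topology, such that all balls are compact. Standing assumption on the $C_0(X)$-module $L^2(X)$ (with $C_0(X)$ acting by multiplication): $C_0(X)L^2(X)$ is dense in $L^2(X)$, and multiplication by any non-zero $f\in C_0(X)$ is not a compact operator (in particular $m$ is non-zero on non-empty open sets). $X$ has bounded geometry if there exists $r>0$ such that for any $R>0$ there exists $N\in\mathbb N$ such that any ball of radius $R$ in $X$ can be covered by at most $N$ balls of radius $r$. A subset $D_0\subset X$ is uniformly discrete if $\inf_{g,h\in D_0,\,g\ne h}d(g,h)>0$. Wannier bases: an orthonormal set $\{\phi_x:x\in D_0\}\subset L^2(X)$ is a $D_0$-compactly supported Wannier basis if there is $R>0$ such that $\operatorname{supp}\phi_x\subset B_R(x)$ for all $x\in D_0$, where $B_R(x)$ is the ball of radius $R$ centered at $x$. Let $H_\phi$ be the closed linear span of $\{\phi_x\}$ in $L^2(X)$. The orthogonal projection $p_\phi$ onto $H_\phi$ is called a Wannier projection, with set of localization centers $D_0$. It lies in $C^*_{\mathbb C}(X)$. Roe algebra: $C^*_{\mathbb C}(X)$ is the norm closure in $\mathbb B(L^2(X))$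 of the $*$-algebra of locally compact, finite propagation operators. $T$ is locally compact if $Tf$ and $fT$ are compact for every $f\in C_0(X)$ (acting by multiplication); $T$ has finite propagation if there is $R>0$ such that $fTg=0$ whenever $f,g\in C_0(X)$ have supports at distance greater than $R$.
   Formalization: X is additionally assumed non-compact; for compact X (e.g. a circle with D_0 one point) C*(X) is the compact operators and [p_φ] = |D_0| ≠ 0, so the claim fails for every non-empty D_0. *)

theory Defs
  imports "HOL-Analysis.Analysis" "HOL-Algebra.Module"
begin

section \<open>Metric measure spaces\<close>

text \<open>The space \<open>X\<close> is the carrier type \<open>'a :: metric_space\<close>; the measure is \<open>M\<close>.\<close>

definition proper_metric_measure_space :: "'a::metric_space measure \<Rightarrow> bool" where
  "proper_metric_measure_space M \<longleftrightarrow>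
     sets M = sets borel \<and> (\<forall>(x::'a) r. compact (cball x r))"

definition bounded_geometry :: "'a::metric_space set \<Rightarrow> bool" where
  "bounded_geometry X \<longleftrightarrow>
     (\<exists>r>0. \<forall>R>0. \<exists>N::nat. \<forall>x\<in>X. \<exists>F\<subseteq>X. finite F \<and> card F \<le> N \<and>
        cball x R \<inter> X \<subseteq> (\<Union>y\<in>F. cball y r))"

definition non_atomic :: "'a measure \<Rightarrow> bool" where
  "non_atomic M \<longleftrightarrow>
     (\<forall>A\<in>sets M. 0 < emeasure M A \<longrightarrow>
        (\<exists>B\<in>sets M. B \<subseteq> A \<and> 0 < emeasure M B \<and> emeasure M B < emeasure M A))"


section \<open>The Hilbert space of square-integrable functions\<close>

text \<open>Elements of \<open>L2 M\<close> are equivalence classes of square-integrable functions modulo equality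
  almost everywhere.\<close>

definition L2_fun :: "'a measure \<Rightarrow> ('a \<Rightarrow> complex) set" where
  "L2_fun M = {f \<in> borel_measurable M. integrable M (\<lambda>x. (cmod (f x))\<^sup>2)}"

definition L2_rel :: "'a measure \<Rightarrow> (('a \<Rightarrow> complex) \<times> ('a \<Rightarrow> complex)) set" where
  "L2_rel M = {(f, g). f \<in> L2_fun M \<and> g \<in> L2_fun M \<and> (AE x in M. f x = g x)}"

definition L2 :: "'a measure \<Rightarrow> ('a \<Rightarrow> complex) set set" where
  "L2 M = L2_fun M // L2_rel M"

definition L2_class :: "'a measure \<Rightarrow> ('a \<Rightarrow> complex) \<Rightarrow> ('a \<Rightarrow> complex) set" where
  "L2_class M f = L2_rel M `` {f}"

definition rep :: "'b set \<Rightarrow> 'b" where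
  "rep U = (SOME u. u \<in> U)"

definition L2_zero :: "'a measure \<Rightarrow> ('a \<Rightarrow> complex) set" where
  "L2_zero M = L2_class M (\<lambda>x. 0)"

definition L2_add ::
    "'a measure \<Rightarrow> ('a \<Rightarrow> complex) set \<Rightarrow> ('a \<Rightarrow> complex) set \<Rightarrow> ('a \<Rightarrow> complex) set" where
  "L2_add M U V = L2_class M (\<lambda>x. rep U x + rep V x)"

definition L2_scale ::
    "'a measure \<Rightarrow> complex \<Rightarrow> ('a \<Rightarrow> complex) set \<Rightarrow> ('a \<Rightarrow> complex) set" where
  "L2_scale M c U = L2_class M (\<lambda>x. c * rep U x)"

definition L2_diff ::
    "'a measure \<Rightarrow> ('a \<Rightarrow> complex) set \<Rightarrow> ('a \<Rightarrow> complex) set \<Rightarrow> ('a \<Rightarrow> complex) set" where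
  "L2_diff M U V = L2_class M (\<lambda>x. rep U x - rep V x)"

definition L2_inner ::
    "'a measure \<Rightarrow> ('a \<Rightarrow> complex) set \<Rightarrow> ('a \<Rightarrow> complex) set \<Rightarrow> complex" where
  "L2_inner M U V = (\<integral>x. cnj (rep U x) * rep V x \<partial>M)"

definition L2_norm :: "'a measure \<Rightarrow> ('a \<Rightarrow> complex) set \<Rightarrow> real" where
  "L2_norm M U = sqrt (\<integral>x. (cmod (rep U x))\<^sup>2 \<partial>M)"

definition L2_dist ::
    "'a measure \<Rightarrow> ('a \<Rightarrow> complex) set \<Rightarrow> ('a \<Rightarrow> complex) set \<Rightarrow> real" where
  "L2_dist M U V = L2_norm M (L2_diff M U V)"

definition L2_closure :: "'a measure \<Rightarrow> ('a \<Rightarrow> complex) set set \<Rightarrow> ('a \<Rightarrow> complex) set set" where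
  "L2_closure M S = {U \<in> L2 M. \<forall>\<epsilon>>0. \<exists>V\<in>S. L2_dist M U V < \<epsilon>}"

text \<open>The complement of the largest open set on which the class vanishes almost everywhere.\<close>

definition ess_supp :: "'a::topological_space measure \<Rightarrow> ('a \<Rightarrow> complex) set \<Rightarrow> 'a set" where
  "ess_supp M U = - \<Union>{G. open G \<and> (AE x in M. x \<in> G \<longrightarrow> rep U x = 0)}"


section \<open>Operators\<close>

text \<open>Complex *-algebras are modules over the complex numbers (in the style of HOL-Algebra, only
  the behaviour on the carrier matters) with an involution.\<close>

record 'b star_alg = "(complex, 'b) module" +
  star :: "'b \<Rightarrow> 'b"

text \<open>Operators are extensional on \<open>L2 M\<close>, so that equality of operators is HOL equality.\<close>

type_synonym 'a l2_op = "('a \<Rightarrow> complex) set \<Rightarrow> ('a \<Rightarrow> complex) set"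

definition bounded_op :: "'a measure \<Rightarrow> 'a l2_op \<Rightarrow> bool" where
  "bounded_op M T \<longleftrightarrow>
     T \<in> L2 M \<rightarrow>\<^sub>E L2 M \<and>
     (\<forall>U\<in>L2 M. \<forall>V\<in>L2 M. T (L2_add M U V) = L2_add M (T U) (T V)) \<and>
     (\<forall>c. \<forall>U\<in>L2 M. T (L2_scale M c U) = L2_scale M c (T U)) \<and>
     (\<exists>C. \<forall>U\<in>L2 M. L2_norm M (T U) \<le> C * L2_norm M U)"

definition op_adj :: "'a measure \<Rightarrow> 'a l2_op \<Rightarrow> 'a l2_op" where
  "op_adj M T = (THE S. bounded_op M S \<and>
     (\<forall>U\<in>L2 M. \<forall>V\<in>L2 M. L2_inner M (S U) V = L2_inner M U (T V)))"

definition bounded_ops :: "'a measure \<Rightarrow> 'a l2_op star_alg" where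
  "bounded_ops M =
     \<lparr> carrier = {T. bounded_op M T},
       monoid.mult = (\<lambda>S T. compose (L2 M) S T),
       one = (\<lambda>U\<in>L2 M. U),
       zero = (\<lambda>U\<in>L2 M. L2_zero M),
       add = (\<lambda>S T. \<lambda>U\<in>L2 M. L2_add M (S U) (T U)),
       smult = (\<lambda>c T. \<lambda>U\<in>L2 M. L2_scale M c (T U)),
       star = op_adj M \<rparr>"

definition op_dist :: "'a measure \<Rightarrow> 'a l2_op \<Rightarrow> 'a l2_op \<Rightarrow> real" where
  "op_dist M S T = (SUP U\<in>{U \<in> L2 M. L2_norm M U \<le> 1}. L2_dist M (S U) (T U))"

definition compact_op :: "'a measure \<Rightarrow> 'a l2_op \<Rightarrow> bool" where
  "compact_op M T \<longleftrightarrow> bounded_op M T \<and>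
     (\<forall>U::nat \<Rightarrow> ('a \<Rightarrow> complex) set. (\<forall>n. U n \<in> L2 M \<and> L2_norm M (U n) \<le> 1) \<longrightarrow>
        (\<exists>V\<in>L2 M. \<exists>s. strict_mono s \<and> (\<lambda>n. L2_dist M (T (U (s n))) V) \<longlonglongrightarrow> 0))"

definition closed_span ::
    "'a measure \<Rightarrow> ('i \<Rightarrow> ('a \<Rightarrow> complex) set) \<Rightarrow> 'i set \<Rightarrow> ('a \<Rightarrow> complex) set set" where
  "closed_span M \<phi> I =
     L2_closure M {L2_class M (\<lambda>y. \<Sum>i\<in>F. c i * rep (\<phi> i) y) | F c. finite F \<and> F \<subseteq> I}"

definition orth_proj :: "'a measure \<Rightarrow> ('a \<Rightarrow> complex) set set \<Rightarrow> 'a l2_op" where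
  "orth_proj M H =
     (\<lambda>U\<in>L2 M. THE V. V \<in> H \<and> (\<forall>W\<in>H. L2_inner M W (L2_diff M U V) = 0))"


section \<open>The Roe algebra\<close>

definition C0 :: "('a::topological_space \<Rightarrow> complex) set" where
  "C0 = {f. continuous_on UNIV f \<and> (\<forall>\<epsilon>>0. \<exists>K. compact K \<and> (\<forall>x. x \<notin> K \<longrightarrow> cmod (f x) < \<epsilon>))}"

definition fun_supp :: "('a::topological_space \<Rightarrow> complex) \<Rightarrow> 'a set" where
  "fun_supp f = closure {x. f x \<noteq> 0}"

definition mult_op :: "'a measure \<Rightarrow> ('a \<Rightarrow> complex) \<Rightarrow> 'a l2_op" where
  "mult_op M f = (\<lambda>U\<in>L2 M. L2_class M (\<lambda>x. f x * rep U x))"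

definition ample :: "'a::topological_space measure \<Rightarrow> bool" where
  "ample M \<longleftrightarrow>
     L2_closure M {mult_op M f U | f U. f \<in> C0 \<and> U \<in> L2 M} = L2 M \<and>
     (\<forall>f\<in>C0. f \<noteq> (\<lambda>x. 0) \<longrightarrow> \<not> compact_op M (mult_op M f))"

definition locally_compact_op :: "'a::topological_space measure \<Rightarrow> 'a l2_op \<Rightarrow> bool" where
  "locally_compact_op M T \<longleftrightarrow>
     (\<forall>f\<in>C0. compact_op M (compose (L2 M) T (mult_op M f)) \<and>
             compact_op M (compose (L2 M) (mult_op M f) T))"

text \<open>If one of the supports is empty then the product vanishes for trivial reasons, so the
  convention \<open>setdist {} A = 0\<close> is immaterial.\<close>

definition finite_propagation :: "'a::metric_space measure \<Rightarrow> 'a l2_op \<Rightarrow> bool" where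
  "finite_propagation M T \<longleftrightarrow>
     (\<exists>R>0. \<forall>f\<in>C0. \<forall>g\<in>C0. setdist (fun_supp f) (fun_supp g) > R \<longrightarrow>
        compose (L2 M) (mult_op M f) (compose (L2 M) T (mult_op M g))
          = (\<lambda>U\<in>L2 M. L2_zero M))"

text \<open>The field \<open>one\<close> of the record stays the identity operator, which in general is not in the
  carrier; the unitization below does not refer to it.\<close>

definition roe_algebra :: "'a::metric_space measure \<Rightarrow> 'a l2_op star_alg" where
  "roe_algebra M = (bounded_ops M)
     \<lparr> carrier := {T. bounded_op M T \<and>
         (\<forall>\<epsilon>>0. \<exists>S. bounded_op M S \<and> locally_compact_op M S \<and> finite_propagation M S \<and>
             op_dist M T S < \<epsilon>)} \<rparr>"


section \<open>Wannier bases\<close>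

definition wannier_basis ::
    "'a::metric_space measure \<Rightarrow> 'a set \<Rightarrow> ('a \<Rightarrow> ('a \<Rightarrow> complex) set) \<Rightarrow> bool" where
  "wannier_basis M D \<phi> \<longleftrightarrow>
     (\<forall>x\<in>D. \<phi> x \<in> L2 M) \<and>
     (\<forall>x\<in>D. \<forall>y\<in>D. L2_inner M (\<phi> x) (\<phi> y) = (if x = y then 1 else 0)) \<and>
     (\<exists>R>0. \<forall>x\<in>D. ess_supp M (\<phi> x) \<subseteq> cball x R)"

definition wannier_projection ::
    "'a measure \<Rightarrow> 'a set \<Rightarrow> ('a \<Rightarrow> ('a \<Rightarrow> complex) set) \<Rightarrow> 'a l2_op" where
  "wannier_projection M D \<phi> = orth_proj M (closed_span M \<phi> D)"


section \<open>K-theory in degree zero\<close>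

text \<open>An \<open>m \<times> n\<close> matrix is a function of two indices that vanishes outside the index range.\<close>

definition mats :: "'b star_alg \<Rightarrow> nat \<Rightarrow> nat \<Rightarrow> (nat \<Rightarrow> nat \<Rightarrow> 'b) set" where
  "mats B m n = {a. \<forall>i j. if i < m \<and> j < n then a i j \<in> carrier B else a i j = \<zero>\<^bsub>B\<^esub>}"

text \<open>Product of an \<open>l \<times> n\<close> matrix and an \<open>n \<times> m\<close> matrix; the argument \<open>n\<close> is the inner dimension.\<close>

definition mats_mult ::
    "'b star_alg \<Rightarrow> nat \<Rightarrow> (nat \<Rightarrow> nat \<Rightarrow> 'b) \<Rightarrow> (nat \<Rightarrow> nat \<Rightarrow> 'b) \<Rightarrow> (nat \<Rightarrow> nat \<Rightarrow> 'b)" where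
  "mats_mult B n a b = (\<lambda>i j. finsum B (\<lambda>k. a i k \<otimes>\<^bsub>B\<^esub> b k j) {..<n})"

definition mats_star :: "'b star_alg \<Rightarrow> (nat \<Rightarrow> nat \<Rightarrow> 'b) \<Rightarrow> (nat \<Rightarrow> nat \<Rightarrow> 'b)" where
  "mats_star B a = (\<lambda>i j. star B (a j i))"

type_synonym 'b sq_mat = "nat \<times> (nat \<Rightarrow> nat \<Rightarrow> 'b)"

definition projections :: "'b star_alg \<Rightarrow> 'b sq_mat set" where
  "projections B = {(n, p). p \<in> mats B n n \<and> mats_mult B n p p = p \<and> mats_star B p = p}"

definition murray_von_neumann :: "'b star_alg \<Rightarrow> 'b sq_mat \<Rightarrow> 'b sq_mat \<Rightarrow> bool" where
  "murray_von_neumann B = (\<lambda>(n, p) (m, q). \<exists>v\<in>mats B m n.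
     mats_mult B m (mats_star B v) v = p \<and> mats_mult B n v (mats_star B v) = q)"

definition block_sum :: "'b star_alg \<Rightarrow> 'b sq_mat \<Rightarrow> 'b sq_mat \<Rightarrow> 'b sq_mat" where
  "block_sum B = (\<lambda>(n, p) (m, q). (n + m,
     \<lambda>i j. if i < n \<and> j < n then p i j
           else if n \<le> i \<and> n \<le> j then q (i - n) (j - n)
           else \<zero>\<^bsub>B\<^esub>))"

definition zero_proj :: "'b star_alg \<Rightarrow> 'b sq_mat" where
  "zero_proj B = (1, \<lambda>i j. \<zero>\<^bsub>B\<^esub>)"

text \<open>The Grothendieck group of the Murray-von Neumann semigroup of a unital algebra: a pair
  \<open>(p, q)\<close> represents the formal difference \<open>[p] - [q]\<close>.\<close>

definition K00_rel :: "'b star_alg \<Rightarrow> (('b sq_mat \<times> 'b sq_mat) \<times> ('b sq_mat \<times> 'b sq_mat)) set" where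
  "K00_rel B = {((p, q), (p', q')).
     p \<in> projections B \<and> q \<in> projections B \<and> p' \<in> projections B \<and> q' \<in> projections B \<and>
     (\<exists>r\<in>projections B. murray_von_neumann B
        (block_sum B (block_sum B p q') r) (block_sum B (block_sum B p' q) r))}"

definition K00_class ::
    "'b star_alg \<Rightarrow> 'b sq_mat \<times> 'b sq_mat \<Rightarrow> ('b sq_mat \<times> 'b sq_mat) set" where
  "K00_class B x = K00_rel B `` {x}"

definition K00 :: "'b star_alg \<Rightarrow> ('b sq_mat \<times> 'b sq_mat) set monoid" where
  "K00 B =
     \<lparr> carrier = (projections B \<times> projections B) // K00_rel B,
       monoid.mult = (\<lambda>\<xi> \<eta>. K00_class B
         (block_sum B (fst (rep \<xi>)) (fst (rep \<eta>)), block_sum B (snd (rep \<xi>)) (snd (rep \<eta>)))),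
       one = K00_class B (zero_proj B, zero_proj B) \<rparr>"

definition K00_map ::
    "'c star_alg \<Rightarrow> ('b \<Rightarrow> 'c) \<Rightarrow> ('b sq_mat \<times> 'b sq_mat) set \<Rightarrow> ('c sq_mat \<times> 'c sq_mat) set" where
  "K00_map C h \<xi> =
     (let push = (\<lambda>(n, p). (n, \<lambda>i j. h (p i j)))
      in K00_class C (push (fst (rep \<xi>)), push (snd (rep \<xi>))))"

definition complex_alg :: "complex star_alg" where
  "complex_alg =
     \<lparr> carrier = UNIV, monoid.mult = (*), one = 1, zero = 0, add = (+), smult = (*), star = cnj \<rparr>"

definition unitization :: "'b star_alg \<Rightarrow> ('b \<times> complex) star_alg" where
  "unitization A =
     \<lparr> carrier = carrier A \<times> UNIV,
       monoid.mult = (\<lambda>(a, s) (b, t).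
         ((a \<otimes>\<^bsub>A\<^esub> b) \<oplus>\<^bsub>A\<^esub> ((s \<odot>\<^bsub>A\<^esub> b) \<oplus>\<^bsub>A\<^esub> (t \<odot>\<^bsub>A\<^esub> a)), s * t)),
       one = (\<zero>\<^bsub>A\<^esub>, 1),
       zero = (\<zero>\<^bsub>A\<^esub>, 0),
       add = (\<lambda>(a, s) (b, t). (a \<oplus>\<^bsub>A\<^esub> b, s + t)),
       smult = (\<lambda>c (a, s). (c \<odot>\<^bsub>A\<^esub> a, c * s)),
       star = (\<lambda>(a, s). (star A a, cnj s)) \<rparr>"

text \<open>For a possibly non-unital \<open>A\<close>, the group is the kernel of the map induced by the canonical
  character of the unitization. The group operation is written multiplicatively, so its neutral
  element is \<open>\<one>\<close>.\<close>

definition K0 :: "'b star_alg \<Rightarrow> (('b \<times> complex) sq_mat \<times> ('b \<times> complex) sq_mat) set monoid" where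
  "K0 A = (K00 (unitization A))
     \<lparr> carrier := {\<xi> \<in> carrier (K00 (unitization A)).
         K00_map complex_alg snd \<xi> = \<one>\<^bsub>K00 complex_alg\<^esub>} \<rparr>"

text \<open>The class of a projection \<open>p\<close> of \<open>A\<close>, viewed as a \<open>1 \<times> 1\<close> matrix over the unitization. It is
  the empty set, hence not an element of \<open>K0 A\<close>, unless \<open>p\<close> is a projection in \<open>A\<close>.\<close>

definition K0_class ::
    "'b star_alg \<Rightarrow> 'b \<Rightarrow> (('b \<times> complex) sq_mat \<times> ('b \<times> complex) sq_mat) set" where
  "K0_class A p = K00_class (unitization A)
     ((1, \<lambda>i j. if i = 0 \<and> j = 0 then (p, 0) else \<zero>\<^bsub>unitization A\<^esub>), zero_proj (unitization A))"

end

theory Submission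
  imports Defs
begin

text \<open>
  The idea is an Eilenberg swindle. Since the space is connected, proper and unbounded, every point
  \<open>x\<close> is the start of a ray \<open>\<gamma>\<^sub>x\<close> with steps of length at most 1, such that every
  bounded set meets only finitely many of the rays starting in \<open>D0\<close>: all points outside a bounded
  set lie in unbounded chain components of the complement of a given ball, and there a ray can be
  continued to infinity without returning to the ball. As the measure is non-atomic and charges
  every ball, the vectors \<open>\<phi>\<^sub>x = \<psi>\<^sub>x\<^sub>,\<^sub>0\<close> extend to an orthonormal family
  \<open>\<psi>\<^sub>x\<^sub>,\<^sub>k\<close> with \<open>\<psi>\<^sub>x\<^sub>,\<^sub>k\<close> supported near \<open>\<gamma>\<^sub>x(k)\<close>. The shift
  \<open>\<psi>\<^sub>x\<^sub>,\<^sub>k \<mapsto> \<psi>\<^sub>x\<^sub>,\<^sub>k\<^sub>+\<^sub>1\<close> is a partial isometry of finite propagation, and it is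
  locally compact because the family is locally finite. It identifies the projection onto the whole
  span with the projection onto the span of the vectors with \<open>k \<ge> 1\<close>; the difference of the two
  is the Wannier projection, whose class is therefore zero.
\<close>

section \<open>The Hilbert space structure of L2\<close>

text \<open>The obstacle is local finiteness. That every single ray escapes to infinity is not
  enough: infinitely many rays could cross the same ball, and local compactness would fail there. A
  ray therefore carries a level, a radius below which it never falls again, and it starts at the
  highest level that its starting point admits; this level tends to infinity with the starting
  point. How many rays cross a given ball is otherwise free: by non-atomicity \<open>L2\<close> of a
  ball is infinite-dimensional, so each new vector can be made orthogonal to all earlier ones,
  wherever these live, without a count of overlaps. In K-theory, let \<open>p\<close> be the Wannier
  projection and \<open>q\<close> the projection onto the vectors with \<open>k \<ge> 1\<close>. The
  shift splits into a part \<open>a\<close> on the range of \<open>p\<close> and a part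
  \<open>b\<close> on the range of \<open>q\<close>, whence \<open>[p] + [q] = [q]\<close>, and
  \<open>[q]\<close> cancels in the Grothendieck group. Operators are built from bounded
  sesquilinear forms and compared through their matrix coefficients, so that no series of vectors
  has to be summed in norm.\<close>

lemma L2_funD:
  assumes "f \<in> L2_fun M"
  shows "f \<in> borel_measurable M" "integrable M (\<lambda>x. (cmod (f x))\<^sup>2)"
  using assms by (auto simp: L2_fun_def)

lemma L2_fun_bounded_mult:
  assumes f: "f \<in> L2_fun M" and h: "h \<in> borel_measurable M" and C: "\<And>x. cmod (h x) \<le> C"
  shows "(\<lambda>x. h x * f x) \<in> L2_fun M"
proof -
  have "integrable M (\<lambda>x. (cmod (h x * f x))\<^sup>2)"
  proof (rule Bochner_Integration.integrable_bound)
    show "integrable M (\<lambda>x. C\<^sup>2 * (cmod (f x))\<^sup>2)"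
      using L2_funD(2)[OF f] by simp
    show "(\<lambda>x. (cmod (h x * f x))\<^sup>2) \<in> borel_measurable M"
      using L2_funD(1)[OF f] h by measurable
    have "(cmod (h x))\<^sup>2 * (cmod (f x))\<^sup>2 \<le> C\<^sup>2 * (cmod (f x))\<^sup>2" for x
      by (intro mult_right_mono power_mono C) auto
    then show "AE x in M. norm ((cmod (h x * f x))\<^sup>2) \<le> norm (C\<^sup>2 * (cmod (f x))\<^sup>2)"
      by (simp add: norm_mult power_mult_distrib abs_mult)
  qed
  then show ?thesis
    using L2_funD(1)[OF f] h by (simp add: L2_fun_def)
qed

lemma L2_fun_cmult: "f \<in> L2_fun M \<Longrightarrow> (\<lambda>x. c * f x) \<in> L2_fun M"
  by (rule L2_fun_bounded_mult[where C = "cmod c"]) auto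

lemma L2_fun_add:
  assumes f: "f \<in> L2_fun M" and g: "g \<in> L2_fun M"
  shows "(\<lambda>x. f x + g x) \<in> L2_fun M"
proof -
  have "(cmod (f x + g x))\<^sup>2 \<le> 2 * (cmod (f x))\<^sup>2 + 2 * (cmod (g x))\<^sup>2" for x
  proof -
    have "(cmod (f x + g x))\<^sup>2 \<le> (cmod (f x) + cmod (g x))\<^sup>2"
      by (intro power_mono norm_triangle_ineq) auto
    also have "\<dots> \<le> 2 * (cmod (f x))\<^sup>2 + 2 * (cmod (g x))\<^sup>2"
      using sum_squares_bound[of "cmod (f x)" "cmod (g x)"] by (simp add: power2_sum)
    finally show ?thesis .
  qed
  then have "integrable M (\<lambda>x. (cmod (f x + g x))\<^sup>2)"
    using L2_funD[OF f] L2_funD[OF g]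
    by - (rule Bochner_Integration.integrable_bound
        [of M "\<lambda>x. 2 * (cmod (f x))\<^sup>2 + 2 * (cmod (g x))\<^sup>2"], simp_all)
  then show ?thesis
    using L2_funD(1)[OF f] L2_funD(1)[OF g] by (simp add: L2_fun_def)
qed

lemma L2_fun_diff: "f \<in> L2_fun M \<Longrightarrow> g \<in> L2_fun M \<Longrightarrow> (\<lambda>x. f x - g x) \<in> L2_fun M"
  using L2_fun_add[of f M "\<lambda>x. (- 1) * g x"] L2_fun_cmult[of g M "- 1"] by simp

lemma L2_fun_zero: "(\<lambda>x. 0) \<in> L2_fun M"
  by (simp add: L2_fun_def)

lemma L2_fun_sum:
  "(\<And>i. i \<in> F \<Longrightarrow> f i \<in> L2_fun M) \<Longrightarrow> (\<lambda>x. \<Sum>i\<in>F. f i x) \<in> L2_fun M"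
  by (induction F rule: infinite_finite_induct) (auto intro: L2_fun_zero L2_fun_add)

lemma integrable_L2_fun_inner:
  assumes f: "f \<in> L2_fun M" and g: "g \<in> L2_fun M"
  shows "integrable M (\<lambda>x. cnj (f x) * g x)"
proof -
  have "cmod (f x) * cmod (g x) \<le> (cmod (f x))\<^sup>2 + (cmod (g x))\<^sup>2" for x
    using sum_squares_bound[of "cmod (f x)" "cmod (g x)"]
      mult_nonneg_nonneg[OF norm_ge_zero norm_ge_zero, of "f x" "g x"] by linarith
  moreover have "(\<lambda>x. cnj (f x)) \<in> borel_measurable M"
    by (rule borel_measurable_continuous_on[OF _ L2_funD(1)[OF f]]) (intro continuous_intros)
  ultimately show ?thesis
    using L2_funD[OF f] L2_funD[OF g]
    by - (rule Bochner_Integration.integrable_bound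
        [of M "\<lambda>x. (cmod (f x))\<^sup>2 + (cmod (g x))\<^sup>2"], simp_all add: norm_mult)
qed

lemma equiv_L2_rel: "equiv (L2_fun M) (L2_rel M)"
proof (intro equivI refl_onI symI transI)
  fix f g h
  show "(g, f) \<in> L2_rel M" if "(f, g) \<in> L2_rel M"
    using that by (simp add: L2_rel_def eq_commute)
  assume "(f, g) \<in> L2_rel M" "(g, h) \<in> L2_rel M"
  then have *: "f \<in> L2_fun M" "h \<in> L2_fun M" and "AE x in M. f x = g x" "AE x in M. g x = h x"
    by (simp_all add: L2_rel_def)
  from this(3,4) have "AE x in M. f x = h x"
    by eventually_elim simp
  with * show "(f, h) \<in> L2_rel M"
    by (simp add: L2_rel_def)
qed (auto simp: L2_rel_def)

lemma L2_class_in: "f \<in> L2_fun M \<Longrightarrow> L2_class M f \<in> L2 M"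
  by (simp add: L2_def L2_class_def quotientI)

lemma rep_in: "U \<in> L2 M \<Longrightarrow> rep U \<in> U"
  unfolding rep_def L2_def
  using in_quotient_imp_non_empty[OF equiv_L2_rel, of U M] by (simp add: some_in_eq)

lemma rep_in_L2_fun: "U \<in> L2 M \<Longrightarrow> rep U \<in> L2_fun M"
  using rep_in[of U M] in_quotient_imp_subset[OF equiv_L2_rel, of U M] by (auto simp: L2_def)

lemma L2_class_eqI: "f \<in> L2_fun M \<Longrightarrow> g \<in> L2_fun M \<Longrightarrow> AE x in M. f x = g x \<Longrightarrow> L2_class M f = L2_class M g"
  unfolding L2_class_def
  by (rule equiv_class_eq[OF equiv_L2_rel]) (simp add: L2_rel_def)

lemma L2_class_rep: "U \<in> L2 M \<Longrightarrow> L2_class M (rep U) = U"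
  unfolding L2_class_def L2_def
  using equiv_L2_rel rep_in[unfolded L2_def] Image_singleton_iff equiv_class_eq_iff
    quotientE by (metis (no_types, lifting))

lemma AE_rep_class:
  assumes "f \<in> L2_fun M"
  shows "AE x in M. rep (L2_class M f) x = f x"
proof -
  have "rep (L2_class M f) \<in> L2_class M f"
    using rep_in L2_class_in assms by blast
  moreover have "L2_class M f \<subseteq> {g. AE x in M. f x = g x}"
    by (auto simp: L2_class_def L2_rel_def)
  ultimately have "AE x in M. f x = rep (L2_class M f) x"
    by blast
  then show ?thesis
    by eventually_elim simp
qed

lemma L2_eqI: "U \<in> L2 M \<Longrightarrow> V \<in> L2 M \<Longrightarrow> AE x in M. rep U x = rep V x \<Longrightarrow> U = V"
  by (metis L2_class_eqI L2_class_rep rep_in_L2_fun)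

lemma L2_closed [simp, intro]:
  shows "L2_zero M \<in> L2 M"
    and "U \<in> L2 M \<Longrightarrow> L2_scale M c U \<in> L2 M"
    and "U \<in> L2 M \<Longrightarrow> V \<in> L2 M \<Longrightarrow> L2_add M U V \<in> L2 M"
    and "U \<in> L2 M \<Longrightarrow> V \<in> L2 M \<Longrightarrow> L2_diff M U V \<in> L2 M"
  by (simp_all add: L2_zero_def L2_scale_def L2_add_def L2_diff_def L2_class_in L2_fun_zero
      L2_fun_cmult L2_fun_add L2_fun_diff rep_in_L2_fun)

lemma AE_rep:
  shows "AE x in M. rep (L2_zero M) x = 0"
    and "U \<in> L2 M \<Longrightarrow> AE x in M. rep (L2_scale M c U) x = c * rep U x"
    and "U \<in> L2 M \<Longrightarrow> V \<in> L2 M \<Longrightarrow> AE x in M. rep (L2_add M U V) x = rep U x + rep V x"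
    and "U \<in> L2 M \<Longrightarrow> V \<in> L2 M \<Longrightarrow> AE x in M. rep (L2_diff M U V) x = rep U x - rep V x"
  unfolding L2_zero_def L2_scale_def L2_add_def L2_diff_def
  by (rule AE_rep_class; simp add: L2_fun_zero L2_fun_cmult L2_fun_add L2_fun_diff rep_in_L2_fun)+

lemma L2_inner_class:
  assumes U: "U \<in> L2 M" and f: "f \<in> L2_fun M"
  shows "L2_inner M U (L2_class M f) = (\<integral>x. cnj (rep U x) * f x \<partial>M)"
  unfolding L2_inner_def
  using integrable_L2_fun_inner[OF rep_in_L2_fun[OF U] f]
    integrable_L2_fun_inner[OF rep_in_L2_fun[OF U] rep_in_L2_fun[OF L2_class_in[OF f]]]
    AE_rep_class[OF f]
  by (intro integral_cong_AE) (auto dest: borel_measurable_integrable)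

lemma L2_inner_commute: "L2_inner M V U = cnj (L2_inner M U V)"
  using Bochner_Integration.integral_cnj[of M "\<lambda>x. cnj (rep U x) * rep V x"]
  by (simp add: L2_inner_def mult.commute)

lemma L2_inner_right [simp]:
  assumes "W \<in> L2 M"
  shows "L2_inner M W (L2_zero M) = 0"
    and "U \<in> L2 M \<Longrightarrow> L2_inner M W (L2_scale M c U) = c * L2_inner M W U"
    and "U \<in> L2 M \<Longrightarrow> V \<in> L2 M \<Longrightarrow>
      L2_inner M W (L2_add M U V) = L2_inner M W U + L2_inner M W V"
    and "U \<in> L2 M \<Longrightarrow> V \<in> L2 M \<Longrightarrow>
      L2_inner M W (L2_diff M U V) = L2_inner M W U - L2_inner M W V"
proof -
  show "L2_inner M W (L2_zero M) = 0"
    by (simp add: L2_zero_def L2_inner_class assms L2_fun_zero)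
  show "L2_inner M W (L2_scale M c U) = c * L2_inner M W U" if "U \<in> L2 M"
    using that integral_mult_right_zero[of M c "\<lambda>x. cnj (rep W x) * rep U x"]
    by (simp add: L2_scale_def L2_inner_class assms L2_fun_cmult rep_in_L2_fun)
      (simp add: L2_inner_def mult_ac)
  note [simp] = integrable_L2_fun_inner[OF rep_in_L2_fun[OF assms] rep_in_L2_fun]
  show "L2_inner M W (L2_add M U V) = L2_inner M W U + L2_inner M W V" if "U \<in> L2 M" "V \<in> L2 M"
    using that
    by (simp add: L2_add_def L2_inner_class assms L2_fun_add rep_in_L2_fun distrib_left)
      (simp add: L2_inner_def)
  show "L2_inner M W (L2_diff M U V) = L2_inner M W U - L2_inner M W V" if "U \<in> L2 M" "V \<in> L2 M"
    using that
    by (simp add: L2_diff_def L2_inner_class assms L2_fun_diff rep_in_L2_fun right_diff_distrib)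
      (simp add: L2_inner_def)
qed

lemma L2_inner_left [simp]:
  assumes "W \<in> L2 M"
  shows "L2_inner M (L2_zero M) W = 0"
    and "U \<in> L2 M \<Longrightarrow> L2_inner M (L2_scale M c U) W = cnj c * L2_inner M U W"
    and "U \<in> L2 M \<Longrightarrow> V \<in> L2 M \<Longrightarrow>
      L2_inner M (L2_add M U V) W = L2_inner M U W + L2_inner M V W"
    and "U \<in> L2 M \<Longrightarrow> V \<in> L2 M \<Longrightarrow>
      L2_inner M (L2_diff M U V) W = L2_inner M U W - L2_inner M V W"
  using L2_inner_right[OF assms] L2_inner_commute[of M _ W]
  by (metis complex_cnj_zero, metis complex_cnj_mult, metis complex_cnj_add, metis complex_cnj_diff)

lemma cmod_square_eq: "(complex_of_real (cmod c))\<^sup>2 = c * cnj c"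
  by (metis complex_norm_square of_real_power)

lemma L2_norm_nonneg [simp]: "0 \<le> L2_norm M U"
  by (simp add: L2_norm_def)

lemma L2_inner_self: "L2_inner M U U = complex_of_real ((L2_norm M U)\<^sup>2)"
proof -
  have "cnj z * z = complex_of_real ((cmod z)\<^sup>2)" for z
    by (metis complex_norm_square mult.commute of_real_power)
  then show ?thesis
    by (simp add: L2_inner_def L2_norm_def flip: of_real_power)
qed

lemma L2_norm_square: "(L2_norm M U)\<^sup>2 = Re (L2_inner M U U)"
  by (simp add: L2_inner_self)

lemma L2_norm_eq_0: 
  assumes "U \<in> L2 M"
  shows "L2_norm M U = 0 \<longleftrightarrow> U = L2_zero M"
proof
  assume "L2_norm M U = 0"
  then have "AE x in M. (cmod (rep U x))\<^sup>2 = 0"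
    using L2_funD[OF rep_in_L2_fun[OF assms]]
    by (simp add: L2_norm_def integral_nonneg_eq_0_iff_AE)
  then have "AE x in M. rep U x = rep (L2_zero M) x"
    using AE_rep(1)[of M] by eventually_elim simp
  then show "U = L2_zero M"
    using assms by (intro L2_eqI) auto
next
  assume "U = L2_zero M"
  then have "(L2_norm M U)\<^sup>2 = 0"
    by (simp add: L2_norm_square)
  then show "L2_norm M U = 0" by simp
qed

text \<open>The difference of the two vectors is tested against itself. As \<open>L2 M\<close> is a
  bare set of equivalence classes, this is the standard way to prove vector identities below: they
  become scalar identities, which the simp rules for \<open>L2_inner\<close> settle.\<close>

lemma L2_ext:
  assumes U: "U \<in> L2 M" and V: "V \<in> L2 M"
    and eq: "\<And>W. W \<in> L2 M \<Longrightarrow> L2_inner M W U = L2_inner M W V"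
  shows "U = V"
proof -
  have "L2_inner M (L2_diff M U V) (L2_diff M U V) = 0"
    using eq[of "L2_diff M U V"] U V by simp
  then have "L2_diff M U V = L2_zero M"
    using L2_norm_eq_0[of "L2_diff M U V" M] U V by (simp add: L2_inner_self)
  then have "AE x in M. rep (L2_diff M U V) x = rep (L2_zero M) x"
    by simp
  then have "AE x in M. rep U x = rep V x"
    using AE_rep(4)[OF U V] AE_rep(1)[of M] by eventually_elim simp
  then show ?thesis
    by (rule L2_eqI[OF U V])
qed

lemma L2_Cauchy_Schwarz:
  assumes U: "U \<in> L2 M" and V: "V \<in> L2 M"
  shows "cmod (L2_inner M U V) \<le> L2_norm M U * L2_norm M V"
proof (cases "V = L2_zero M")
  case True
  then show ?thesis using U by simp
next
  case False
  define v where "v = (L2_norm M V)\<^sup>2"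
  define c where "c = L2_inner M V U"
  have v: "v > 0"
    using False L2_norm_eq_0[OF V] by (simp add: v_def)
  have c': "L2_inner M U V = cnj c"
    by (simp add: c_def L2_inner_commute[of M V U])
  \<comment> \<open>This is \<open>v\<close> times the component of \<open>U\<close> orthogonal to
    \<open>V\<close>; the factor \<open>v\<close> avoids a division.\<close>
  define W where "W = L2_diff M (L2_scale M v U) (L2_scale M c V)"
  have "L2_inner M W W = v * (v * L2_inner M U U - cnj c * c)"
    using U V by (simp add: W_def L2_inner_self[of M V] c' algebra_simps flip: v_def c_def)
  also have "\<dots> = complex_of_real (v * (v * (L2_norm M U)\<^sup>2 - (cmod c)\<^sup>2))"
    by (simp add: L2_inner_self cmod_square_eq mult.commute)
  finally have "(L2_norm M W)\<^sup>2 = v * (v * (L2_norm M U)\<^sup>2 - (cmod c)\<^sup>2)"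
    by (simp add: L2_norm_square)
  then have "0 \<le> v * (v * (L2_norm M U)\<^sup>2 - (cmod c)\<^sup>2)"
    by (metis zero_le_power2)
  then have "(cmod c)\<^sup>2 \<le> (L2_norm M U * L2_norm M V)\<^sup>2"
    using v by (simp add: zero_le_mult_iff v_def power_mult_distrib mult.commute)
  then show ?thesis
    by - (rule power2_le_imp_le, auto simp: c')
qed

lemma L2_norm_scale [simp]:
  assumes "U \<in> L2 M"
  shows "L2_norm M (L2_scale M c U) = cmod c * L2_norm M U"
proof (rule power2_eq_imp_eq)
  have "L2_inner M (L2_scale M c U) (L2_scale M c U) = complex_of_real ((cmod c * L2_norm M U)\<^sup>2)"
    using assms by (simp add: L2_inner_self[of M U] power_mult_distrib cmod_square_eq mult.commute)
  then show "(L2_norm M (L2_scale M c U))\<^sup>2 = (cmod c * L2_norm M U)\<^sup>2"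
    by (simp only: L2_norm_square Re_complex_of_real)
qed auto

lemma L2_norm_add_square:
  assumes "U \<in> L2 M" "V \<in> L2 M"
  shows "(L2_norm M (L2_add M U V))\<^sup>2 = (L2_norm M U)\<^sup>2 + 2 * Re (L2_inner M U V) + (L2_norm M V)\<^sup>2"
  using assms by (simp add: L2_norm_square L2_inner_commute[of M V U])

lemma L2_norm_triangle:
  assumes "U \<in> L2 M" "V \<in> L2 M"
  shows "L2_norm M (L2_add M U V) \<le> L2_norm M U + L2_norm M V"
proof (rule power2_le_imp_le)
  have "Re (L2_inner M U V) \<le> L2_norm M U * L2_norm M V"
    using L2_Cauchy_Schwarz[OF assms] complex_Re_le_cmod order_trans by blast
  then show "(L2_norm M (L2_add M U V))\<^sup>2 \<le> (L2_norm M U + L2_norm M V)\<^sup>2"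
    using L2_norm_add_square[OF assms] by (simp add: power2_sum)
qed simp

lemma L2_norm_class:
  assumes "f \<in> L2_fun M"
  shows "L2_norm M (L2_class M f) = sqrt (\<integral>x. (cmod (f x))\<^sup>2 \<partial>M)"
proof -
  have "(\<integral>x. (cmod (rep (L2_class M f) x))\<^sup>2 \<partial>M) = (\<integral>x. (cmod (f x))\<^sup>2 \<partial>M)"
    using AE_rep_class[OF assms] L2_funD[OF assms] L2_funD[OF rep_in_L2_fun[OF L2_class_in[OF assms]]]
    by (intro integral_cong_AE) auto
  then show ?thesis by (simp add: L2_norm_def)
qed

text \<open>No membership assumptions are needed: if the difference is not square integrable then
  both classes are empty.\<close>

lemma L2_norm_diff_commute: "L2_norm M (L2_diff M U V) = L2_norm M (L2_diff M V U)"
proof -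
  let ?f = "\<lambda>x. rep U x - rep V x" and ?g = "\<lambda>x. rep V x - rep U x"
  have fg: "?f \<in> L2_fun M \<longleftrightarrow> ?g \<in> L2_fun M"
    using L2_fun_cmult[of ?f M "- 1"] L2_fun_cmult[of ?g M "- 1"] by auto
  show ?thesis
  proof (cases "?f \<in> L2_fun M")
    case True
    then show ?thesis
      using fg by (simp add: L2_diff_def L2_norm_class norm_minus_commute)
  next
    case False
    then have "L2_class M ?f = {}" "L2_class M ?g = {}"
      using fg by (auto simp: L2_class_def L2_rel_def)
    then show ?thesis by (simp add: L2_diff_def)
  qed
qed

lemma L2_norm_diff_triangle:
  assumes "U \<in> L2 M" "V \<in> L2 M" "W \<in> L2 M"
  shows "L2_norm M (L2_diff M U W) \<le> L2_norm M (L2_diff M U V) + L2_norm M (L2_diff M V W)"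
proof -
  have "L2_diff M U W = L2_add M (L2_diff M U V) (L2_diff M V W)"
    using assms by (intro L2_ext) auto
  then show ?thesis using assms L2_norm_triangle[of "L2_diff M U V" M "L2_diff M V W"] by simp
qed

section \<open>Metric structure and completeness\<close>

lemma Metric_space_L2: "Metric_space (L2 M) (L2_dist M)"
proof
  show "L2_dist M U V = 0 \<longleftrightarrow> U = V" if "U \<in> L2 M" "V \<in> L2 M" for U V
  proof
    assume "L2_dist M U V = 0"
    then have *: "L2_diff M U V = L2_zero M"
      using that by (simp add: L2_dist_def L2_norm_eq_0)
    show "U = V"
    proof (rule L2_ext[OF that])
      fix W assume "W \<in> L2 M"
      then have "L2_inner M W (L2_diff M U V) = 0" by (simp add: *)
      then show "L2_inner M W U = L2_inner M W V" using that \<open>W \<in> L2 M\<close> by simp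
    qed
  next
    assume "U = V"
    then have "(L2_norm M (L2_diff M U V))\<^sup>2 = 0"
      using that by (simp add: L2_norm_square)
    then show "L2_dist M U V = 0" by (simp add: L2_dist_def)
  qed
qed (auto simp: L2_dist_def L2_norm_diff_commute L2_norm_diff_triangle)

text \<open>Makes Cauchy sequences and total boundedness on a carrier set available; compact
  operators are treated with them.\<close>

interpretation L2: Metric_space "L2 M" "L2_dist M" for M
  by (rule Metric_space_L2)

lemma L2_dist_eq:
  assumes "U \<in> L2 M" "V \<in> L2 M"
  shows "L2_dist M U V = sqrt (\<integral>x. (cmod (rep U x - rep V x))\<^sup>2 \<partial>M)"
  using assms by (simp add: L2_dist_def L2_diff_def L2_norm_class L2_fun_diff rep_in_L2_fun)

lemma L2_dist_nn_integral:
  assumes "U \<in> L2 M" "V \<in> L2 M"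
  shows "(\<integral>\<^sup>+x. ennreal ((cmod (rep U x - rep V x))\<^sup>2) \<partial>M) = ennreal ((L2_dist M U V)\<^sup>2)"
  using L2_funD(2)[OF L2_fun_diff[OF rep_in_L2_fun[OF assms(1)] rep_in_L2_fun[OF assms(2)]]]
  by (simp add: L2_dist_eq assms nn_integral_eq_integral)

text \<open>First half of Riesz-Fischer. With the weights \<open>4 ^ k\<close> the integrals of the
  squared increments are still at most \<open>(1 / 4) ^ k\<close>, so the weighted sum is finite
  almost everywhere; at such a point the increments are dominated by a multiple of
  \<open>(1 / 2) ^ k\<close>, and the telescoping series converges absolutely.\<close>

lemma AE_convergent_if_fast_Cauchy:
  assumes U: "\<And>k. U k \<in> L2 M" and fast: "\<And>k. L2_dist M (U (Suc k)) (U k) < (1 / 4) ^ k"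
  shows "AE x in M. convergent (\<lambda>k. rep (U k) x)"
proof -
  define d where "d k x = cmod (rep (U (Suc k)) x - rep (U k) x)" for k x
  have [measurable]: "rep (U k) \<in> borel_measurable M" for k
    by (rule L2_funD(1)[OF rep_in_L2_fun[OF U]])
  have [measurable]: "d k \<in> borel_measurable M" for k
    unfolding d_def by measurable
  have int: "(\<integral>\<^sup>+x. ennreal (4 ^ k * (d k x)\<^sup>2) \<partial>M) \<le> ennreal ((1 / 4) ^ k)" for k
  proof -
    have "(\<integral>\<^sup>+x. ennreal (4 ^ k * (d k x)\<^sup>2) \<partial>M) = ennreal (4 ^ k) * (\<integral>\<^sup>+x. ennreal ((d k x)\<^sup>2) \<partial>M)"
      by (subst nn_integral_cmult[symmetric]) (auto simp: ennreal_mult)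
    also have "\<dots> = ennreal (4 ^ k * (L2_dist M (U (Suc k)) (U k))\<^sup>2)"
      by (simp add: d_def L2_dist_nn_integral U ennreal_mult)
    also have "\<dots> \<le> ennreal (4 ^ k * ((1 / 4) ^ k)\<^sup>2)"
      using fast[of k] by (intro ennreal_leI mult_left_mono power_mono) (auto simp: less_imp_le)
    also have "4 ^ k * ((1 / 4) ^ k)\<^sup>2 = (1 / 4 :: real) ^ k"
      by (simp add: power2_eq_square field_simps flip: power_mult_distrib)
    finally show ?thesis .
  qed
  have "(\<integral>\<^sup>+x. (\<Sum>k. ennreal (4 ^ k * (d k x)\<^sup>2)) \<partial>M) = (\<Sum>k. \<integral>\<^sup>+x. ennreal (4 ^ k * (d k x)\<^sup>2) \<partial>M)"
    by (intro nn_integral_suminf) auto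
  also have "\<dots> \<le> (\<Sum>k. ennreal ((1 / 4) ^ k))"
    by (intro suminf_le int) auto
  also have "\<dots> = ennreal (\<Sum>k. (1 / 4) ^ k)"
    by (intro suminf_ennreal2 summable_geometric) auto
  finally have "(\<integral>\<^sup>+x. (\<Sum>k. ennreal (4 ^ k * (d k x)\<^sup>2)) \<partial>M) \<noteq> \<infinity>"
    by (auto simp: top_unique)
  then have "AE x in M. (\<Sum>k. ennreal (4 ^ k * (d k x)\<^sup>2)) \<noteq> \<infinity>"
    by (intro nn_integral_PInf_AE) auto
  then show ?thesis
  proof eventually_elim
    case (elim x)
    define C where "C = enn2real (\<Sum>k. ennreal (4 ^ k * (d k x)\<^sup>2))"
    have le: "d k x \<le> sqrt C * (1 / 2) ^ k" for k
    proof -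
      have "ennreal (4 ^ k * (d k x)\<^sup>2) = (\<Sum>j\<in>{k}. ennreal (4 ^ j * (d j x)\<^sup>2))"
        by simp
      also have "\<dots> \<le> (\<Sum>k. ennreal (4 ^ k * (d k x)\<^sup>2))"
        by (intro sum_le_suminf) auto
      also have "\<dots> = ennreal C"
        using elim by (simp add: C_def less_top)
      finally have "4 ^ k * (d k x)\<^sup>2 \<le> C"
        by (subst (asm) ennreal_le_iff) (auto simp: C_def)
      moreover have "(4::real) ^ k = 2 ^ k * 2 ^ k"
        by (simp flip: power_mult_distrib)
      ultimately have "(2 ^ k * d k x)\<^sup>2 \<le> C"
        by (simp add: power2_eq_square mult_ac)
      then have "2 ^ k * d k x \<le> sqrt C"
        by (rule real_le_rsqrt)
      then show ?thesis by (simp add: field_simps)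
    qed
    have "summable (\<lambda>k. rep (U (Suc k)) x - rep (U k) x)"
      by (rule summable_comparison_test'[where g = "\<lambda>k. sqrt C * (1 / 2) ^ k" and N = 0])
        (use le in \<open>auto simp: d_def intro!: summable_mult summable_geometric\<close>)
    then have "convergent (\<lambda>n. \<Sum>k<n. rep (U (Suc k)) x - rep (U k) x)"
      by (simp add: summable_iff_convergent)
    then have "convergent (\<lambda>n. (rep (U n) x - rep (U 0) x) + rep (U 0) x)"
      by (intro convergent_add convergent_const) (simp add: sum_lessThan_telescope[where f = "\<lambda>n. rep (U n) x"])
    then show ?case by simp
  qed
qed

text \<open>Second half of Riesz-Fischer: a fast subsequence has a pointwise limit, and Fatou's
  lemma carries the Cauchy estimate over to that limit.\<close>

lemma L2_complete:
  assumes U: "\<And>n. U n \<in> L2 M"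
    and Cauchy: "\<And>e. e > 0 \<Longrightarrow> \<exists>N. \<forall>n\<ge>N. \<forall>m\<ge>N. L2_dist M (U n) (U m) < e"
  obtains V where "V \<in> L2 M" "(\<lambda>n. L2_dist M (U n) V) \<longlonglongrightarrow> 0"
proof -
  have "\<forall>k. \<exists>N. \<forall>n\<ge>N. \<forall>m\<ge>N. L2_dist M (U n) (U m) < (1 / 4) ^ k"
    using Cauchy by simp
  then obtain N where N: "\<And>k n m. n \<ge> N k \<Longrightarrow> m \<ge> N k \<Longrightarrow> L2_dist M (U n) (U m) < (1 / 4) ^ k"
    by metis
  \<comment> \<open>Summing all earlier thresholds makes \<open>r\<close> nondecreasing, so that
    \<open>r (Suc k)\<close> is also above \<open>N k\<close>; the summand \<open>k\<close> sends it
    to infinity.\<close>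
  define r where "r k = k + (\<Sum>j\<le>k. N j)" for k
  have r_ge: "r k \<ge> N k" "r k \<ge> k" "r (Suc k) \<ge> r k" for k
    unfolding r_def using member_le_sum[of k "{..k}" N] by auto
  define g where "g k = rep (U (r k))" for k
  have g [measurable]: "g k \<in> borel_measurable M" for k
    unfolding g_def by (rule L2_funD(1)[OF rep_in_L2_fun[OF U]])
  have conv: "AE x in M. convergent (\<lambda>k. g k x)"
    unfolding g_def
    by (rule AE_convergent_if_fast_Cauchy) (use U N r_ge in \<open>blast intro: order_trans\<close>)+
  define f where "f x = lim (\<lambda>k. g k x)" for x
  have f [measurable]: "f \<in> borel_measurable M"
    unfolding f_def by measurable
  have fatou: "(\<integral>\<^sup>+x. ennreal ((cmod (rep (U n) x - f x))\<^sup>2) \<partial>M) \<le> ennreal (e\<^sup>2)"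
    if n: "\<forall>m\<ge>K. L2_dist M (U n) (U m) < e" for n e K
  proof -
    have [measurable]: "rep (U n) \<in> borel_measurable M"
      by (rule L2_funD(1)[OF rep_in_L2_fun[OF U]])
    have "(\<integral>\<^sup>+x. ennreal ((cmod (rep (U n) x - f x))\<^sup>2) \<partial>M)
        = (\<integral>\<^sup>+x. liminf (\<lambda>k. ennreal ((cmod (rep (U n) x - g k x))\<^sup>2)) \<partial>M)"
    proof (rule nn_integral_cong_AE)
      show "AE x in M. ennreal ((cmod (rep (U n) x - f x))\<^sup>2)
          = liminf (\<lambda>k. ennreal ((cmod (rep (U n) x - g k x))\<^sup>2))"
        using conv
      proof eventually_elim
        case (elim x)
        then have "(\<lambda>k. g k x) \<longlonglongrightarrow> f x"
          by (simp add: f_def convergent_LIMSEQ_iff)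
        then have "(\<lambda>k. ennreal ((cmod (rep (U n) x - g k x))\<^sup>2)) \<longlonglongrightarrow> ennreal ((cmod (rep (U n) x - f x))\<^sup>2)"
          by (intro tendsto_intros)
        then show ?case
          by (metis lim_imp_Liminf trivial_limit_sequentially)
      qed
    qed
    also have "\<dots> \<le> liminf (\<lambda>k. \<integral>\<^sup>+x. ennreal ((cmod (rep (U n) x - g k x))\<^sup>2) \<partial>M)"
      by (intro nn_integral_liminf) measurable
    also have "\<dots> \<le> ennreal (e\<^sup>2)"
    proof (rule Liminf_le)
      show "eventually (\<lambda>k. (\<integral>\<^sup>+x. ennreal ((cmod (rep (U n) x - g k x))\<^sup>2) \<partial>M) \<le> ennreal (e\<^sup>2)) sequentially"
        using eventually_ge_at_top[of K]
      proof eventually_elim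
        case (elim k)
        then have "L2_dist M (U n) (U (r k)) < e"
          using n r_ge(2)[of k] by auto
        then show ?case
          unfolding g_def L2_dist_nn_integral[OF U U]
          by (intro ennreal_leI power_mono) auto
      qed
    qed simp
    finally show ?thesis .
  qed
  have diff: "(\<lambda>x. rep (U n) x - f x) \<in> L2_fun M" if n: "\<forall>m\<ge>K. L2_dist M (U n) (U m) < e" for n e K
    using fatou[OF n] L2_funD(1)[OF rep_in_L2_fun[OF U], of n]
    by (auto simp: L2_fun_def integrable_iff_bounded le_less_trans[OF _ ennreal_less_top])
  \<comment> \<open>Fatou controls only differences from \<open>f\<close>, so \<open>f\<close> is
    recovered as a representative minus such a difference.\<close>
  have "f \<in> L2_fun M"
  proof -
    have "\<forall>m\<ge>N 0. L2_dist M (U (N 0)) (U m) < (1 / 4) ^ 0"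
      using N by blast
    from L2_fun_diff[OF rep_in_L2_fun[OF U[of "N 0"]] diff[OF this]] show ?thesis
      by simp
  qed
  define V where "V = L2_class M f"
  have V: "V \<in> L2 M"
    by (simp add: V_def L2_class_in \<open>f \<in> L2_fun M\<close>)
  have le: "L2_dist M (U n) V \<le> e" if n: "\<forall>m\<ge>K. L2_dist M (U n) (U m) < e" for n e K
  proof -
    have e: "e > 0"
      using n[rule_format, of K] by (meson L2.nonneg le_less_trans order_refl)
    have "ennreal ((L2_dist M (U n) V)\<^sup>2) = (\<integral>\<^sup>+x. ennreal ((cmod (rep (U n) x - rep V x))\<^sup>2) \<partial>M)"
      by (simp add: L2_dist_nn_integral U V)
    also have "\<dots> = (\<integral>\<^sup>+x. ennreal ((cmod (rep (U n) x - f x))\<^sup>2) \<partial>M)"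
    proof (rule nn_integral_cong_AE)
      show "AE x in M. ennreal ((cmod (rep (U n) x - rep V x))\<^sup>2) = ennreal ((cmod (rep (U n) x - f x))\<^sup>2)"
        using AE_rep_class[OF \<open>f \<in> L2_fun M\<close>] unfolding V_def by eventually_elim simp
    qed
    also have "\<dots> \<le> ennreal (e\<^sup>2)"
      by (rule fatou[OF n])
    finally show ?thesis
      using e by (simp add: power2_le_iff_abs_le)
  qed
  have "(\<lambda>n. L2_dist M (U n) V) \<longlonglongrightarrow> 0"
  proof (rule LIMSEQ_I)
    fix e :: real assume "e > 0"
    then obtain K where "\<And>n m. n \<ge> K \<Longrightarrow> m \<ge> K \<Longrightarrow> L2_dist M (U n) (U m) < e / 2"
      using Cauchy[of "e / 2"] by auto
    then have "L2_dist M (U n) V \<le> e / 2" if "n \<ge> K" for n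
      using le[of K n "e / 2"] that by blast
    then show "\<exists>N. \<forall>n\<ge>N. norm (L2_dist M (U n) V - 0) < e"
      using \<open>e > 0\<close> by (intro exI[of _ K]) fastforce
  qed
  with V that show ?thesis by blast
qed

lemma L2_inner_tendsto:
  assumes U: "\<And>n. U n \<in> L2 M" and V: "V \<in> L2 M" and W: "W \<in> L2 M"
    and lim: "(\<lambda>n. L2_dist M (U n) V) \<longlonglongrightarrow> 0"
  shows "(\<lambda>n. L2_inner M W (U n)) \<longlonglongrightarrow> L2_inner M W V"
proof (rule LIM_zero_cancel, rule Lim_null_comparison)
  show "\<forall>\<^sub>F n in sequentially. norm (L2_inner M W (U n) - L2_inner M W V) \<le> L2_norm M W * L2_dist M (U n) V"
    using L2_Cauchy_Schwarz[OF W, of "L2_diff M (U _) V"] U V W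
    by (auto simp: L2_dist_def intro!: always_eventually)
  show "(\<lambda>n. L2_norm M W * L2_dist M (U n) V) \<longlonglongrightarrow> 0"
    using tendsto_mult_right_zero[OF lim] by simp
qed

section \<open>The Riesz representation theorem\<close>

lemma real_eq_0_if_quadratic_nonneg:
  fixes a b :: real
  assumes "\<And>t. 0 \<le> t\<^sup>2 * a + t * b"
  shows "b = 0"
proof (rule ccontr)
  assume b: "b \<noteq> 0"
  \<comment> \<open>Stands in for the coefficient in the minimizer of the parabola; it is positive
    and exceeds \<open>a\<close> whatever the sign of \<open>a\<close>.\<close>
  define c where "c = \<bar>a\<bar> + 1"
  have c: "c > 0" "a < c" by (auto simp: c_def)
  have "0 \<le> (- b / c)\<^sup>2 * a + (- b / c) * b" by (rule assms)
  also have "\<dots> = b\<^sup>2 / c\<^sup>2 * (a - c)"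
    using c by (simp add: power2_eq_square field_simps)
  also have "\<dots> < 0"
    using b c by (intro mult_pos_neg) auto
  finally show False by simp
qed

text \<open>The representing vector minimizes \<open>\<parallel>U\<parallel>\<^sup>2 - 2 Re F(U)\<close>; a minimizing sequence is Cauchy by
  the parallelogram law.\<close>

lemma L2_Riesz:
  assumes add: "\<And>U V. U \<in> L2 M \<Longrightarrow> V \<in> L2 M \<Longrightarrow> F (L2_add M U V) = F U + F V"
    and scale: "\<And>c U. U \<in> L2 M \<Longrightarrow> F (L2_scale M c U) = c * F U"
    and bound: "\<And>U. U \<in> L2 M \<Longrightarrow> cmod (F U) \<le> C * L2_norm M U"
  obtains V where "V \<in> L2 M" "\<And>U. U \<in> L2 M \<Longrightarrow> L2_inner M V U = F U"
proof -
  define J where "J U = (L2_norm M U)\<^sup>2 - 2 * Re (F U)" for U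
  define m where "m = Inf (J ` L2 M)"
  have J_ge: "- C\<^sup>2 \<le> J U" if "U \<in> L2 M" for U
  proof -
    have "Re (F U) \<le> C * L2_norm M U"
      using bound[OF that] complex_Re_le_cmod order_trans by blast
    moreover have "2 * (C * L2_norm M U) \<le> (L2_norm M U)\<^sup>2 + C\<^sup>2"
      using sum_squares_bound[of C "L2_norm M U"] by (simp add: mult_ac)
    ultimately show ?thesis unfolding J_def by linarith
  qed
  have bdd: "bdd_below (J ` L2 M)"
    using J_ge by (intro bdd_belowI2)
  have m_le: "m \<le> J U" if "U \<in> L2 M" for U
    unfolding m_def by (rule cINF_lower[OF bdd that])
  have "\<exists>U\<in>L2 M. J U < m + 1 / real (Suc n)" for n
  proof -
    have "Inf (J ` L2 M) < m + 1 / real (Suc n)" by (simp add: m_def)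
    then show ?thesis
      using L2_closed(1) by (subst (asm) cINF_less_iff[OF _ bdd]) auto
  qed
  then obtain U where U: "\<And>n. U n \<in> L2 M" and JU: "\<And>n. J (U n) < m + 1 / real (Suc n)"
    by metis
  \<comment> \<open>\<open>J\<close> is the squared norm plus a real-linear term, so the
    parallelogram law expresses the squared distance by \<open>J\<close> at both points and at their
    midpoint \<open>A\<close>, where \<open>J\<close> is at least \<open>m\<close>.\<close>
  have par: "(L2_dist M (U n) (U k))\<^sup>2 \<le> 2 / real (Suc n) + 2 / real (Suc k)" for n k
  proof -
    define A where "A = L2_scale M (1 / 2) (L2_add M (U n) (U k))"
    have A: "A \<in> L2 M" by (simp add: A_def U)
    have norm: "4 * (L2_norm M A)\<^sup>2 = (L2_norm M (L2_add M (U n) (U k)))\<^sup>2"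
      by (simp add: A_def U power_divide)
    have F: "2 * F A = F (U n) + F (U k)"
      by (simp add: A_def U scale add)
    have "(L2_dist M (U n) (U k))\<^sup>2 + (L2_norm M (L2_add M (U n) (U k)))\<^sup>2
        = 2 * (L2_norm M (U n))\<^sup>2 + 2 * (L2_norm M (U k))\<^sup>2"
      using U by (simp add: L2_dist_def L2_norm_square algebra_simps)
    then have "(L2_dist M (U n) (U k))\<^sup>2 = 2 * J (U n) + 2 * J (U k) - 4 * J A"
      using norm arg_cong[OF F, of Re] by (simp add: J_def)
    then show ?thesis
      using JU[of n] JU[of k] m_le[OF A] by simp
  qed
  have "\<exists>N. \<forall>n\<ge>N. \<forall>k\<ge>N. L2_dist M (U n) (U k) < e" if e: "e > 0" for e
  proof -
    obtain N :: nat where N: "4 / e\<^sup>2 < real (Suc N)"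
      using reals_Archimedean2[of "4 / e\<^sup>2"] by (metis less_Suc_eq of_nat_less_iff order_less_trans)
    have "L2_dist M (U n) (U k) < e" if "n \<ge> N" "k \<ge> N" for n k
    proof -
      have "2 / real (Suc n) \<le> 2 / real (Suc N)" "2 / real (Suc k) \<le> 2 / real (Suc N)"
        using that by (auto intro!: divide_left_mono)
      then have "(L2_dist M (U n) (U k))\<^sup>2 \<le> 4 / real (Suc N)"
        using par[of n k] by simp
      also have "\<dots> < e\<^sup>2"
        using N e by (simp add: field_simps)
      finally show ?thesis
        using e by (simp add: power2_less_imp_less)
    qed
    then show ?thesis by blast
  qed
  then obtain V where V: "V \<in> L2 M" and lim: "(\<lambda>n. L2_dist M (U n) V) \<longlonglongrightarrow> 0"
    using L2_complete[of U M] U by blast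
  \<comment> \<open>First variation at the minimum. That \<open>V\<close> attains \<open>m\<close>
    is never stated: the inequality for a variation in direction \<open>W\<close> is written at
    \<open>U n\<close>, with error \<open>1 / Suc n\<close>, and then passed to the limit.\<close>
  have Re_eq: "Re (L2_inner M V W) = Re (F W)" if W: "W \<in> L2 M" for W
  proof -
    have "0 \<le> t\<^sup>2 * (L2_norm M W)\<^sup>2 + t * (2 * (Re (L2_inner M V W) - Re (F W)))" for t :: real
    proof -
      have "- (1 / real (Suc n)) \<le> t\<^sup>2 * (L2_norm M W)\<^sup>2 + t * (2 * (Re (L2_inner M W (U n)) - Re (F W)))" for n
      proof -
        have "m \<le> J (L2_add M (U n) (L2_scale M (of_real t) W))"
          by (simp add: m_le U W)
        also have "\<dots> = J (U n) + t\<^sup>2 * (L2_norm M W)\<^sup>2 + t * (2 * (Re (L2_inner M (U n) W) - Re (F W)))"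
          using U W by (simp add: J_def L2_norm_add_square add scale power_mult_distrib algebra_simps)
        also have "Re (L2_inner M (U n) W) = Re (L2_inner M W (U n))"
          by (simp add: L2_inner_commute[of M W])
        finally show ?thesis using JU[of n] by simp
      qed
      moreover have "(\<lambda>n. - (1 / real (Suc n))) \<longlonglongrightarrow> - 0"
        using LIMSEQ_inverse_real_of_nat by (intro tendsto_minus) (simp add: inverse_eq_divide)
      moreover have "(\<lambda>n. t\<^sup>2 * (L2_norm M W)\<^sup>2 + t * (2 * (Re (L2_inner M W (U n)) - Re (F W))))
          \<longlonglongrightarrow> t\<^sup>2 * (L2_norm M W)\<^sup>2 + t * (2 * (Re (L2_inner M W V) - Re (F W)))"
        by (intro tendsto_intros L2_inner_tendsto U V W lim)
      ultimately have "- 0 \<le> t\<^sup>2 * (L2_norm M W)\<^sup>2 + t * (2 * (Re (L2_inner M W V) - Re (F W)))"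
        by (intro LIMSEQ_le) auto
      then show ?thesis
        by (simp add: L2_inner_commute[of M V])
    qed
    then have "2 * (Re (L2_inner M V W) - Re (F W)) = 0"
      by (rule real_eq_0_if_quadratic_nonneg)
    then show ?thesis by simp
  qed
  have "L2_inner M V W = F W" if W: "W \<in> L2 M" for W
  proof (rule complex_eqI)
    show "Re (L2_inner M V W) = Re (F W)" by (rule Re_eq[OF W])
    have "Re (\<i> * L2_inner M V W) = Re (\<i> * F W)"
      using Re_eq[of "L2_scale M \<i> W"] W V by (simp add: scale)
    then show "Im (L2_inner M V W) = Im (F W)" by simp
  qed
  with V that show ?thesis by blast
qed

section \<open>Bounded operators\<close>

lemma bounded_opD:
  assumes "bounded_op M T"
  shows "U \<in> L2 M \<Longrightarrow> T U \<in> L2 M"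
    and "U \<in> L2 M \<Longrightarrow> V \<in> L2 M \<Longrightarrow> T (L2_add M U V) = L2_add M (T U) (T V)"
    and "U \<in> L2 M \<Longrightarrow> T (L2_scale M c U) = L2_scale M c (T U)"
    and "U \<in> L2 M \<Longrightarrow> V \<in> L2 M \<Longrightarrow> T (L2_diff M U V) = L2_diff M (T U) (T V)"
    and "T (L2_zero M) = L2_zero M"
    and "T \<in> extensional (L2 M)"
    and "\<exists>C\<ge>0. \<forall>U\<in>L2 M. L2_norm M (T U) \<le> C * L2_norm M U"
proof -
  show T: "T U \<in> L2 M" if "U \<in> L2 M" for U
    using assms that by (auto simp: bounded_op_def)
  show add: "T (L2_add M U V) = L2_add M (T U) (T V)" if "U \<in> L2 M" "V \<in> L2 M" for U V
    using assms that by (auto simp: bounded_op_def)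
  show scale: "T (L2_scale M c U) = L2_scale M c (T U)" if "U \<in> L2 M" for U c
    using assms that by (auto simp: bounded_op_def)
  have "L2_diff M U V = L2_add M U (L2_scale M (- 1) V)" if "U \<in> L2 M" "V \<in> L2 M" for U V
    using that by (intro L2_ext) auto
  then show "T (L2_diff M U V) = L2_diff M (T U) (T V)" if "U \<in> L2 M" "V \<in> L2 M"
    using that by (simp add: T add scale)
  have "L2_zero M = L2_scale M 0 U" if "U \<in> L2 M" for U
    using that by (intro L2_ext) auto
  from this[of "L2_zero M"] this[of "T (L2_zero M)"] show "T (L2_zero M) = L2_zero M"
    using scale[of "L2_zero M" 0] T by simp
  show "T \<in> extensional (L2 M)"
    using assms by (auto simp: bounded_op_def PiE_def)
  obtain C where C: "\<forall>U\<in>L2 M. L2_norm M (T U) \<le> C * L2_norm M U"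
    using assms by (auto simp: bounded_op_def)
  have "L2_norm M (T U) \<le> max 0 C * L2_norm M U" if "U \<in> L2 M" for U
    using C that mult_right_mono[of C "max 0 C" "L2_norm M U"] by force
  then show "\<exists>C\<ge>0. \<forall>U\<in>L2 M. L2_norm M (T U) \<le> C * L2_norm M U"
    by (intro exI[of _ "max 0 C"]) auto
qed

lemma bounded_op_ext:
  assumes "S \<in> extensional (L2 M)" "T \<in> extensional (L2 M)"
    and "\<And>U. U \<in> L2 M \<Longrightarrow> S U \<in> L2 M" "\<And>U. U \<in> L2 M \<Longrightarrow> T U \<in> L2 M"
    and "\<And>U W. U \<in> L2 M \<Longrightarrow> W \<in> L2 M \<Longrightarrow> L2_inner M W (S U) = L2_inner M W (T U)"
  shows "S = T"
  using assms by (intro extensionalityI[of S "L2 M" T] L2_ext) auto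

lemma bounded_op_if_form:
  assumes S: "S \<in> L2 M \<rightarrow>\<^sub>E L2 M"
    and form: "\<And>U W. U \<in> L2 M \<Longrightarrow> W \<in> L2 M \<Longrightarrow> L2_inner M W (S U) = B W U"
    and add: "\<And>W U V. W \<in> L2 M \<Longrightarrow> U \<in> L2 M \<Longrightarrow> V \<in> L2 M \<Longrightarrow> B W (L2_add M U V) = B W U + B W V"
    and scale: "\<And>W c U. W \<in> L2 M \<Longrightarrow> U \<in> L2 M \<Longrightarrow> B W (L2_scale M c U) = c * B W U"
    and bound: "\<And>U W. U \<in> L2 M \<Longrightarrow> W \<in> L2 M \<Longrightarrow> cmod (B W U) \<le> C * L2_norm M W * L2_norm M U"
  shows "bounded_op M S" "\<And>U. U \<in> L2 M \<Longrightarrow> L2_norm M (S U) \<le> C * L2_norm M U"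
proof -
  have S': "S U \<in> L2 M" if "U \<in> L2 M" for U
    using S that by auto
  show *: "L2_norm M (S U) \<le> C * L2_norm M U" if U: "U \<in> L2 M" for U
  proof (cases "L2_norm M (S U) = 0")
    case True
    show ?thesis
    proof (cases "L2_norm M U = 0")
      case False
      have "cmod (B U U) \<le> C * L2_norm M U * L2_norm M U"
        by (rule bound[OF U U])
      then have "0 \<le> C * L2_norm M U * L2_norm M U"
        using norm_ge_zero order_trans by blast
      then have "0 \<le> C * L2_norm M U"
        using False by (simp add: zero_le_mult_iff) (metis L2_norm_nonneg False order_antisym)
      then show ?thesis using True by simp
    qed (use True in simp)
  next
    case False
    have "(L2_norm M (S U))\<^sup>2 = cmod (B (S U) U)"
      using arg_cong[OF form[OF U S'[OF U]], of cmod] by (simp add: L2_inner_self norm_power)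
    also have "\<dots> \<le> C * L2_norm M U * L2_norm M (S U)"
      using bound[OF U S'[OF U]] by (simp add: mult_ac)
    finally show ?thesis
      using False L2_norm_nonneg[of M "S U"] by (simp add: power2_eq_square mult_le_cancel_right)
  qed
  have "S (L2_add M U V) = L2_add M (S U) (S V)" if "U \<in> L2 M" "V \<in> L2 M" for U V
    using that by (intro L2_ext) (auto simp: form add S')
  moreover have "S (L2_scale M c U) = L2_scale M c (S U)" if "U \<in> L2 M" for U c
    using that by (intro L2_ext) (auto simp: form scale S')
  ultimately show "bounded_op M S"
    unfolding bounded_op_def by (intro conjI ballI allI S exI[of _ C] *) auto
qed

text \<open>Riesz is applied to the first slot of the form; the conjugate turns that antilinear slot
  into the linear functional which Riesz expects. Adjoints and the infinite sums in
  \<open>matching_op\<close> are both obtained in this way.\<close>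

lemma bounded_op_from_form:
  assumes add: "\<And>W U V. W \<in> L2 M \<Longrightarrow> U \<in> L2 M \<Longrightarrow> V \<in> L2 M \<Longrightarrow> B W (L2_add M U V) = B W U + B W V"
    and scale: "\<And>W c U. W \<in> L2 M \<Longrightarrow> U \<in> L2 M \<Longrightarrow> B W (L2_scale M c U) = c * B W U"
    and add': "\<And>W U V. W \<in> L2 M \<Longrightarrow> U \<in> L2 M \<Longrightarrow> V \<in> L2 M \<Longrightarrow> B (L2_add M U V) W = B U W + B V W"
    and scale': "\<And>W c U. W \<in> L2 M \<Longrightarrow> U \<in> L2 M \<Longrightarrow> B (L2_scale M c U) W = cnj c * B U W"
    and bound: "\<And>U W. U \<in> L2 M \<Longrightarrow> W \<in> L2 M \<Longrightarrow> cmod (B W U) \<le> C * L2_norm M W * L2_norm M U"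
  obtains S where "bounded_op M S" "\<And>U W. U \<in> L2 M \<Longrightarrow> W \<in> L2 M \<Longrightarrow> L2_inner M W (S U) = B W U"
    "\<And>U. U \<in> L2 M \<Longrightarrow> L2_norm M (S U) \<le> C * L2_norm M U"
proof -
  have "\<exists>V. V \<in> L2 M \<and> (\<forall>W\<in>L2 M. L2_inner M W V = B W U)" if U: "U \<in> L2 M" for U
  proof -
    obtain V where "V \<in> L2 M" "\<And>W. W \<in> L2 M \<Longrightarrow> L2_inner M V W = cnj (B W U)"
    proof (rule L2_Riesz[of M "\<lambda>W. cnj (B W U)" "C * L2_norm M U"])
      show "cmod (cnj (B W U)) \<le> C * L2_norm M U * L2_norm M W" if "W \<in> L2 M" for W
        using bound[OF U that] by (simp add: mult_ac)
    qed (use U in \<open>auto simp: add' scale'\<close>)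
    then show ?thesis
      by (metis L2_inner_commute complex_cnj_cnj)
  qed
  then obtain S0 where S0: "\<And>U. U \<in> L2 M \<Longrightarrow> S0 U \<in> L2 M \<and> (\<forall>W\<in>L2 M. L2_inner M W (S0 U) = B W U)"
    by metis
  define S where "S = restrict S0 (L2 M)"
  have S: "S \<in> L2 M \<rightarrow>\<^sub>E L2 M" "\<And>U W. U \<in> L2 M \<Longrightarrow> W \<in> L2 M \<Longrightarrow> L2_inner M W (S U) = B W U"
    using S0 by (auto simp: S_def)
  show ?thesis
    by (rule that[OF bounded_op_if_form(1) _ bounded_op_if_form(2)]; (rule S add scale bound)?; assumption?)
qed

lemma bounded_op_norm_form:
  assumes T: "bounded_op M T"
  obtains C where "C \<ge> 0" "\<And>U W. U \<in> L2 M \<Longrightarrow> W \<in> L2 M \<Longrightarrow> cmod (L2_inner M W (T U)) \<le> C * L2_norm M W * L2_norm M U"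
proof -
  obtain C where C: "C \<ge> 0" "\<And>U. U \<in> L2 M \<Longrightarrow> L2_norm M (T U) \<le> C * L2_norm M U"
    using bounded_opD(7)[OF T] by blast
  have "cmod (L2_inner M W (T U)) \<le> C * L2_norm M W * L2_norm M U" if "U \<in> L2 M" "W \<in> L2 M" for U W
  proof -
    have "cmod (L2_inner M W (T U)) \<le> L2_norm M W * L2_norm M (T U)"
      by (rule L2_Cauchy_Schwarz[OF that(2) bounded_opD(1)[OF T that(1)]])
    also have "\<dots> \<le> L2_norm M W * (C * L2_norm M U)"
      by (intro mult_left_mono C that) auto
    finally show ?thesis by (simp add: mult_ac)
  qed
  with C that show ?thesis by blast
qed

section \<open>Adjoints\<close>

lemma op_adj_unique:
  assumes S: "bounded_op M S"
    and SV: "\<And>U V. U \<in> L2 M \<Longrightarrow> V \<in> L2 M \<Longrightarrow> L2_inner M (S U) V = L2_inner M U (T V)"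
  shows "op_adj M T = S"
  unfolding op_adj_def
proof (rule the_equality)
  show "bounded_op M S \<and> (\<forall>U\<in>L2 M. \<forall>V\<in>L2 M. L2_inner M (S U) V = L2_inner M U (T V))"
    using assms by blast
  fix S' assume S': "bounded_op M S' \<and> (\<forall>U\<in>L2 M. \<forall>V\<in>L2 M. L2_inner M (S' U) V = L2_inner M U (T V))"
  show "S' = S"
  proof (rule bounded_op_ext)
    fix U W assume UW: "U \<in> L2 M" "W \<in> L2 M"
    then have "L2_inner M (S' U) W = L2_inner M (S U) W"
      using S' SV by simp
    then show "L2_inner M W (S' U) = L2_inner M W (S U)"
      by (simp add: L2_inner_commute[of M W])
  qed (simp_all add: S bounded_opD(1,6)[OF S] bounded_opD(1,6)[OF conjunct1[OF S']])
qed

lemma op_adj: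
  assumes T: "bounded_op M T"
  shows "bounded_op M (op_adj M T)"
    and "U \<in> L2 M \<Longrightarrow> V \<in> L2 M \<Longrightarrow> L2_inner M (op_adj M T U) V = L2_inner M U (T V)"
    and "U \<in> L2 M \<Longrightarrow> V \<in> L2 M \<Longrightarrow> L2_inner M V (op_adj M T U) = L2_inner M (T V) U"
proof -
  note [simp] = bounded_opD[OF T]
  obtain C where C: "C \<ge> 0" "\<And>U W. U \<in> L2 M \<Longrightarrow> W \<in> L2 M \<Longrightarrow> cmod (L2_inner M W (T U)) \<le> C * L2_norm M W * L2_norm M U"
    using bounded_op_norm_form[OF T] by blast
  have bound: "cmod (L2_inner M (T W) U) \<le> C * L2_norm M W * L2_norm M U" if "U \<in> L2 M" "W \<in> L2 M" for U W
    using C(2)[OF that(2,1)] by (subst L2_inner_commute) (simp add: mult_ac)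
  obtain S where S: "bounded_op M S" "\<And>U W. U \<in> L2 M \<Longrightarrow> W \<in> L2 M \<Longrightarrow> L2_inner M W (S U) = L2_inner M (T W) U"
    by (rule bounded_op_from_form[of M "\<lambda>W U. L2_inner M (T W) U" C]) (auto simp: bound)
  have eq: "L2_inner M (S U) V = L2_inner M U (T V)" if "U \<in> L2 M" "V \<in> L2 M" for U V
    using S(2)[OF that] by (metis L2_inner_commute)
  have "op_adj M T = S"
    by (rule op_adj_unique[OF S(1) eq])
  then show "bounded_op M (op_adj M T)"
    "U \<in> L2 M \<Longrightarrow> V \<in> L2 M \<Longrightarrow> L2_inner M (op_adj M T U) V = L2_inner M U (T V)"
    "U \<in> L2 M \<Longrightarrow> V \<in> L2 M \<Longrightarrow> L2_inner M V (op_adj M T U) = L2_inner M (T V) U"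
    using S eq by auto
qed

section \<open>Algebraic operations on bounded operators\<close>

abbreviation op_add :: "'a measure \<Rightarrow> 'a l2_op \<Rightarrow> 'a l2_op \<Rightarrow> 'a l2_op" where
  "op_add M S T \<equiv> (\<lambda>U\<in>L2 M. L2_add M (S U) (T U))"

abbreviation op_scale :: "'a measure \<Rightarrow> complex \<Rightarrow> 'a l2_op \<Rightarrow> 'a l2_op" where
  "op_scale M c T \<equiv> (\<lambda>U\<in>L2 M. L2_scale M c (T U))"

abbreviation op_zero :: "'a measure \<Rightarrow> 'a l2_op" where
  "op_zero M \<equiv> (\<lambda>U\<in>L2 M. L2_zero M)"

abbreviation op_comp :: "'a measure \<Rightarrow> 'a l2_op \<Rightarrow> 'a l2_op \<Rightarrow> 'a l2_op" where
  "op_comp M S T \<equiv> compose (L2 M) S T"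

lemma bounded_opI:
  assumes "\<And>U. U \<in> L2 M \<Longrightarrow> T U \<in> L2 M" "T \<in> extensional (L2 M)"
    and "\<And>U V. U \<in> L2 M \<Longrightarrow> V \<in> L2 M \<Longrightarrow> T (L2_add M U V) = L2_add M (T U) (T V)"
    and "\<And>U c. U \<in> L2 M \<Longrightarrow> T (L2_scale M c U) = L2_scale M c (T U)"
    and "\<And>U. U \<in> L2 M \<Longrightarrow> L2_norm M (T U) \<le> C * L2_norm M U"
  shows "bounded_op M T"
  unfolding bounded_op_def PiE_def
  by (intro conjI ballI allI IntI exI[of _ C] Pi_I assms)

lemma L2_norm_zero [simp]: "L2_norm M (L2_zero M) = 0"
  by (simp add: L2_norm_eq_0)

lemma L2_arith_zero [simp]:
  "L2_add M (L2_zero M) (L2_zero M) = L2_zero M"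
  "L2_diff M (L2_zero M) (L2_zero M) = L2_zero M"
  "L2_scale M c (L2_zero M) = L2_zero M"
  by - (rule L2_ext[of _ M]; simp)+

lemma L2_arith:
  assumes "U \<in> L2 M" "V \<in> L2 M"
  shows "U' \<in> L2 M \<Longrightarrow> V' \<in> L2 M \<Longrightarrow>
      L2_add M (L2_add M U V) (L2_add M U' V') = L2_add M (L2_add M U U') (L2_add M V V')"
    and "L2_scale M c (L2_add M U V) = L2_add M (L2_scale M c U) (L2_scale M c V)"
    and "L2_scale M c (L2_scale M d U) = L2_scale M d (L2_scale M c U)"
  using assms by - (rule L2_ext[of _ M]; simp add: algebra_simps)+

lemma bounded_op_zero: "bounded_op M (op_zero M)"
  by (rule bounded_opI[where C = 0]) simp_all

lemma bounded_op_id: "bounded_op M (\<lambda>U\<in>L2 M. U)"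
  by (rule bounded_opI[where C = 1]) auto

lemma bounded_op_add:
  assumes S: "bounded_op M S" and T: "bounded_op M T"
  shows "bounded_op M (op_add M S T)"
proof -
  note [simp] = bounded_opD(1-5)[OF S] bounded_opD(1-5)[OF T]
  obtain C where C: "\<And>U. U \<in> L2 M \<Longrightarrow> L2_norm M (S U) \<le> C * L2_norm M U"
    using bounded_opD(7)[OF S] by blast
  obtain D where D: "\<And>U. U \<in> L2 M \<Longrightarrow> L2_norm M (T U) \<le> D * L2_norm M U"
    using bounded_opD(7)[OF T] by blast
  show ?thesis
  proof (rule bounded_opI[where C = "C + D"])
    fix U assume U: "U \<in> L2 M"
    have "L2_norm M (L2_add M (S U) (T U)) \<le> L2_norm M (S U) + L2_norm M (T U)"
      using U by (intro L2_norm_triangle) auto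
    then show "L2_norm M (op_add M S T U) \<le> (C + D) * L2_norm M U"
      using C[OF U] D[OF U] U by (simp add: distrib_right)
  qed (simp_all add: L2_arith)
qed

lemma bounded_op_scale:
  assumes T: "bounded_op M T"
  shows "bounded_op M (op_scale M c T)"
proof -
  note [simp] = bounded_opD(1-5)[OF T]
  obtain D where D: "\<And>U. U \<in> L2 M \<Longrightarrow> L2_norm M (T U) \<le> D * L2_norm M U"
    using bounded_opD(7)[OF T] by blast
  show ?thesis
  proof (rule bounded_opI[where C = "cmod c * D"])
    fix U assume U: "U \<in> L2 M"
    then show "L2_norm M (op_scale M c T U) \<le> cmod c * D * L2_norm M U"
      using D[OF U] by (simp add: mult.assoc mult_left_mono)
  qed (simp_all add: L2_arith)
qed

lemma bounded_op_compose:
  assumes S: "bounded_op M S" and T: "bounded_op M T"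
  shows "bounded_op M (op_comp M S T)"
proof -
  note [simp] = bounded_opD(1-5)[OF S] bounded_opD(1-5)[OF T]
  obtain C where C: "C \<ge> 0" "\<And>U. U \<in> L2 M \<Longrightarrow> L2_norm M (S U) \<le> C * L2_norm M U"
    using bounded_opD(7)[OF S] by blast
  obtain D where D: "\<And>U. U \<in> L2 M \<Longrightarrow> L2_norm M (T U) \<le> D * L2_norm M U"
    using bounded_opD(7)[OF T] by blast
  show ?thesis
  proof (rule bounded_opI[where C = "C * D"])
    fix U assume U: "U \<in> L2 M"
    have "L2_norm M (S (T U)) \<le> C * (D * L2_norm M U)"
      using U C(2)[of "T U"] mult_left_mono[OF D[OF U] C(1)] by simp
    then show "L2_norm M (op_comp M S T U) \<le> C * D * L2_norm M U"
      using U by (simp add: compose_def)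
  qed (auto simp: compose_def)
qed

lemmas bounded_op_intros =
  bounded_op_zero bounded_op_id bounded_op_add bounded_op_scale bounded_op_compose op_adj(1)

lemma op_adj_algebra:
  assumes S: "bounded_op M S" and T: "bounded_op M T"
  shows "op_adj M (op_add M S T) = op_add M (op_adj M S) (op_adj M T)"
    and "op_adj M (op_scale M c T) = op_scale M (cnj c) (op_adj M T)"
    and "op_adj M (op_comp M S T) = op_comp M (op_adj M T) (op_adj M S)"
    and "op_adj M (op_adj M T) = T"
proof -
  note [simp] = bounded_opD(1-5)[OF S] bounded_opD(1-5)[OF T] op_adj[OF S] op_adj[OF T]
    bounded_opD(1-5)[OF op_adj(1)[OF S]] bounded_opD(1-5)[OF op_adj(1)[OF T]]
  note b = bounded_op_intros S T
  show "op_adj M (op_add M S T) = op_add M (op_adj M S) (op_adj M T)"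
    by (intro op_adj_unique b) auto
  show "op_adj M (op_scale M c T) = op_scale M (cnj c) (op_adj M T)"
    by (intro op_adj_unique b) auto
  show "op_adj M (op_comp M S T) = op_comp M (op_adj M T) (op_adj M S)"
    by (intro op_adj_unique b) (auto simp: compose_def)
  show "op_adj M (op_adj M T) = T"
    by (intro op_adj_unique b) auto
qed

section \<open>The operator distance\<close>

lemma op_dist_le:
  assumes "\<And>U. U \<in> L2 M \<Longrightarrow> L2_dist M (S U) (T U) \<le> C * L2_norm M U" and "C \<ge> 0"
  shows "op_dist M S T \<le> C"
  unfolding op_dist_def
proof (rule cSUP_least)
  show "{U \<in> L2 M. L2_norm M U \<le> 1} \<noteq> {}"
    by (auto intro!: exI[of _ "L2_zero M"])
  fix U assume "U \<in> {U \<in> L2 M. L2_norm M U \<le> 1}"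
  then show "L2_dist M (S U) (T U) \<le> C"
    using assms(1)[of U] mult_left_mono[of "L2_norm M U" 1 C] assms(2) by auto
qed

lemma L2_dist_op_le:
  assumes S: "bounded_op M S" and T: "bounded_op M T" and U: "U \<in> L2 M"
  shows "L2_dist M (S U) (T U) \<le> op_dist M S T * L2_norm M U"
proof (cases "L2_norm M U = 0")
  case True
  then have "U = L2_zero M" using U L2_norm_eq_0 by blast
  then show ?thesis
    using True by (simp add: bounded_opD(5)[OF S] bounded_opD(5)[OF T])
next
  case False
  note [simp] = bounded_opD(1-5)[OF S] bounded_opD(1-5)[OF T]
  define n where "n = L2_norm M U"
  have n: "n > 0" using False L2_norm_nonneg[of M U] unfolding n_def by linarith
  define D where "D = op_add M S (op_scale M (- 1) T)"
  have D: "bounded_op M D" unfolding D_def by (intro bounded_op_intros S T)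
  have D_eq: "D V = L2_diff M (S V) (T V)" if "V \<in> L2 M" for V
    using that by - (rule L2_ext[of _ M], auto simp: D_def)
  obtain C where C: "C \<ge> 0" "\<And>V. V \<in> L2 M \<Longrightarrow> L2_norm M (D V) \<le> C * L2_norm M V"
    using bounded_opD(7)[OF D] by blast
  define V where "V = L2_scale M (of_real (1 / n)) U"
  have V: "V \<in> L2 M" "L2_norm M V \<le> 1"
    using U n by (simp_all add: V_def n_def[symmetric] norm_divide)
  \<comment> \<open>Without this bound the supremum in \<open>op_dist\<close> would say nothing
    about single vectors.\<close>
  have "bdd_above ((\<lambda>U. L2_dist M (S U) (T U)) ` {U \<in> L2 M. L2_norm M U \<le> 1})"
  proof (rule bdd_aboveI2)
    fix V assume "V \<in> {U \<in> L2 M. L2_norm M U \<le> 1}"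
    then show "L2_dist M (S V) (T V) \<le> C"
      using C(2)[of V] mult_left_mono[of "L2_norm M V" 1 C] C(1) by (simp add: L2_dist_def D_eq)
  qed
  then have "L2_dist M (S V) (T V) \<le> op_dist M S T"
    unfolding op_dist_def by (rule cSUP_upper[rotated]) (use V in simp)
  moreover have "L2_dist M (S V) (T V) = L2_dist M (S U) (T U) / n"
  proof -
    have "L2_diff M (S V) (T V) = L2_scale M (of_real (1 / n)) (L2_diff M (S U) (T U))"
      using U by - (rule L2_ext[of _ M], auto simp: V_def algebra_simps)
    then show ?thesis
      using U n by (simp add: L2_dist_def norm_divide)
  qed
  ultimately show ?thesis
    using n by (simp add: field_simps n_def)
qed

section \<open>Compact operators\<close>

lemma L2_MCauchy_iff:
  "L2.MCauchy M X \<longleftrightarrow>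
     (\<forall>n. X n \<in> L2 M) \<and> (\<forall>e>0. \<exists>N. \<forall>n\<ge>N. \<forall>m\<ge>N. L2_dist M (X n) (X m) < e)"
proof -
  have "(\<forall>n n'. N \<le> n \<longrightarrow> N \<le> n' \<longrightarrow> P n n') \<longleftrightarrow> (\<forall>n\<ge>N. \<forall>m\<ge>N. P n m)" for P and N :: nat
    by blast
  then show ?thesis
    by (simp only: L2.MCauchy_def image_subset_iff UNIV_I simp_thms Ball_def)
qed

text \<open>By completeness, convergence of the images can be replaced by the Cauchy property, which
  passes through compositions and comparisons without a limit being named.\<close>

lemma compact_op_iff:
  "compact_op M T \<longleftrightarrow> bounded_op M T \<and>
     (\<forall>U. (\<forall>n::nat. U n \<in> L2 M \<and> L2_norm M (U n) \<le> 1) \<longrightarrow>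
        (\<exists>s. strict_mono s \<and> L2.MCauchy M (\<lambda>n. T (U (s n)))))"
proof (cases "bounded_op M T")
  case True
  note [simp] = bounded_opD(1)[OF True]
  have conv: "(\<exists>V\<in>L2 M. (\<lambda>n. L2_dist M (X n) V) \<longlonglongrightarrow> 0) \<longleftrightarrow> L2.MCauchy M X"
    if X: "\<And>n. X n \<in> L2 M" for X
  proof
    assume "L2.MCauchy M X"
    then have "\<And>e. e > 0 \<Longrightarrow> \<exists>N. \<forall>n\<ge>N. \<forall>m\<ge>N. L2_dist M (X n) (X m) < e"
      by (simp add: L2_MCauchy_iff)
    from L2_complete[OF X this] show "\<exists>V\<in>L2 M. (\<lambda>n. L2_dist M (X n) V) \<longlonglongrightarrow> 0"
      by (metis (no_types))
  next
    assume "\<exists>V\<in>L2 M. (\<lambda>n. L2_dist M (X n) V) \<longlonglongrightarrow> 0"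
    then obtain V where V: "V \<in> L2 M" "(\<lambda>n. L2_dist M (X n) V) \<longlonglongrightarrow> 0" by blast
    have "\<exists>N. \<forall>n\<ge>N. \<forall>m\<ge>N. L2_dist M (X n) (X m) < e" if "e > 0" for e
    proof -
      have "\<forall>\<^sub>F n in sequentially. L2_dist M (X n) V < e / 2"
        using order_tendstoD(2)[OF V(2), of "e / 2"] that by simp
      then obtain N where N: "\<And>n. n \<ge> N \<Longrightarrow> L2_dist M (X n) V < e / 2"
        by (auto simp: eventually_sequentially)
      have "L2_dist M (X n) (X m) < e" if "n \<ge> N" "m \<ge> N" for n m
        using L2.triangle[OF X V(1) X, of n m] N[OF that(1)] N[OF that(2)]
        by (simp add: L2.commute[of M V])
      then show ?thesis by blast
    qed
    then show "L2.MCauchy M X"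
      using X by (simp add: L2_MCauchy_iff)
  qed
  have "(\<exists>V\<in>L2 M. \<exists>s. strict_mono s \<and> (\<lambda>n. L2_dist M (T (U (s n))) V) \<longlonglongrightarrow> 0)
      \<longleftrightarrow> (\<exists>s. strict_mono s \<and> L2.MCauchy M (\<lambda>n. T (U (s n))))"
    if "\<forall>n::nat. U n \<in> L2 M \<and> L2_norm M (U n) \<le> 1" for U
  proof -
    have "L2.MCauchy M (\<lambda>n. T (U (s n))) \<longleftrightarrow> (\<exists>V\<in>L2 M. (\<lambda>n. L2_dist M (T (U (s n))) V) \<longlonglongrightarrow> 0)"
      for s :: "nat \<Rightarrow> nat"
      by (rule conv[symmetric]) (use that in simp)
    then show ?thesis
      by (simp only:) blast
  qed
  then show ?thesis
    using True by (simp add: compact_op_def)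
next
  case False
  then show ?thesis by (simp add: compact_op_def)
qed

lemma compact_opE:
  assumes "compact_op M T" "\<And>n::nat. U n \<in> L2 M" "\<And>n. L2_norm M (U n) \<le> 1"
  obtains s :: "nat \<Rightarrow> nat" where "strict_mono s" "L2.MCauchy M (\<lambda>n. T (U (s n)))"
  using assms unfolding compact_op_iff by blast

text \<open>The disjunction serves two users: the first alternative is the Lipschitz estimate for
  compositions, the second a square-root estimate for adjoints. Accordingly \<open>d\<close> is
  small against both \<open>e\<close> and its square, and \<open>C + 1\<close> replaces
  \<open>C\<close>, which may be 0.\<close>

lemma MCauchy_L2_comparison:
  assumes "L2.MCauchy M X" "\<And>n. Y n \<in> L2 M"
    and "\<And>n m. (L2_dist M (Y n) (Y m))\<^sup>2 \<le> (C * L2_dist M (X n) (X m))\<^sup>2 \<or>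
      (L2_dist M (Y n) (Y m))\<^sup>2 \<le> C * L2_dist M (X n) (X m)" and "C \<ge> 0"
  shows "L2.MCauchy M Y"
  unfolding L2.MCauchy_def
proof (intro conjI allI impI)
  show "range Y \<subseteq> L2 M" using assms(2) by blast
  fix e :: real assume e: "e > 0"
  define d where "d = min (e / (C + 1)) (e\<^sup>2 / (C + 1))"
  have d: "d > 0" using e \<open>C \<ge> 0\<close> by (simp add: d_def)
  have d': "(C + 1) * d \<le> e" "(C + 1) * d \<le> e\<^sup>2"
    using \<open>C \<ge> 0\<close> by (simp_all add: d_def min_le_iff_disj mult.commute[of "C + 1"] flip: pos_le_divide_eq)
  obtain N where N: "\<And>n n'. N \<le> n \<Longrightarrow> N \<le> n' \<Longrightarrow> L2_dist M (X n) (X n') < d"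
    using assms(1) d unfolding L2.MCauchy_def by blast
  show "\<exists>N. \<forall>n n'. N \<le> n \<longrightarrow> N \<le> n' \<longrightarrow> L2_dist M (Y n) (Y n') < e"
  proof (intro exI allI impI)
    fix n n' assume "N \<le> n" "N \<le> n'"
    then have "L2_dist M (X n) (X n') < d" by (rule N)
    then have le: "C * L2_dist M (X n) (X n') \<le> C * d"
      using \<open>C \<ge> 0\<close> by (intro mult_left_mono) auto
    also have "C * d < (C + 1) * d" using d by (simp add: distrib_right)
    finally have lt: "C * L2_dist M (X n) (X n') < (C + 1) * d" .
    have "(L2_dist M (Y n) (Y n'))\<^sup>2 < e\<^sup>2"
      using assms(3)[of n n']
    proof
      assume "(L2_dist M (Y n) (Y n'))\<^sup>2 \<le> (C * L2_dist M (X n) (X n'))\<^sup>2"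
      also have "\<dots> < e\<^sup>2"
        using lt d' \<open>C \<ge> 0\<close> by (intro power_strict_mono) auto
      finally show ?thesis .
    qed (use lt d' in linarith)
    then show "L2_dist M (Y n) (Y n') < e"
      using e by (simp add: power2_less_imp_less)
  qed
qed

lemma MCauchy_L2_subseq:
  assumes "L2.MCauchy M X" "strict_mono (s :: nat \<Rightarrow> nat)"
  shows "L2.MCauchy M (\<lambda>n. X (s n))"
  using L2.MCauchy_subsequence[OF assms(2,1)] by (simp add: o_def)

lemma MCauchy_L2_add:
  assumes X: "L2.MCauchy M X" and Y: "L2.MCauchy M Y"
  shows "L2.MCauchy M (\<lambda>n. L2_add M (X n) (Y n))"
  unfolding L2.MCauchy_def
proof (intro conjI allI impI)
  have [simp]: "X n \<in> L2 M" "Y n \<in> L2 M" for n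
    using X Y unfolding L2.MCauchy_def by blast+
  then show "range (\<lambda>n. L2_add M (X n) (Y n)) \<subseteq> L2 M" by auto
  fix e :: real assume e: "e > 0"
  obtain N where N: "\<And>n n'. N \<le> n \<Longrightarrow> N \<le> n' \<Longrightarrow> L2_dist M (X n) (X n') < e / 2"
    using X e unfolding L2.MCauchy_def by (meson half_gt_zero)
  obtain N' where N': "\<And>n n'. N' \<le> n \<Longrightarrow> N' \<le> n' \<Longrightarrow> L2_dist M (Y n) (Y n') < e / 2"
    using Y e unfolding L2.MCauchy_def by (meson half_gt_zero)
  have "L2_dist M (L2_add M (X n) (Y n)) (L2_add M (X n') (Y n')) < e"
    if "max N N' \<le> n" "max N N' \<le> n'" for n n'
  proof -
    have "L2_diff M (L2_add M (X n) (Y n)) (L2_add M (X n') (Y n'))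
        = L2_add M (L2_diff M (X n) (X n')) (L2_diff M (Y n) (Y n'))"
      by (intro L2_ext) auto
    then have "L2_dist M (L2_add M (X n) (Y n)) (L2_add M (X n') (Y n'))
        \<le> L2_dist M (X n) (X n') + L2_dist M (Y n) (Y n')"
      by (simp add: L2_dist_def L2_norm_triangle)
    then show ?thesis
      using N[of n n'] N'[of n n'] that by simp
  qed
  then show "\<exists>N. \<forall>n n'. N \<le> n \<longrightarrow> N \<le> n' \<longrightarrow>
      L2_dist M (L2_add M (X n) (Y n)) (L2_add M (X n') (Y n')) < e" by blast
qed

lemma bounded_op_dist:
  assumes T: "bounded_op M T"
  obtains C where "C \<ge> 0" "\<And>U V. U \<in> L2 M \<Longrightarrow> V \<in> L2 M \<Longrightarrow> L2_dist M (T U) (T V) \<le> C * L2_dist M U V"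
  using bounded_opD(7)[OF T] by (metis L2_closed(4) L2_dist_def bounded_opD(4)[OF T])

lemma compact_op_zero: "compact_op M (op_zero M)"
  unfolding compact_op_iff
  by (auto simp: bounded_op_zero L2.MCauchy_def L2_dist_def
      intro!: exI[of _ id] strict_mono_id)

lemma compact_op_compose_left:
  assumes S: "bounded_op M S" and T: "compact_op M T"
  shows "compact_op M (op_comp M S T)"
  unfolding compact_op_iff
proof (intro conjI allI impI)
  have T': "bounded_op M T" using T by (simp add: compact_op_def)
  note [simp] = bounded_opD(1)[OF T'] bounded_opD(1)[OF S]
  show "bounded_op M (op_comp M S T)" by (intro bounded_op_intros S T')
  obtain C where C: "C \<ge> 0" "\<And>U V. U \<in> L2 M \<Longrightarrow> V \<in> L2 M \<Longrightarrow> L2_dist M (S U) (S V) \<le> C * L2_dist M U V"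
    using bounded_op_dist[OF S] by blast
  fix U assume U: "\<forall>n::nat. U n \<in> L2 M \<and> L2_norm M (U n) \<le> 1"
  then obtain s where s: "strict_mono s" "L2.MCauchy M (\<lambda>n. T (U (s n)))"
    using compact_opE[OF T, of U] by blast
  have "L2.MCauchy M (\<lambda>n. S (T (U (s n))))"
    by (rule MCauchy_L2_comparison[OF s(2) _ disjI1 C(1)]) (use U C(2) in \<open>auto intro!: power_mono\<close>)
  then show "\<exists>s. strict_mono s \<and> L2.MCauchy M (\<lambda>n. op_comp M S T (U (s n)))"
    using s(1) U by (auto simp: compose_def)
qed

lemma compact_op_compose_right:
  assumes S: "bounded_op M S" and T: "compact_op M T"
  shows "compact_op M (op_comp M T S)"
  unfolding compact_op_iff
proof (intro conjI allI impI)
  have T': "bounded_op M T" using T by (simp add: compact_op_def)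
  note [simp] = bounded_opD(1-5)[OF T'] bounded_opD(1-5)[OF S]
  show "bounded_op M (op_comp M T S)" by (intro bounded_op_intros S T')
  obtain C where C: "C \<ge> 0" "\<And>U. U \<in> L2 M \<Longrightarrow> L2_norm M (S U) \<le> C * L2_norm M U"
    using bounded_opD(7)[OF S] by blast
  fix U assume U: "\<forall>n::nat. U n \<in> L2 M \<and> L2_norm M (U n) \<le> 1"
  \<comment> \<open>The factor brings the bounded sequence \<open>S (U n)\<close> back into the unit
    ball, where compactness of \<open>T\<close> applies.\<close>
  define V where "V n = L2_scale M (of_real (1 / (C + 1))) (S (U n))" for n
  have V: "V n \<in> L2 M" for n using U by (simp add: V_def)
  have "L2_norm M (V n) \<le> 1" for n
  proof -
    have "L2_norm M (S (U n)) \<le> C * 1"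
      using C(2)[of "U n"] mult_left_mono[of "L2_norm M (U n)" 1 C] U C(1) by (auto intro: order_trans)
    then show ?thesis
      using C(1) U by (simp add: V_def norm_divide del: of_real_add)
  qed
  then obtain s where s: "strict_mono s" "L2.MCauchy M (\<lambda>n. T (V (s n)))"
    using compact_opE[OF T, of V] V by blast
  have "complex_of_real (C + 1) \<noteq> 0" using C(1) by (simp only: of_real_eq_0_iff)
  then have "complex_of_real C + 1 \<noteq> 0" by simp
  then have eq: "T (S (U n)) = L2_scale M (of_real (C + 1)) (T (V n))" for n
    using U C(1) by - (rule L2_ext[of _ M], auto simp: V_def simp flip: of_real_mult)
  have "L2_dist M (T (S (U n))) (T (S (U m))) = (C + 1) * L2_dist M (T (V n)) (T (V m))" for n m
  proof -
    have "L2_diff M (T (S (U n))) (T (S (U m))) = L2_scale M (of_real (C + 1)) (L2_diff M (T (V n)) (T (V m)))"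
      unfolding eq using V by - (rule L2_ext[of _ M], auto simp: algebra_simps)
    then show ?thesis
      using V C(1) by (simp add: L2_dist_def del: of_real_add)
  qed
  then have "L2.MCauchy M (\<lambda>n. T (S (U (s n))))"
    by (intro MCauchy_L2_comparison[OF s(2), of _ "C + 1"] disjI1) (use U C(1) in auto)
  then show "\<exists>s. strict_mono s \<and> L2.MCauchy M (\<lambda>n. op_comp M T S (U (s n)))"
    using s(1) U by (auto simp: compose_def)
qed

lemma compact_op_add:
  assumes S: "compact_op M S" and T: "compact_op M T"
  shows "compact_op M (op_add M S T)"
  unfolding compact_op_iff
proof (intro conjI allI impI)
  show "bounded_op M (op_add M S T)"
    using S T by (intro bounded_op_intros) (auto simp: compact_op_def)
  fix U assume U: "\<forall>n::nat. U n \<in> L2 M \<and> L2_norm M (U n) \<le> 1"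
  then obtain s where s: "strict_mono s" "L2.MCauchy M (\<lambda>n. S (U (s n)))"
    using compact_opE[OF S, of U] by blast
  obtain t where t: "strict_mono t" "L2.MCauchy M (\<lambda>n. T (U (s (t n))))"
    using compact_opE[OF T, of "\<lambda>n. U (s n)"] U by blast
  have "L2.MCauchy M (\<lambda>n. L2_add M (S (U (s (t n)))) (T (U (s (t n)))))"
    by (rule MCauchy_L2_add[OF MCauchy_L2_subseq[OF s(2) t(1)] t(2)])
  then show "\<exists>s. strict_mono s \<and> L2.MCauchy M (\<lambda>n. op_add M S T (U (s n)))"
    using U strict_mono_o[OF s(1) t(1)] by (intro exI[of _ "s \<circ> t"]) (auto simp: o_def)
qed

lemma compact_op_scale:
  assumes T: "compact_op M T"
  shows "compact_op M (op_scale M c T)"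
proof -
  have T': "bounded_op M T" using T by (simp add: compact_op_def)
  have "op_scale M c T = op_comp M (op_scale M c (\<lambda>U\<in>L2 M. U)) T"
    using bounded_opD(1)[OF T'] by (auto simp: compose_def fun_eq_iff restrict_def)
  then show ?thesis
    by (simp only:) (intro compact_op_compose_left bounded_op_intros T)
qed

text \<open>\<open>\<parallel>T\<^sup>*U\<parallel>\<^sup>2 \<le> \<parallel>T T\<^sup>* U\<parallel> \<parallel>U\<parallel>\<close>, and \<open>T T\<^sup>*\<close> is compact.\<close>

lemma compact_op_adj:
  assumes T: "compact_op M T"
  shows "compact_op M (op_adj M T)"
  unfolding compact_op_iff
proof (intro conjI allI impI)
  have T': "bounded_op M T" using T by (simp add: compact_op_def)
  show adj: "bounded_op M (op_adj M T)" by (rule op_adj(1)[OF T'])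
  note [simp] = bounded_opD(1-5)[OF T'] bounded_opD(1-5)[OF adj] op_adj[OF T']
  fix U assume U: "\<forall>n::nat. U n \<in> L2 M \<and> L2_norm M (U n) \<le> 1"
  then obtain s where s: "strict_mono s" "L2.MCauchy M (\<lambda>n. op_comp M T (op_adj M T) (U (s n)))"
    using compact_opE[OF compact_op_compose_right[OF adj T], of U] by blast
  have "L2.MCauchy M (\<lambda>n. op_adj M T (U (s n)))"
  proof (rule MCauchy_L2_comparison[OF s(2) _ disjI2])
    fix n m
    \<comment> \<open>A difference of two vectors of the unit ball has norm at most 2, which is the
      factor in the comparison.\<close>
    define V where "V = L2_diff M (U (s n)) (U (s m))"
    have V: "V \<in> L2 M" using U by (simp add: V_def)
    have "L2_norm M V \<le> L2_norm M (L2_diff M (U (s n)) (L2_zero M)) + L2_norm M (L2_diff M (L2_zero M) (U (s m)))"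
      unfolding V_def using U by (intro L2_norm_diff_triangle) auto
    also have "\<dots> = L2_norm M (L2_diff M (U (s n)) (L2_zero M)) + L2_norm M (L2_diff M (U (s m)) (L2_zero M))"
      by (simp add: L2_norm_diff_commute)
    also have "\<dots> = L2_norm M (U (s n)) + L2_norm M (U (s m))"
    proof -
      have "L2_diff M W (L2_zero M) = W" if "W \<in> L2 M" for W
        using that by (intro L2_ext) auto
      then show ?thesis using U by simp
    qed
    also have "\<dots> \<le> 2" using U[rule_format, of "s n"] U[rule_format, of "s m"] by simp
    finally have V2: "L2_norm M V \<le> 2" .
    have "(L2_dist M (op_adj M T (U (s n))) (op_adj M T (U (s m))))\<^sup>2 = (L2_norm M (op_adj M T V))\<^sup>2"
      using U by (simp add: L2_dist_def V_def)
    also have "\<dots> = Re (L2_inner M (T (op_adj M T V)) V)"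
      using V by (simp add: L2_norm_square)
    also have "\<dots> \<le> L2_norm M (T (op_adj M T V)) * L2_norm M V"
      using L2_Cauchy_Schwarz[of "T (op_adj M T V)" M V] V complex_Re_le_cmod order_trans by fastforce
    also have "\<dots> \<le> L2_norm M (T (op_adj M T V)) * 2"
      using V2 by (intro mult_left_mono) auto
    also have "L2_norm M (T (op_adj M T V)) = L2_dist M (T (op_adj M T (U (s n)))) (T (op_adj M T (U (s m))))"
      using U by (simp add: L2_dist_def V_def)
    finally show "(L2_dist M (op_adj M T (U (s n))) (op_adj M T (U (s m))))\<^sup>2
        \<le> 2 * L2_dist M (op_comp M T (op_adj M T) (U (s n))) (op_comp M T (op_adj M T) (U (s m)))"
      using U by (simp add: compose_def)
  qed (use U in auto)
  then show "\<exists>s. strict_mono s \<and> L2.MCauchy M (\<lambda>n. op_adj M T (U (s n)))"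
    using s(1) by blast
qed

text \<open>The images of the sequence are totally bounded: take a finite \<open>e / 4\<close>-net
  for the images under a nearby compact \<open>S\<close>; the same indices give an
  \<open>e\<close>-net for the images under \<open>T\<close>, by three errors of
  \<open>e / 4\<close>.\<close>

lemma compact_op_limit:
  assumes T: "bounded_op M T"
    and approx: "\<And>e. e > 0 \<Longrightarrow> \<exists>S. compact_op M S \<and> (\<forall>U\<in>L2 M. L2_dist M (T U) (S U) \<le> e * L2_norm M U)"
  shows "compact_op M T"
  unfolding compact_op_iff
proof (intro conjI allI impI T)
  fix U assume U: "\<forall>n::nat. U n \<in> L2 M \<and> L2_norm M (U n) \<le> 1"
  have "L2.mtotally_bounded M (range (\<lambda>n. T (U n)))"
    unfolding L2.mtotally_bounded_def
  proof (intro allI impI)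
    fix e :: real assume e: "e > 0"
    obtain S where S: "compact_op M S" "\<And>U. U \<in> L2 M \<Longrightarrow> L2_dist M (T U) (S U) \<le> e / 4 * L2_norm M U"
      using approx[of "e / 4"] e by auto
    note [simp] = bounded_opD(1)[OF T] bounded_opD(1)[OF S(1)[unfolded compact_op_def, THEN conjunct1]]
    have TS: "L2_dist M (T (U n)) (S (U n)) \<le> e / 4" for n
      using S(2)[of "U n"] U mult_left_mono[of "L2_norm M (U n)" 1 "e / 4"] e by (auto intro: order_trans)
    have "L2.mtotally_bounded M (range (\<lambda>n. S (U n)))"
      unfolding L2.mtotally_bounded_sequentially
    proof (intro conjI allI impI)
      show "range (\<lambda>n. S (U n)) \<subseteq> L2 M" using U by auto
      fix \<sigma> :: "nat \<Rightarrow> _" assume "range \<sigma> \<subseteq> range (\<lambda>n. S (U n))"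
      then have "\<forall>k. \<exists>n. \<sigma> k = S (U n)" by blast
      then obtain f where f: "\<And>k. \<sigma> k = S (U (f k))" by metis
      obtain s where "strict_mono s" "L2.MCauchy M (\<lambda>n. S (U (f (s n))))"
        using compact_opE[OF S(1), of "\<lambda>k. U (f k)"] U by blast
      then show "\<exists>r. strict_mono r \<and> L2.MCauchy M (\<sigma> \<circ> r)"
        by (auto simp: o_def f)
    qed
    then obtain K where K: "finite K" "K \<subseteq> range (\<lambda>n. S (U n))"
        "range (\<lambda>n. S (U n)) \<subseteq> (\<Union>x\<in>K. L2.mball M x (e / 4))"
      using e unfolding L2.mtotally_bounded_def by (metis zero_less_divide_iff zero_less_numeral)
    then obtain J where J: "finite J" "K = (\<lambda>n. S (U n)) ` J"
      by (meson finite_subset_image)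
    have "\<exists>j\<in>J. T (U n) \<in> L2.mball M (T (U j)) e" for n
    proof -
      have "S (U n) \<in> (\<Union>x\<in>K. L2.mball M x (e / 4))" using K(3) by blast
      then obtain j where j: "j \<in> J" "L2_dist M (S (U j)) (S (U n)) < e / 4"
        using J(2) by (auto simp: L2.in_mball)
      have "L2_dist M (T (U j)) (T (U n)) \<le> L2_dist M (T (U j)) (S (U j)) + L2_dist M (S (U j)) (T (U n))"
        using U by (intro L2.triangle) auto
      also have "L2_dist M (S (U j)) (T (U n)) \<le> L2_dist M (S (U j)) (S (U n)) + L2_dist M (S (U n)) (T (U n))"
        using U by (intro L2.triangle) auto
      finally have "L2_dist M (T (U j)) (T (U n)) < e"
        using TS[of j] TS[of n] j(2) e by (simp add: L2.commute[of M "S (U n)"])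
      then show "\<exists>j\<in>J. T (U n) \<in> L2.mball M (T (U j)) e"
        using j(1) U by (auto simp: L2.in_mball)
    qed
    then have "range (\<lambda>n. T (U n)) \<subseteq> (\<Union>x\<in>(\<lambda>n. T (U n)) ` J. L2.mball M x e)"
      by blast
    then show "\<exists>K. finite K \<and> K \<subseteq> range (\<lambda>n. T (U n)) \<and> range (\<lambda>n. T (U n)) \<subseteq> (\<Union>x\<in>K. L2.mball M x e)"
      using J(1) by (intro exI[of _ "(\<lambda>n. T (U n)) ` J"]) auto
  qed
  then have "\<exists>r. strict_mono r \<and> L2.MCauchy M ((\<lambda>n. T (U n)) \<circ> r)"
    unfolding L2.mtotally_bounded_sequentially by blast
  then show "\<exists>s. strict_mono s \<and> L2.MCauchy M (\<lambda>n. T (U (s n)))"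
    by (simp add: o_def)
qed

section \<open>Multiplication operators\<close>

text \<open>Larger than \<open>C0\<close>, because local compactness is later shown by means of a
  discontinuous truncation of a \<open>C0\<close> function.\<close>

definition bounded_fun :: "'a measure \<Rightarrow> ('a \<Rightarrow> complex) \<Rightarrow> bool" where
  "bounded_fun M h \<longleftrightarrow> h \<in> borel_measurable M \<and> (\<exists>C. \<forall>x. cmod (h x) \<le> C)"

lemma bounded_fun_L2:
  assumes "bounded_fun M h" "f \<in> L2_fun M"
  shows "(\<lambda>x. h x * f x) \<in> L2_fun M"
  using assms L2_fun_bounded_mult unfolding bounded_fun_def by blast

lemma bounded_fun_cnj: "bounded_fun M h \<Longrightarrow> bounded_fun M (\<lambda>x. cnj (h x))"
  unfolding bounded_fun_def
  by (auto intro!: borel_measurable_continuous_on[of cnj] continuous_intros)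

lemma mult_op_in:
  assumes "bounded_fun M h" "U \<in> L2 M"
  shows "mult_op M h U \<in> L2 M"
  using assms by (simp add: mult_op_def L2_class_in bounded_fun_L2 rep_in_L2_fun)

lemma AE_rep_mult_op:
  assumes "bounded_fun M h" "U \<in> L2 M"
  shows "AE x in M. rep (mult_op M h U) x = h x * rep U x"
  using assms AE_rep_class[OF bounded_fun_L2[OF assms(1) rep_in_L2_fun[OF assms(2)]]]
  by (simp add: mult_op_def)

lemma L2_inner_mult_op:
  assumes "bounded_fun M h" "U \<in> L2 M" "W \<in> L2 M"
  shows "L2_inner M W (mult_op M h U) = (\<integral>x. cnj (rep W x) * (h x * rep U x) \<partial>M)"
  using assms by (simp add: mult_op_def L2_inner_class bounded_fun_L2 rep_in_L2_fun)

lemma L2_inner_mult_op_left: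
  assumes h: "bounded_fun M h" and "U \<in> L2 M" "W \<in> L2 M"
  shows "L2_inner M (mult_op M h W) U = L2_inner M W (mult_op M (\<lambda>x. cnj (h x)) U)"
proof -
  have "L2_inner M (mult_op M h W) U = cnj (\<integral>x. cnj (rep U x) * (h x * rep W x) \<partial>M)"
    by (subst L2_inner_commute) (simp add: L2_inner_mult_op assms)
  also have "\<dots> = (\<integral>x. cnj (cnj (rep U x) * (h x * rep W x)) \<partial>M)"
    by (rule Bochner_Integration.integral_cnj[symmetric])
  also have "\<dots> = L2_inner M W (mult_op M (\<lambda>x. cnj (h x)) U)"
    by (simp add: L2_inner_mult_op bounded_fun_cnj assms mult_ac)
  finally show ?thesis .
qed

lemma L2_norm_mult_op_le:
  assumes h: "bounded_fun M h" and U: "U \<in> L2 M" and C: "\<And>x. rep U x \<noteq> 0 \<Longrightarrow> cmod (h x) \<le> C" "C \<ge> 0"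
  shows "L2_norm M (mult_op M h U) \<le> C * L2_norm M U"
proof -
  note hU = bounded_fun_L2[OF h rep_in_L2_fun[OF U]]
  have "(cmod (h x * rep U x))\<^sup>2 \<le> C\<^sup>2 * (cmod (rep U x))\<^sup>2" for x
  proof (cases "rep U x = 0")
    case False
    then have "(cmod (h x))\<^sup>2 * (cmod (rep U x))\<^sup>2 \<le> C\<^sup>2 * (cmod (rep U x))\<^sup>2"
      by (intro mult_right_mono power_mono C) auto
    then show ?thesis by (simp add: norm_mult power_mult_distrib)
  qed simp
  then have "(\<integral>x. (cmod (h x * rep U x))\<^sup>2 \<partial>M) \<le> (\<integral>x. C\<^sup>2 * (cmod (rep U x))\<^sup>2 \<partial>M)"
    using L2_funD(2)[OF hU] L2_funD(2)[OF rep_in_L2_fun[OF U]] by (intro integral_mono) auto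
  also have "\<dots> = C\<^sup>2 * (\<integral>x. (cmod (rep U x))\<^sup>2 \<partial>M)"
    by simp
  finally have "sqrt (\<integral>x. (cmod (h x * rep U x))\<^sup>2 \<partial>M) \<le> sqrt (C\<^sup>2 * (\<integral>x. (cmod (rep U x))\<^sup>2 \<partial>M))"
    by (rule real_sqrt_le_mono)
  also have "\<dots> = C * L2_norm M U"
    using C(2) by (simp add: real_sqrt_mult L2_norm_def)
  finally show ?thesis
    using U by (simp add: mult_op_def L2_norm_class hU)
qed

lemma bounded_op_mult:
  assumes h: "bounded_fun M h"
  shows "bounded_op M (mult_op M h)"
proof -
  obtain C where C: "\<And>x. cmod (h x) \<le> C" using h by (auto simp: bounded_fun_def)
  have "C \<ge> 0" using C[of undefined] norm_ge_zero order_trans by blast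
  note [simp] = mult_op_in[OF h]
  show ?thesis
  proof (rule bounded_opI[where C = C])
    show "mult_op M h \<in> extensional (L2 M)" by (simp add: mult_op_def)
    show "L2_norm M (mult_op M h U) \<le> C * L2_norm M U" if "U \<in> L2 M" for U
      by (rule L2_norm_mult_op_le[OF h that C \<open>C \<ge> 0\<close>])
    \<comment> \<open>Linearity is tested against a vector, and the multiplier is moved onto that
      vector as its conjugate, where the sum no longer meets it.\<close>
    fix U V assume "U \<in> L2 M" "V \<in> L2 M"
    then show "mult_op M h (L2_add M U V) = L2_add M (mult_op M h U) (mult_op M h V)"
      using L2_inner_mult_op_left[OF bounded_fun_cnj[OF h]]
      by - (rule L2_ext[of _ M], simp_all flip: L2_inner_mult_op_left[OF bounded_fun_cnj[OF h], simplified]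
          add: mult_op_in[OF bounded_fun_cnj[OF h]])
  next
    fix U c assume "U \<in> L2 M"
    then show "mult_op M h (L2_scale M c U) = L2_scale M c (mult_op M h U)"
      by - (rule L2_ext[of _ M], simp_all flip: L2_inner_mult_op_left[OF bounded_fun_cnj[OF h], simplified]
          add: mult_op_in[OF bounded_fun_cnj[OF h]])
  qed simp
qed

lemma op_adj_mult:
  assumes h: "bounded_fun M h"
  shows "op_adj M (mult_op M h) = mult_op M (\<lambda>x. cnj (h x))"
  using L2_inner_mult_op_left[OF bounded_fun_cnj[OF h]]
  by (intro op_adj_unique bounded_op_mult bounded_fun_cnj h) simp

lemma mult_op_eqI:
  assumes h: "bounded_fun M h" and g: "bounded_fun M g" and UV: "U \<in> L2 M" "V \<in> L2 M"
    and eq: "AE x in M. h x * rep U x = g x * rep V x"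
  shows "mult_op M h U = mult_op M g V"
proof (rule L2_eqI)
  show "AE x in M. rep (mult_op M h U) x = rep (mult_op M g V) x"
    using eq AE_rep_mult_op[OF h UV(1)] AE_rep_mult_op[OF g UV(2)] by eventually_elim simp
qed (intro mult_op_in h g UV)+

lemma bounded_fun_const: "bounded_fun M (\<lambda>_. c)"
  by (auto simp: bounded_fun_def)

lemma mult_op_zero:
  assumes U: "U \<in> L2 M"
  shows "mult_op M (\<lambda>_. 0) U = L2_zero M"
proof (rule L2_eqI)
  show "AE x in M. rep (mult_op M (\<lambda>_. 0) U) x = rep (L2_zero M) x"
    using AE_rep_mult_op[OF bounded_fun_const[of M 0] U] AE_rep(1)[of M] by eventually_elim simp
qed (auto intro: mult_op_in bounded_fun_const U)

section \<open>Continuous functions vanishing at infinity\<close>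

lemma continuous_bounded_fun:
  assumes M: "sets M = sets borel" and h: "continuous_on UNIV h" and "\<And>x. cmod (h x) \<le> C"
  shows "bounded_fun M h"
proof -
  have "h \<in> borel_measurable M"
    using borel_measurable_continuous_onI[OF h] by (simp add: measurable_cong_sets[OF M refl])
  then show ?thesis using assms(3) by (auto simp: bounded_fun_def)
qed

lemma C0_bounded_fun:
  assumes M: "sets M = sets borel" and f: "f \<in> C0"
  shows "bounded_fun M f"
proof -
  have cont: "continuous_on UNIV f" using f by (simp add: C0_def)
  obtain K where K: "compact K" "\<And>x. x \<notin> K \<Longrightarrow> cmod (f x) < 1"
    using f[unfolded C0_def] zero_less_one by blast
  have "bounded (f ` K)"
    by (intro compact_imp_bounded compact_continuous_image K continuous_on_subset[OF cont]) simp
  then obtain C where C: "\<And>x. x \<in> K \<Longrightarrow> cmod (f x) \<le> C"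
    unfolding bounded_iff by blast
  have "cmod (f x) \<le> max C 1" for x
    using C[of x] K(2)[of x] by (cases "x \<in> K") auto
  then show ?thesis by (rule continuous_bounded_fun[OF M cont])
qed

lemma C0_cnj: "f \<in> C0 \<Longrightarrow> (\<lambda>x. cnj (f x)) \<in> C0"
  by (auto simp: C0_def intro!: continuous_intros)

lemma C0_if_compact_support:
  assumes "continuous_on UNIV f" "compact K" "\<And>x. x \<notin> K \<Longrightarrow> f x = 0"
  shows "f \<in> C0"
  using assms by (auto simp: C0_def intro!: exI[of _ K])

definition cutoff :: "'a::metric_space \<Rightarrow> real \<Rightarrow> 'a \<Rightarrow> complex" where
  "cutoff z r x = complex_of_real (max 0 (min 1 (r + 1 - dist z x)))"

lemma cutoff:
  shows "continuous_on UNIV (cutoff z r)"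
    and "cmod (cutoff z r x) \<le> 1"
    and "cmod (1 - cutoff z r x) \<le> 1"
    and "dist z x \<le> r \<Longrightarrow> cutoff z r x = 1"
    and "r + 1 \<le> dist z x \<Longrightarrow> cutoff z r x = 0"
proof -
  define c where "c = max 0 (min 1 (r + 1 - dist z x))"
  have c: "0 \<le> c" "c \<le> 1" by (auto simp: c_def)
  have eq: "cutoff z r x = complex_of_real c"
    by (simp add: cutoff_def c_def)
  have "cmod (complex_of_real (1 - c)) \<le> 1"
    unfolding norm_of_real using c by linarith
  then show "cmod (cutoff z r x) \<le> 1" "cmod (1 - cutoff z r x) \<le> 1"
    using c by (simp_all add: eq)
qed (auto simp: cutoff_def intro!: continuous_intros)

lemma cutoff_mult_C0:
  fixes M :: "'a::metric_space measure" and z :: 'a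
  assumes M: "proper_metric_measure_space M" and h: "continuous_on UNIV h"
  shows "(\<lambda>x. cutoff z r x * h x) \<in> C0"
proof (rule C0_if_compact_support)
  show "compact (cball z (r + 1))" using M by (simp add: proper_metric_measure_space_def)
qed (auto intro!: continuous_intros cutoff h simp: not_le less_imp_le)

lemma cutoff_C0:
  fixes M :: "'a::metric_space measure"
  assumes M: "proper_metric_measure_space M"
  shows "cutoff z r \<in> (C0 :: ('a \<Rightarrow> complex) set)"
  using cutoff_mult_C0[OF M, of "\<lambda>_. 1" z r] by simp

text \<open>Dominated convergence, the sequence being eventually constant at each point. It allows a
  bounded continuous multiplier to be replaced by multipliers in \<open>C0\<close>.\<close>

lemma cutoff_tendsto:
  assumes M: "proper_metric_measure_space M" and U: "U \<in> L2 M"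
  shows "(\<lambda>n. L2_dist M (mult_op M (cutoff z (real n)) U) U) \<longlonglongrightarrow> 0"
proof -
  let ?h = "\<lambda>n. cutoff z (real n)"
  have h: "bounded_fun M (?h n)" for n
    using M C0_bounded_fun cutoff_C0[OF M] by (auto simp: proper_metric_measure_space_def)
  note [measurable] = L2_funD(1)[OF rep_in_L2_fun[OF U]] h[unfolded bounded_fun_def, THEN conjunct1]
  note hU = bounded_fun_L2[OF h rep_in_L2_fun[OF U]]
  have dist: "L2_dist M (mult_op M (?h n) U) U = sqrt (\<integral>x. (cmod (?h n x * rep U x - rep U x))\<^sup>2 \<partial>M)" for n
  proof -
    have [measurable]: "rep (mult_op M (?h n) U) \<in> borel_measurable M"
      by (rule L2_funD(1)[OF rep_in_L2_fun[OF mult_op_in[OF h U]]])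
    have "(\<integral>x. (cmod (rep (mult_op M (?h n) U) x - rep U x))\<^sup>2 \<partial>M)
        = (\<integral>x. (cmod (?h n x * rep U x - rep U x))\<^sup>2 \<partial>M)"
    proof (rule integral_cong_AE)
      show "AE x in M. (cmod (rep (mult_op M (?h n) U) x - rep U x))\<^sup>2 = (cmod (?h n x * rep U x - rep U x))\<^sup>2"
        using AE_rep_mult_op[OF h[of n] U] by eventually_elim simp
    qed measurable
    then show ?thesis by (simp add: L2_dist_eq U mult_op_in h)
  qed
  have "(\<lambda>n. \<integral>x. (cmod (?h n x * rep U x - rep U x))\<^sup>2 \<partial>M) \<longlonglongrightarrow> (\<integral>x. 0 \<partial>M)"
  proof (rule integral_dominated_convergence)
    show "integrable M (\<lambda>x. (cmod (rep U x))\<^sup>2)" by (rule L2_funD(2)[OF rep_in_L2_fun[OF U]])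
    show "AE x in M. (\<lambda>n. (cmod (?h n x * rep U x - rep U x))\<^sup>2) \<longlonglongrightarrow> 0"
    proof (rule AE_I2, rule tendsto_eventually)
      fix x
      obtain N :: nat where N: "dist z x \<le> real N" using real_arch_simple by blast
      show "\<forall>\<^sub>F n in sequentially. (cmod (?h n x * rep U x - rep U x))\<^sup>2 = 0"
        using eventually_ge_at_top[of N]
      proof eventually_elim
        case (elim n)
        then have "dist z x \<le> real n" using N by linarith
        then show ?case by (simp add: cutoff)
      qed
    qed
    fix n
    show "AE x in M. norm ((cmod (?h n x * rep U x - rep U x))\<^sup>2) \<le> (cmod (rep U x))\<^sup>2"
    proof (rule AE_I2)
      fix x
      have "cmod (?h n x * rep U x - rep U x) = cmod (1 - ?h n x) * cmod (rep U x)"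
        by (metis left_diff_distrib mult_1 norm_minus_commute norm_mult)
      also have "\<dots> \<le> 1 * cmod (rep U x)"
        by (intro mult_right_mono cutoff) auto
      finally show "norm ((cmod (?h n x * rep U x - rep U x))\<^sup>2) \<le> (cmod (rep U x))\<^sup>2"
        by (simp add: power_mono)
    qed
  qed measurable
  then have "(\<lambda>n. sqrt (\<integral>x. (cmod (?h n x * rep U x - rep U x))\<^sup>2 \<partial>M)) \<longlonglongrightarrow> sqrt 0"
    by (intro tendsto_real_sqrt) simp
  then show ?thesis by (simp add: dist)
qed

section \<open>The Roe algebra is a star-algebra\<close>

text \<open>Pointwise distances between non-zero sets avoid closures of supports and the value of
  \<open>setdist\<close> on an empty set, and they combine directly with the triangle
  inequality.\<close>

lemma finite_propagation_iff:
  fixes M :: "'a::metric_space measure"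
  assumes M: "sets M = sets borel" and T: "bounded_op M T"
  shows "finite_propagation M T \<longleftrightarrow> (\<exists>R>0. \<forall>f\<in>C0. \<forall>g\<in>C0.
    (\<forall>x y. f x \<noteq> 0 \<longrightarrow> g y \<noteq> 0 \<longrightarrow> dist x y > R) \<longrightarrow>
    (\<forall>U\<in>L2 M. mult_op M f (T (mult_op M g U)) = L2_zero M))" (is "_ \<longleftrightarrow> ?rhs")
proof
  note bf = C0_bounded_fun[OF M]
  have eq: "compose (L2 M) (mult_op M f) (compose (L2 M) T (mult_op M g)) = op_zero M
      \<longleftrightarrow> (\<forall>U\<in>L2 M. mult_op M f (T (mult_op M g U)) = L2_zero M)" for f g
    by (auto simp: compose_def fun_eq_iff restrict_def)
  have sd: "setdist (fun_supp f) (fun_supp g) = setdist {x. f x \<noteq> 0} {x. g x \<noteq> 0}"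
    for f g :: "'a \<Rightarrow> complex" by (simp add: fun_supp_def)
  {
    assume "finite_propagation M T"
    then obtain R where R: "R > 0" "\<And>f g. f \<in> C0 \<Longrightarrow> g \<in> C0 \<Longrightarrow>
        setdist {x. f x \<noteq> 0} {x. g x \<noteq> 0} > R \<Longrightarrow>
        \<forall>U\<in>L2 M. mult_op M f (T (mult_op M g U)) = L2_zero M"
      unfolding finite_propagation_def eq sd by blast
    \<comment> \<open>Strict pointwise bounds only give a weak bound on the infimum; raising the
      constant by 1 restores strictness.\<close>
    show ?rhs
    proof (intro exI[of _ "R + 1"] conjI ballI impI)
      fix f g :: "'a \<Rightarrow> complex" and U
      assume f: "f \<in> C0" and g: "g \<in> C0" and far: "\<forall>x y. f x \<noteq> 0 \<longrightarrow> g y \<noteq> 0 \<longrightarrow> dist x y > R + 1"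
        and U: "U \<in> L2 M"
      show "mult_op M f (T (mult_op M g U)) = L2_zero M"
      proof (cases "{x. f x \<noteq> 0} = {} \<or> {x. g x \<noteq> 0} = {}")
        case True
        then have "f = (\<lambda>_. 0) \<or> g = (\<lambda>_. 0)" by auto
        then show ?thesis
          using bf[OF f] bf[OF g] U
          by (auto simp: mult_op_zero bounded_opD[OF T] mult_op_in bounded_opD(5)[OF bounded_op_mult])
      next
        case False
        then have "R + 1 \<le> setdist {x. f x \<noteq> 0} {x. g x \<noteq> 0}"
          using far by (intro le_setdistI) (auto simp: less_imp_le)
        then show ?thesis using R(2)[OF f g] U by auto
      qed
    qed (use R in simp)
  }
  assume ?rhs
  then obtain R where R: "R > 0" "\<And>f g. f \<in> C0 \<Longrightarrow> g \<in> C0 \<Longrightarrow>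
      (\<forall>x y. f x \<noteq> 0 \<longrightarrow> g y \<noteq> 0 \<longrightarrow> dist x y > R) \<Longrightarrow>
      \<forall>U\<in>L2 M. mult_op M f (T (mult_op M g U)) = L2_zero M"
    by blast
  show "finite_propagation M T"
    unfolding finite_propagation_def eq sd
  proof (intro exI[of _ R] conjI ballI impI)
    fix f g :: "'a \<Rightarrow> complex" and U
    assume f: "f \<in> C0" "g \<in> C0" and "R < setdist {x. f x \<noteq> 0} {x. g x \<noteq> 0}" and U: "U \<in> L2 M"
    then have "\<forall>x y. f x \<noteq> 0 \<longrightarrow> g y \<noteq> 0 \<longrightarrow> dist x y > R"
      by (metis (mono_tags, lifting) mem_Collect_eq order_less_le_trans setdist_le_dist)
    from R(2)[OF f this] U show "mult_op M f (T (mult_op M g U)) = L2_zero M" by blast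
  qed (rule R(1))
qed

text \<open>To compose, insert between the two factors a continuous function that is 1 near the support
  of the right-hand multiplier; the cutoffs make the inserted functions vanish at infinity.\<close>

lemma finite_propagation_compose:
  fixes M :: "'a::metric_space measure"
  assumes M: "proper_metric_measure_space M"
    and T: "bounded_op M T" "finite_propagation M T" and S: "bounded_op M S" "finite_propagation M S"
  shows "finite_propagation M (op_comp M T S)"
proof -
  have borel: "sets M = sets borel" using M by (simp add: proper_metric_measure_space_def)
  note bf = C0_bounded_fun[OF borel]
  obtain RT where RT: "RT > 0" "\<And>f g U. f \<in> C0 \<Longrightarrow> g \<in> C0 \<Longrightarrow>
      (\<And>x y. f x \<noteq> 0 \<Longrightarrow> g y \<noteq> 0 \<Longrightarrow> dist x y > RT) \<Longrightarrow> U \<in> L2 M \<Longrightarrow>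
      mult_op M f (T (mult_op M g U)) = L2_zero M"
    using T(2) unfolding finite_propagation_iff[OF borel T(1)] by blast
  obtain RS where RS: "RS > 0" "\<And>f g U. f \<in> C0 \<Longrightarrow> g \<in> C0 \<Longrightarrow>
      (\<And>x y. f x \<noteq> 0 \<Longrightarrow> g y \<noteq> 0 \<Longrightarrow> dist x y > RS) \<Longrightarrow> U \<in> L2 M \<Longrightarrow>
      mult_op M f (S (mult_op M g U)) = L2_zero M"
    using S(2) unfolding finite_propagation_iff[OF borel S(1)] by blast
  note TS = bounded_op_compose[OF T(1) S(1)]
  show ?thesis
    unfolding finite_propagation_iff[OF borel TS]
  proof (intro exI[of _ "RT + RS + 2"] conjI ballI impI)
    fix f g :: "'a \<Rightarrow> complex" and U
    assume f: "f \<in> C0" and g: "g \<in> C0" and U: "U \<in> L2 M"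
      and far: "\<forall>x y. f x \<noteq> 0 \<longrightarrow> g y \<noteq> 0 \<longrightarrow> RT + RS + 2 < dist x y"
    define A where "A = {y. g y \<noteq> 0}"
    define W where "W = S (mult_op M g U)"
    have W: "W \<in> L2 M"
      unfolding W_def by (intro bounded_opD(1)[OF S(1)] mult_op_in bf g U)
    have "mult_op M f (T W) = L2_zero M"
    proof (cases "A = {}")
      case True
      then have "g = (\<lambda>_. 0)" by (auto simp: A_def)
      then have "W = L2_zero M"
        unfolding W_def using mult_op_zero[OF U] bounded_opD(5)[OF S(1)] by simp
      then show ?thesis
        by (simp add: bounded_opD(5)[OF T(1)] bounded_opD(5)[OF bounded_op_mult[OF bf[OF f]]])
    next
      case A: False
      \<comment> \<open>\<open>h\<close> is 1 up to distance \<open>RS + 1\<close> from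
        \<open>A\<close> and 0 from distance \<open>RS + 2\<close> on. Thus \<open>1 - h\<close>
        lives farther than \<open>RS\<close> from \<open>g\<close>, while \<open>h\<close> lives
        farther than \<open>RT\<close> from \<open>f\<close>; this accounts for the constant
        \<open>RT + RS + 2\<close>.\<close>
      define h where "h x = complex_of_real (max 0 (min 1 (RS + 2 - infdist x A)))" for x
      have h_cont: "continuous_on UNIV h"
        unfolding h_def by (intro continuous_intros)
      let ?c = "\<lambda>n x. cutoff undefined (real n) x"
      have near: "\<exists>a. g a \<noteq> 0 \<and> dist x a < RS + 2" if "h x \<noteq> 0" for x
      proof -
        have "infdist x A < RS + 2" using that by (auto simp: h_def)
        then show ?thesis
          using A setdist_ltE[of "{x}" A "RS + 2"] by (auto simp: infdist_eq_setdist A_def)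
      qed
      have not_near: "dist x y > RS" if "1 - h x \<noteq> 0" "g y \<noteq> 0" for x y
      proof -
        have "infdist x A > RS + 1" using that(1) by (auto simp: h_def)
        moreover have "infdist x A \<le> dist x y" using that(2) by (intro infdist_le) (simp add: A_def)
        ultimately show ?thesis by simp
      qed
      have ch: "(\<lambda>x. ?c n x * h x) \<in> C0" and ch': "(\<lambda>x. ?c n x * (1 - h x)) \<in> C0" for n
        by (intro cutoff_mult_C0[OF M] h_cont continuous_intros)+
      \<comment> \<open>The complementary multiplier \<open>?c n * (1 - h)\<close> lives farther
        than \<open>RS\<close> from \<open>A\<close>, hence annihilates \<open>W\<close>.\<close>
      have cW: "mult_op M (?c n) W = mult_op M (\<lambda>x. ?c n x * h x) W" for n
      proof (rule mult_op_eqI[OF bf[OF cutoff_C0[OF M]] bf[OF ch] W W])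
        have "mult_op M (\<lambda>x. ?c n x * (1 - h x)) W = L2_zero M"
          unfolding W_def by (rule RS(2)[OF ch' g _ U]) (use not_near in auto)
        then show "AE x in M. ?c n x * rep W x = ?c n x * h x * rep W x"
          using AE_rep_mult_op[OF bf[OF ch'[of n]] W] AE_rep(1)[of M]
          by (auto simp: algebra_simps elim: eventually_elim2)
      qed
      have zero: "mult_op M f (T (mult_op M (?c n) W)) = L2_zero M" for n
        unfolding cW
      proof (rule RT(2)[OF f ch _ W])
        fix x y assume "f x \<noteq> 0" "?c n y * h y \<noteq> 0"
        then obtain a where a: "g a \<noteq> 0" "dist y a < RS + 2" using near[of y] by auto
        have "RT + RS + 2 < dist x a" using far \<open>f x \<noteq> 0\<close> a(1) by blast
        also have "\<dots> \<le> dist x y + dist y a" by (rule dist_triangle)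
        finally show "RT < dist x y" using a(2) by simp
      qed
      \<comment> \<open>\<open>B\<close> is continuous and annihilates all truncations of
        \<open>W\<close>, hence \<open>W\<close> itself.\<close>
      define B where "B = op_comp M (mult_op M f) T"
      have B: "bounded_op M B"
        unfolding B_def by (intro bounded_op_compose bounded_op_mult bf f T)
      obtain C where C: "C \<ge> 0" "\<And>U V. U \<in> L2 M \<Longrightarrow> V \<in> L2 M \<Longrightarrow> L2_dist M (B U) (B V) \<le> C * L2_dist M U V"
        using bounded_op_dist[OF B] by blast
      have cW_in: "mult_op M (?c n) W \<in> L2 M" for n
        by (intro mult_op_in bf cutoff_C0[OF M] W)
      have "L2_dist M (L2_zero M) (B W) \<le> C * L2_dist M (mult_op M (?c n) W) W" for n
        using C(2)[OF cW_in W, of n] zero[of n] cW_in[of n] by (simp add: B_def compose_def)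
      moreover have "(\<lambda>n. C * L2_dist M (mult_op M (?c n) W) W) \<longlonglongrightarrow> 0"
        using tendsto_mult_right_zero[OF cutoff_tendsto[OF M W]] by simp
      ultimately have "L2_dist M (L2_zero M) (B W) \<le> 0"
        by (intro LIMSEQ_le_const) auto
      then have "L2_dist M (L2_zero M) (B W) = 0"
        using L2.nonneg[of M "L2_zero M" "B W"] by linarith
      then have "B W = L2_zero M"
        using L2.zero[of "L2_zero M" M "B W"] bounded_opD(1)[OF B W] by simp
      then show ?thesis using W by (simp add: B_def compose_def)
    qed
    then show "mult_op M f (op_comp M T S (mult_op M g U)) = L2_zero M"
      using mult_op_in[OF bf[OF g] U] by (simp add: compose_def W_def)
  qed (use RT RS in simp)
qed

lemma finite_propagation_zero:
  assumes M: "sets M = sets borel"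
  shows "finite_propagation M (op_zero M)"
  unfolding finite_propagation_iff[OF M bounded_op_zero]
  by (intro exI[of _ 1])
    (auto simp: mult_op_in C0_bounded_fun[OF M] bounded_opD(5)[OF bounded_op_mult])

lemma finite_propagation_add:
  fixes M :: "'a::metric_space measure"
  assumes M: "sets M = sets borel"
    and T: "bounded_op M T" "finite_propagation M T" and S: "bounded_op M S" "finite_propagation M S"
  shows "finite_propagation M (op_add M T S)"
proof -
  note bf = C0_bounded_fun[OF M]
  obtain RT where RT: "RT > 0" "\<And>f g U. f \<in> C0 \<Longrightarrow> g \<in> C0 \<Longrightarrow>
      (\<And>x y. f x \<noteq> 0 \<Longrightarrow> g y \<noteq> 0 \<Longrightarrow> dist x y > RT) \<Longrightarrow> U \<in> L2 M \<Longrightarrow>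
      mult_op M f (T (mult_op M g U)) = L2_zero M"
    using T(2) unfolding finite_propagation_iff[OF M T(1)] by blast
  obtain RS where RS: "RS > 0" "\<And>f g U. f \<in> C0 \<Longrightarrow> g \<in> C0 \<Longrightarrow>
      (\<And>x y. f x \<noteq> 0 \<Longrightarrow> g y \<noteq> 0 \<Longrightarrow> dist x y > RS) \<Longrightarrow> U \<in> L2 M \<Longrightarrow>
      mult_op M f (S (mult_op M g U)) = L2_zero M"
    using S(2) unfolding finite_propagation_iff[OF M S(1)] by blast
  show ?thesis
    unfolding finite_propagation_iff[OF M bounded_op_add[OF T(1) S(1)]]
  proof (intro exI[of _ "max RT RS"] conjI ballI impI)
    fix f g :: "'a \<Rightarrow> complex" and U
    assume f: "f \<in> C0" and g: "g \<in> C0" and U: "U \<in> L2 M"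
      and far: "\<forall>x y. f x \<noteq> 0 \<longrightarrow> g y \<noteq> 0 \<longrightarrow> max RT RS < dist x y"
    have "mult_op M f (T (mult_op M g U)) = L2_zero M"
      by (rule RT(2)[OF f g _ U]) (use far in auto)
    moreover have "mult_op M f (S (mult_op M g U)) = L2_zero M"
      by (rule RS(2)[OF f g _ U]) (use far in auto)
    ultimately
    show "mult_op M f (op_add M T S (mult_op M g U)) = L2_zero M"
      using mult_op_in[OF bf[OF g] U] bounded_opD(1)[OF T(1)] bounded_opD(1)[OF S(1)]
        bounded_opD(2)[OF bounded_op_mult[OF bf[OF f]]] by simp
  qed (use RT in auto)
qed

lemma finite_propagation_scale:
  fixes M :: "'a::metric_space measure"
  assumes M: "sets M = sets borel" and T: "bounded_op M T" "finite_propagation M T"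
  shows "finite_propagation M (op_scale M c T)"
proof -
  note bf = C0_bounded_fun[OF M]
  have "mult_op M f (op_scale M c T (mult_op M g U)) = L2_scale M c (mult_op M f (T (mult_op M g U)))"
    if "f \<in> C0" "g \<in> C0" "U \<in> L2 M" for f g U
    using mult_op_in[OF bf[OF that(2)] that(3)] bounded_opD(1)[OF T(1)]
      bounded_opD(3)[OF bounded_op_mult[OF bf[OF that(1)]]] by simp
  then show ?thesis
    using T(2) unfolding finite_propagation_iff[OF M T(1)] finite_propagation_iff[OF M bounded_op_scale[OF T(1)]]
    by (elim ex_forward) simp
qed

lemma finite_propagation_adj:
  fixes M :: "'a::metric_space measure"
  assumes M: "sets M = sets borel" and T: "bounded_op M T" "finite_propagation M T"
  shows "finite_propagation M (op_adj M T)"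
proof -
  note bf = C0_bounded_fun[OF M]
  obtain R where R: "R > 0" "\<And>f g U. f \<in> C0 \<Longrightarrow> g \<in> C0 \<Longrightarrow>
      (\<And>x y. f x \<noteq> 0 \<Longrightarrow> g y \<noteq> 0 \<Longrightarrow> dist x y > R) \<Longrightarrow> U \<in> L2 M \<Longrightarrow>
      mult_op M f (T (mult_op M g U)) = L2_zero M"
    using T(2) unfolding finite_propagation_iff[OF M T(1)] by blast
  show ?thesis
    unfolding finite_propagation_iff[OF M op_adj(1)[OF T(1)]]
  proof (intro exI[of _ R] conjI ballI impI)
    fix f g :: "'a \<Rightarrow> complex" and U
    assume f: "f \<in> C0" and g: "g \<in> C0" and U: "U \<in> L2 M"
      and far: "\<forall>x y. f x \<noteq> 0 \<longrightarrow> g y \<noteq> 0 \<longrightarrow> R < dist x y"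
    note [simp] = bounded_opD(1)[OF T(1)] bounded_opD(1)[OF op_adj(1)[OF T(1)]]
      mult_op_in[OF bf[OF f]] mult_op_in[OF bf[OF g]]
      mult_op_in[OF bf[OF C0_cnj[OF f]]] mult_op_in[OF bf[OF C0_cnj[OF g]]]
    show "mult_op M f (op_adj M T (mult_op M g U)) = L2_zero M"
    proof (rule L2_ext[of _ M])
      fix W assume W: "W \<in> L2 M"
      have "L2_inner M W (mult_op M f (op_adj M T (mult_op M g U)))
          = L2_inner M (mult_op M (\<lambda>x. cnj (f x)) W) (op_adj M T (mult_op M g U))"
        using L2_inner_mult_op_left[OF bf[OF C0_cnj[OF f]], of "op_adj M T (mult_op M g U)" W] U W by simp
      also have "\<dots> = L2_inner M (T (mult_op M (\<lambda>x. cnj (f x)) W)) (mult_op M g U)"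
        using U W by (simp add: op_adj[OF T(1)])
      also have "\<dots> = L2_inner M (mult_op M (\<lambda>x. cnj (g x)) (T (mult_op M (\<lambda>x. cnj (f x)) W))) U"
        using L2_inner_mult_op_left[OF bf[OF C0_cnj[OF g]], of U "T (mult_op M (\<lambda>x. cnj (f x)) W)"] U W by simp
      also have "mult_op M (\<lambda>x. cnj (g x)) (T (mult_op M (\<lambda>x. cnj (f x)) W)) = L2_zero M"
        by (rule R(2)[OF C0_cnj[OF g] C0_cnj[OF f] _ W]) (use far in \<open>metis complex_cnj_zero_iff dist_commute\<close>)
      finally show "L2_inner M W (mult_op M f (op_adj M T (mult_op M g U))) = L2_inner M W (L2_zero M)"
        using U W by simp
    qed (use U in auto)
  qed (use R in simp)
qed

section \<open>Matrices over a ring with involution\<close>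

text \<open>Murray-von Neumann equivalence of projection matrices is pure algebra over a ring with
  involution. The locale separates it from the analysis; it is entered once, through the unitization
  of the Roe algebra.\<close>

locale star_ring = ring R for R :: "'b star_alg" (structure) +
  assumes star_closed [simp, intro]: "a \<in> carrier R \<Longrightarrow> star R a \<in> carrier R"
    and star_star [simp]: "a \<in> carrier R \<Longrightarrow> star R (star R a) = a"
    and star_add: "a \<in> carrier R \<Longrightarrow> b \<in> carrier R \<Longrightarrow> star R (a \<oplus> b) = star R a \<oplus> star R b"
    and star_mult: "a \<in> carrier R \<Longrightarrow> b \<in> carrier R \<Longrightarrow> star R (a \<otimes> b) = star R b \<otimes> star R a"
begin

lemma star_zero [simp]: "star R \<zero> = \<zero>"
proof -
  have "star R \<zero> \<oplus> star R \<zero> = star R \<zero>"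
    by (simp flip: star_add)
  then have "\<ominus> star R \<zero> \<oplus> (star R \<zero> \<oplus> star R \<zero>) = \<ominus> star R \<zero> \<oplus> star R \<zero>"
    by simp
  then show ?thesis
    by (simp add: r_neg1 l_neg)
qed

lemma finsum_lessThan_Suc:
  "(\<And>i. i < Suc n \<Longrightarrow> f i \<in> carrier R) \<Longrightarrow> finsum R f {..<Suc n} = f n \<oplus> finsum R f {..<n}"
  by (simp add: lessThan_Suc finsum_insert Pi_iff)

lemma finsum_lessThan_closed:
  "(\<And>i. i < n \<Longrightarrow> f i \<in> carrier R) \<Longrightarrow> finsum R f {..<n} \<in> carrier R"
  by (auto intro: finsum_closed)

lemma finsum_lessThan_cong:
  "(\<And>i. i < n \<Longrightarrow> f i = g i) \<Longrightarrow> (\<And>i. i < n \<Longrightarrow> g i \<in> carrier R) \<Longrightarrow>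
    finsum R f {..<n :: nat} = finsum R g {..<n}"
  by (rule finsum_cong') auto

lemma finsum_lessThan_zero: "(\<And>i. i < n \<Longrightarrow> f i = \<zero>) \<Longrightarrow> finsum R f {..<n :: nat} = \<zero>"
  by (rule add.finprod_one_eqI) auto

lemma star_finsum:
  "(\<And>i. i < n \<Longrightarrow> f i \<in> carrier R) \<Longrightarrow>
    star R (finsum R f {..<n :: nat}) = finsum R (\<lambda>i. star R (f i)) {..<n}"
  by (induction n) (simp_all add: finsum_lessThan_Suc star_add finsum_lessThan_closed)

lemma finsum_lessThan_swap:
  "(\<And>i j. i < m \<Longrightarrow> j < n \<Longrightarrow> f i j \<in> carrier R) \<Longrightarrow>
    finsum R (\<lambda>i. finsum R (f i) {..<n :: nat}) {..<m :: nat} = finsum R (\<lambda>j. finsum R (\<lambda>i. f i j) {..<m}) {..<n}"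
proof (induction m)
  case (Suc m)
  have "finsum R (\<lambda>i. finsum R (f i) {..<n}) {..<Suc m}
      = finsum R (f m) {..<n} \<oplus> finsum R (\<lambda>j. finsum R (\<lambda>i. f i j) {..<m}) {..<n}"
    using Suc by (simp add: finsum_lessThan_Suc finsum_lessThan_closed)
  also have "\<dots> = finsum R (\<lambda>j. f m j \<oplus> finsum R (\<lambda>i. f i j) {..<m}) {..<n}"
    using Suc.prems by (intro finsum_addf[symmetric]) (auto intro: finsum_lessThan_closed)
  also have "\<dots> = finsum R (\<lambda>j. finsum R (\<lambda>i. f i j) {..<Suc m}) {..<n}"
    using Suc.prems by (intro finsum_lessThan_cong) (auto simp: finsum_lessThan_Suc finsum_lessThan_closed)
  finally show ?case .
qed (simp add: finsum_lessThan_zero)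

lemma finsum_lessThan_add:
  "(\<And>i. i < m + n \<Longrightarrow> f i \<in> carrier R) \<Longrightarrow>
    finsum R f {..<m + n :: nat} = finsum R f {..<m} \<oplus> finsum R (\<lambda>k. f (m + k)) {..<n}"
proof (induction n)
  case (Suc n)
  then show ?case
    by (simp add: finsum_lessThan_Suc finsum_lessThan_closed a_lcomm)
qed (simp add: finsum_lessThan_closed)

lemma mats_closed: "a \<in> mats R m n \<Longrightarrow> a i j \<in> carrier R"
  unfolding mats_def by (metis (mono_tags, lifting) mem_Collect_eq zero_closed)

lemma mats_zero: "a \<in> mats R m n \<Longrightarrow> m \<le> i \<or> n \<le> j \<Longrightarrow> a i j = \<zero>"
  by (auto simp: mats_def)

lemma matsI:
  "(\<And>i j. i < m \<Longrightarrow> j < n \<Longrightarrow> a i j \<in> carrier R) \<Longrightarrow>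
    (\<And>i j. m \<le> i \<or> n \<le> j \<Longrightarrow> a i j = \<zero>) \<Longrightarrow> a \<in> mats R m n"
  by (auto simp: mats_def not_less)

lemma mats_mult_in: "a \<in> mats R l m \<Longrightarrow> b \<in> mats R m n \<Longrightarrow> mats_mult R m a b \<in> mats R l n"
  by (rule matsI) (auto simp: mats_mult_def mats_closed mats_zero
      intro!: finsum_lessThan_closed finsum_lessThan_zero)

lemma mats_star_in: "a \<in> mats R m n \<Longrightarrow> mats_star R a \<in> mats R n m"
  by (rule matsI) (auto simp: mats_star_def mats_closed mats_zero)

lemma mats_star_star: "a \<in> mats R m n \<Longrightarrow> mats_star R (mats_star R a) = a"
  by (intro ext) (simp add: mats_star_def mats_closed)

lemma mats_mult_assoc:
  assumes a: "a \<in> mats R l m" and b: "b \<in> mats R m n" and c: "c \<in> mats R n p"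
  shows "mats_mult R n (mats_mult R m a b) c = mats_mult R m a (mats_mult R n b c)"
proof (intro ext)
  fix i j
  note [simp] = mats_closed[OF a] mats_closed[OF b] mats_closed[OF c]
  have "mats_mult R n (mats_mult R m a b) c i j
      = finsum R (\<lambda>k. finsum R (\<lambda>q. a i q \<otimes> b q k \<otimes> c k j) {..<m}) {..<n}"
    unfolding mats_mult_def
    by (intro finsum_lessThan_cong finsum_ldistr) (auto intro: finsum_lessThan_closed)
  also have "\<dots> = finsum R (\<lambda>q. finsum R (\<lambda>k. a i q \<otimes> b q k \<otimes> c k j) {..<n}) {..<m}"
    by (intro finsum_lessThan_swap) simp
  also have "\<dots> = mats_mult R m a (mats_mult R n b c) i j"
    unfolding mats_mult_def
  proof (intro finsum_lessThan_cong)
    fix q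
    show "finsum R (\<lambda>k. a i q \<otimes> b q k \<otimes> c k j) {..<n} = a i q \<otimes> finsum R (\<lambda>k. b q k \<otimes> c k j) {..<n}"
      by (subst finsum_rdistr) (auto simp: m_assoc)
  qed (auto intro: finsum_lessThan_closed)
  finally show "mats_mult R n (mats_mult R m a b) c i j = mats_mult R m a (mats_mult R n b c) i j" .
qed

lemma mats_star_mult:
  assumes a: "a \<in> mats R l m" and b: "b \<in> mats R m n"
  shows "mats_star R (mats_mult R m a b) = mats_mult R m (mats_star R b) (mats_star R a)"
  using mats_closed[OF a] mats_closed[OF b]
  by (intro ext) (simp add: mats_star_def mats_mult_def star_finsum star_mult)

section \<open>Block matrices\<close>

definition zero_mat :: "nat \<Rightarrow> nat \<Rightarrow> 'b" where
  "zero_mat = (\<lambda>i j. \<zero>)"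

definition add_mat :: "(nat \<Rightarrow> nat \<Rightarrow> 'b) \<Rightarrow> (nat \<Rightarrow> nat \<Rightarrow> 'b) \<Rightarrow> nat \<Rightarrow> nat \<Rightarrow> 'b" where
  "add_mat a b = (\<lambda>i j. a i j \<oplus> b i j)"

text \<open>\<open>m\<close> and \<open>n\<close> mark the row and the column at which the blocks
  meet; the outer sizes enter only through membership in \<open>mats\<close>.\<close>

definition block_mat :: "nat \<Rightarrow> nat \<Rightarrow> (nat \<Rightarrow> nat \<Rightarrow> 'b) \<Rightarrow> (nat \<Rightarrow> nat \<Rightarrow> 'b) \<Rightarrow>
    (nat \<Rightarrow> nat \<Rightarrow> 'b) \<Rightarrow> (nat \<Rightarrow> nat \<Rightarrow> 'b) \<Rightarrow> nat \<Rightarrow> nat \<Rightarrow> 'b" where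
  "block_mat m n a b c d = (\<lambda>i j.
     if i < m then (if j < n then a i j else b i (j - n))
     else (if j < n then c (i - m) j else d (i - m) (j - n)))"

lemma zero_mat_in: "zero_mat \<in> mats R m n"
  by (simp add: zero_mat_def mats_def)

lemma block_mat_in:
  assumes "a \<in> mats R m n" "b \<in> mats R m n'" "c \<in> mats R m' n" "d \<in> mats R m' n'"
  shows "block_mat m n a b c d \<in> mats R (m + m') (n + n')"
  using assms by (intro matsI) (auto simp: block_mat_def mats_closed mats_zero le_diff_conv2)

lemma block_mat_mult:
  assumes "a \<in> mats R l m" "b \<in> mats R l m'" "c \<in> mats R l' m" "d \<in> mats R l' m'"
    and "a' \<in> mats R m n" "b' \<in> mats R m n'" "c' \<in> mats R m' n" "d' \<in> mats R m' n'"
  shows "mats_mult R (m + m') (block_mat l m a b c d) (block_mat m n a' b' c' d')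
    = block_mat l n
        (add_mat (mats_mult R m a a') (mats_mult R m' b c'))
        (add_mat (mats_mult R m a b') (mats_mult R m' b d'))
        (add_mat (mats_mult R m c a') (mats_mult R m' d c'))
        (add_mat (mats_mult R m c b') (mats_mult R m' d d'))"
proof (intro ext)
  fix i j
  note [simp] = assms[THEN mats_closed]
  have closed: "block_mat l m a b c d i k \<in> carrier R" "block_mat m n a' b' c' d' k j \<in> carrier R" for k
    by (simp_all add: block_mat_def)
  show "mats_mult R (m + m') (block_mat l m a b c d) (block_mat m n a' b' c' d') i j
    = block_mat l n
        (add_mat (mats_mult R m a a') (mats_mult R m' b c'))
        (add_mat (mats_mult R m a b') (mats_mult R m' b d'))
        (add_mat (mats_mult R m c a') (mats_mult R m' d c'))
        (add_mat (mats_mult R m c b') (mats_mult R m' d d')) i j"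
    unfolding mats_mult_def
    by (subst finsum_lessThan_add)
      (auto simp: closed block_mat_def add_mat_def
        intro!: arg_cong2[where f = "(\<oplus>)"] finsum_lessThan_cong)
qed

lemma block_mat_star:
  "mats_star R (block_mat m n a b c d)
    = block_mat n m (mats_star R a) (mats_star R c) (mats_star R b) (mats_star R d)"
  by (intro ext) (simp add: mats_star_def block_mat_def)

lemma block_sum_eq: "block_sum R (n, p) (m, q) = (n + m, block_mat n n p zero_mat zero_mat q)"
  by (auto simp: block_sum_def block_mat_def zero_mat_def fun_eq_iff)

text \<open>An equality rather than an equivalence, since only indices are shifted. Regrouping
  summands therefore costs no partial isometry.\<close>

lemma block_sum_assoc: "block_sum R (block_sum R x y) z = block_sum R x (block_sum R y z)"
proof -
  obtain n p m q l r where "x = (n, p)" "y = (m, q)" "z = (l, r)"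
    by (metis surj_pair)
  then show ?thesis
    by (auto simp: block_sum_def fun_eq_iff)
qed

lemma mats_mult_zero [simp]:
  "a \<in> mats R l m \<Longrightarrow> mats_mult R m a zero_mat = zero_mat"
  "a \<in> mats R m n \<Longrightarrow> mats_mult R m zero_mat a = zero_mat"
  by (intro ext; simp add: mats_mult_def zero_mat_def mats_closed finsum_lessThan_zero)+

lemma mats_star_zero [simp]: "mats_star R zero_mat = zero_mat"
  by (simp add: mats_star_def zero_mat_def)

lemma add_mat_zero [simp]:
  "a \<in> mats R m n \<Longrightarrow> add_mat a zero_mat = a"
  "a \<in> mats R m n \<Longrightarrow> add_mat zero_mat a = a"
  by (intro ext; simp add: add_mat_def zero_mat_def mats_closed)+

lemma add_mat_zero_zero [simp]: "add_mat zero_mat zero_mat = zero_mat"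
  by (simp add: add_mat_def zero_mat_def)

lemma block_diag_mult:
  assumes "a \<in> mats R l m" "b \<in> mats R l' m'" "a' \<in> mats R m n" "b' \<in> mats R m' n'"
  shows "mats_mult R (m + m') (block_mat l m a zero_mat zero_mat b) (block_mat m n a' zero_mat zero_mat b')
    = block_mat l n (mats_mult R m a a') zero_mat zero_mat (mats_mult R m' b b')"
proof -
  have "mats_mult R m a zero_mat = zero_mat" "mats_mult R m' b zero_mat = zero_mat"
    "mats_mult R m zero_mat a' = zero_mat" "mats_mult R m' zero_mat b' = zero_mat"
    "mats_mult R m zero_mat zero_mat = zero_mat" "mats_mult R m' zero_mat zero_mat = zero_mat"
    using assms zero_mat_in by auto
  then show ?thesis
    using assms mats_mult_in[OF assms(1,3)] mats_mult_in[OF assms(2,4)]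
    by (subst block_mat_mult[where l' = l' and n' = n']) (auto intro: zero_mat_in)
qed

section \<open>Projections and Murray-von Neumann equivalence\<close>

lemma projectionsD:
  "(n, p) \<in> projections R \<Longrightarrow> p \<in> mats R n n \<and> mats_mult R n p p = p \<and> mats_star R p = p"
  by (simp add: projections_def)

lemma block_sum_projections:
  assumes "x \<in> projections R" "y \<in> projections R"
  shows "block_sum R x y \<in> projections R"
proof -
  obtain n p m q where [simp]: "x = (n, p)" "y = (m, q)" by (metis surj_pair)
  have "p \<in> mats R n n \<and> mats_mult R n p p = p \<and> mats_star R p = p"
    "q \<in> mats R m m \<and> mats_mult R m q q = q \<and> mats_star R q = q"
    using assms by (auto dest: projectionsD)
  then show ?thesis
    using block_diag_mult[of p n n q m m p n q m]
    by (simp add: block_sum_eq projections_def block_mat_in zero_mat_in block_mat_star)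
qed

lemma murray_von_neumann_sym:
  assumes "murray_von_neumann R x y"
  shows "murray_von_neumann R y x"
proof -
  obtain n p m q where [simp]: "x = (n, p)" "y = (m, q)" by (metis surj_pair)
  obtain v where "v \<in> mats R m n" "mats_mult R m (mats_star R v) v = p" "mats_mult R n v (mats_star R v) = q"
    using assms by (auto simp: murray_von_neumann_def)
  then show ?thesis
    by (auto simp: murray_von_neumann_def mats_star_star intro!: bexI[of _ "mats_star R v"] mats_star_in)
qed

text \<open>The composite \<open>w v\<close> serves. As \<open>v\<close> and \<open>w\<close> are
  not normalized by their end projections, the two products come out as the squares of
  \<open>p\<close> and of \<open>r\<close>; here idempotence of the end points enters.\<close>

lemma murray_von_neumann_trans:
  assumes xy: "murray_von_neumann R x y" and yz: "murray_von_neumann R y z"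
    and x: "x \<in> projections R" and z: "z \<in> projections R"
  shows "murray_von_neumann R x z"
proof -
  obtain n p m q l r where [simp]: "x = (n, p)" "y = (m, q)" "z = (l, r)"
    by (metis surj_pair)
  obtain v where v: "v \<in> mats R m n" "mats_mult R m (mats_star R v) v = p" "mats_mult R n v (mats_star R v) = q"
    using xy by (auto simp: murray_von_neumann_def)
  obtain w where w: "w \<in> mats R l m" "mats_mult R l (mats_star R w) w = q" "mats_mult R m w (mats_star R w) = r"
    using yz by (auto simp: murray_von_neumann_def)
  note vs = mats_star_in[OF v(1)] and ws = mats_star_in[OF w(1)]
  let ?u = "mats_mult R m w v"
  have u: "?u \<in> mats R l n" by (rule mats_mult_in[OF w(1) v(1)])
  have "mats_mult R l (mats_star R ?u) ?u
      = mats_mult R m (mats_star R v) (mats_mult R m (mats_mult R l (mats_star R w) w) v)"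
    unfolding mats_star_mult[OF w(1) v(1)]
    by (simp add: mats_mult_assoc[OF vs ws u] mats_mult_assoc[OF ws w(1) v(1)])
  also have "\<dots> = mats_mult R m (mats_star R v) (mats_mult R n v (mats_mult R m (mats_star R v) v))"
    unfolding w(2) v(3)[symmetric] by (simp add: mats_mult_assoc[OF v(1) vs v(1)])
  also have "\<dots> = mats_mult R n p p"
    using mats_mult_assoc[OF vs v(1) mats_mult_in[OF vs v(1)]] v(2) by simp
  also have "\<dots> = p" using projectionsD x by simp
  finally have 1: "mats_mult R l (mats_star R ?u) ?u = p" .
  have "mats_mult R n ?u (mats_star R ?u)
      = mats_mult R m w (mats_mult R m (mats_mult R n v (mats_star R v)) (mats_star R w))"
    unfolding mats_star_mult[OF w(1) v(1)]
    by (simp add: mats_mult_assoc[OF w(1) v(1) mats_mult_in[OF vs ws]] mats_mult_assoc[OF v(1) vs ws])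
  also have "\<dots> = mats_mult R m w (mats_mult R l (mats_star R w) (mats_mult R m w (mats_star R w)))"
    unfolding v(3) w(2)[symmetric] by (simp add: mats_mult_assoc[OF ws w(1) ws])
  also have "\<dots> = mats_mult R l r r"
    using mats_mult_assoc[OF w(1) ws mats_mult_in[OF w(1) ws]] w(3) by simp
  also have "\<dots> = r" using projectionsD z by simp
  finally show ?thesis
    using u 1 by (auto simp: murray_von_neumann_def)
qed

lemma murray_von_neumann_block_sum:
  assumes xy: "murray_von_neumann R x y" and z: "z \<in> projections R"
  shows "murray_von_neumann R (block_sum R x z) (block_sum R y z)"
proof -
  obtain n p m q l r where [simp]: "x = (n, p)" "y = (m, q)" "z = (l, r)"
    by (metis surj_pair)
  obtain v where v: "v \<in> mats R m n" "mats_mult R m (mats_star R v) v = p" "mats_mult R n v (mats_star R v) = q"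
    using xy by (auto simp: murray_von_neumann_def)
  have r: "r \<in> mats R l l" "mats_mult R l r r = r" "mats_star R r = r"
    using z by (auto dest: projectionsD)
  let ?w = "block_mat m n v zero_mat zero_mat r"
  have "?w \<in> mats R (m + l) (n + l)"
    by (intro block_mat_in v r zero_mat_in)
  moreover have "mats_mult R (m + l) (mats_star R ?w) ?w = block_mat n n p zero_mat zero_mat r"
    by (simp add: block_mat_star r block_diag_mult[OF mats_star_in[OF v(1)] r(1) v(1) r(1)] v)
  moreover have "mats_mult R (n + l) ?w (mats_star R ?w) = block_mat m m q zero_mat zero_mat r"
    by (simp add: block_mat_star r block_diag_mult[OF v(1) r(1) mats_star_in[OF v(1)] r(1)] v)
  ultimately show ?thesis
    by (auto simp: murray_von_neumann_def block_sum_eq)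
qed

text \<open>Carries no size, so that the swindle can use it as a row, as a column and as a square
  block.\<close>

definition unit_mat :: "'b \<Rightarrow> nat \<Rightarrow> nat \<Rightarrow> 'b" where
  "unit_mat x = (\<lambda>i j. if i = 0 \<and> j = 0 then x else \<zero>)"

lemma unit_mat_in: "x \<in> carrier R \<Longrightarrow> 0 < m \<Longrightarrow> 0 < n \<Longrightarrow> unit_mat x \<in> mats R m n"
  by (rule matsI) (auto simp: unit_mat_def)

lemma unit_mat_zero: "unit_mat \<zero> = zero_mat"
  by (simp add: unit_mat_def zero_mat_def fun_eq_iff)

lemma unit_mat_star: "mats_star R (unit_mat x) = unit_mat (star R x)"
  by (auto simp: mats_star_def unit_mat_def fun_eq_iff)

lemma unit_mat_add: "x \<in> carrier R \<Longrightarrow> y \<in> carrier R \<Longrightarrow> add_mat (unit_mat x) (unit_mat y) = unit_mat (x \<oplus> y)"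
  by (simp add: add_mat_def unit_mat_def fun_eq_iff)

lemma unit_mat_mult:
  assumes "x \<in> carrier R" "y \<in> carrier R" "0 < n"
  shows "mats_mult R n (unit_mat x) (unit_mat y) = unit_mat (x \<otimes> y)"
proof (intro ext)
  fix i j
  obtain m where m: "n = 1 + m" using \<open>0 < n\<close> by (metis Suc_pred plus_1_eq_Suc)
  show "mats_mult R n (unit_mat x) (unit_mat y) i j = unit_mat (x \<otimes> y) i j"
    unfolding mats_mult_def m using assms
    by (subst finsum_lessThan_add)
      (auto simp: unit_mat_def finsum_lessThan_Suc finsum_lessThan_zero)
qed

text \<open>The partial isometry is, in block form with blocks of sizes 1, k, 1, the matrix with rows
  \<open>(0, 0, 0)\<close>, \<open>(0, s, 0)\<close>, \<open>(a, 0, b)\<close>.\<close>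

lemma murray_von_neumann_swindle:
  assumes p: "p \<in> carrier R" and q: "q \<in> carrier R" and a: "a \<in> carrier R" and b: "b \<in> carrier R"
    and rel: "star R a \<otimes> a = p" "star R a \<otimes> b = \<zero>" "star R b \<otimes> a = \<zero>" "star R b \<otimes> b = q"
      "a \<otimes> star R a \<oplus> b \<otimes> star R b = q"
    and s: "s \<in> projections R"
  shows "murray_von_neumann R
    (block_sum R (block_sum R (1, unit_mat p) s) (1, unit_mat q))
    (block_sum R (block_sum R (zero_proj R) s) (1, unit_mat q))"
proof -
  obtain k s' where [simp]: "s = (k, s')" by (metis surj_pair)
  have s': "s' \<in> mats R k k" "mats_mult R k s' s' = s'" "mats_star R s' = s'"
    using s by (auto dest: projectionsD)
  define A where "A = block_mat 1 1 zero_mat zero_mat zero_mat s'"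
  have A: "A \<in> mats R (1 + k) (1 + k)"
    unfolding A_def by (intro block_mat_in zero_mat_in s')
  have A_star: "mats_star R A = A"
    by (simp add: A_def block_mat_star s')
  have AA: "mats_mult R (1 + k) A A = A"
    unfolding A_def by (subst block_diag_mult[OF zero_mat_in s'(1) zero_mat_in s'(1)])
      (simp_all add: zero_mat_in s')
  \<comment> \<open>\<open>unit_mat x\<close> is concentrated in the first row and column, where
    \<open>A\<close> is zero.\<close>
  have A_unit: "mats_mult R (1 + k) A (unit_mat x) = zero_mat" if "x \<in> carrier R" for x
    using that by (intro ext) (auto simp: mats_mult_def unit_mat_def zero_mat_def A_def block_mat_def
        mats_closed[OF s'(1)] intro!: finsum_lessThan_zero)
  have unit_A: "mats_mult R (1 + k) (unit_mat x) A = zero_mat" if "x \<in> carrier R" for x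
    using that by (intro ext) (auto simp: mats_mult_def unit_mat_def zero_mat_def A_def block_mat_def
        mats_closed[OF s'(1)] intro!: finsum_lessThan_zero)
  have u: "unit_mat x \<in> mats R m n" if "x \<in> carrier R" "0 < m" "0 < n" for x m n
    using that by (rule unit_mat_in)
  have zu: "mats_mult R n zero_mat (unit_mat x) = zero_mat" "mats_mult R n (unit_mat x) zero_mat = zero_mat"
    if "x \<in> carrier R" for n x
    using that by (intro ext; simp add: mats_mult_def zero_mat_def unit_mat_def finsum_lessThan_zero)+
  \<comment> \<open>The adjoint of \<open>W\<close> times \<open>W\<close> is diagonal with entries
    \<open>p\<close>, \<open>s\<close>, \<open>q\<close>, and \<open>W\<close> times its adjoint is
    diagonal with entries 0, \<open>s\<close>, \<open>q\<close>. Keeping \<open>s\<close> in the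
    middle matches the bracketing in \<open>K00_rel\<close>, so that no summand has to be moved past
    another.\<close>
  define W where "W = block_mat (1 + k) (1 + k) A zero_mat (unit_mat a) (unit_mat b)"
  have W: "W \<in> mats R (1 + k + 1) (1 + k + 1)"
    unfolding W_def by (intro block_mat_in zero_mat_in A u a b) auto
  have W_star: "mats_star R W
      = block_mat (1 + k) (1 + k) A (unit_mat (star R a)) zero_mat (unit_mat (star R b))"
    by (simp add: W_def block_mat_star A_star unit_mat_star)
  have add: "add_mat A (unit_mat p) = block_mat 1 1 (unit_mat p) zero_mat zero_mat s'"
    using p by (auto simp: fun_eq_iff add_mat_def A_def block_mat_def unit_mat_def zero_mat_def
        mats_closed[OF s'(1)])
  have "mats_mult R (1 + k + 1) (mats_star R W) W
      = block_mat (1 + k) (1 + k) (add_mat A (unit_mat p)) zero_mat zero_mat (unit_mat q)"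
    unfolding W_star unfolding W_def
    by (subst block_mat_mult[where l' = 1 and n' = 1])
      (use a b p q A in \<open>simp_all add: zero_mat_in u AA[simplified] unit_mat_mult rel unit_mat_zero
          mats_mult_zero(1)[OF A] mats_mult_zero(2)[OF A] mats_mult_zero(1)[OF zero_mat_in]
          mats_mult_zero(1)[OF u] mats_mult_zero(2)[OF u] add_mat_zero[OF u, of _ 1 1]
          add_mat_zero[OF zero_mat_in]\<close>)
  moreover have "mats_mult R (1 + k + 1) W (mats_star R W)
      = block_mat (1 + k) (1 + k) A zero_mat zero_mat (unit_mat q)"
    unfolding W_star unfolding W_def
    by (subst block_mat_mult[where l' = 1 and n' = 1])
      (use a b p q A in \<open>simp_all add: zero_mat_in u AA[simplified] unit_mat_mult rel unit_mat_add zu A_unit[simplified] unit_A[simplified]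
          mats_mult_zero(1)[OF A] mats_mult_zero(2)[OF A] mats_mult_zero(1)[OF zero_mat_in]
          mats_mult_zero(1)[OF u] mats_mult_zero(2)[OF u] add_mat_zero[OF A]
          add_mat_zero[OF zero_mat_in]\<close>)
  moreover have "zero_proj R = (1, zero_mat)"
    by (simp add: zero_proj_def zero_mat_def)
  ultimately show ?thesis
    using W unfolding add
    by (auto simp: murray_von_neumann_def block_sum_eq simp flip: A_def[simplified])
qed

lemma unit_mat_projection:
  assumes "p \<in> carrier R" "p \<otimes> p = p" "star R p = p"
  shows "(1, unit_mat p) \<in> projections R"
  using assms by (simp add: projections_def unit_mat_in unit_mat_mult unit_mat_star)

lemma zero_proj_projection: "zero_proj R \<in> projections R"
  using unit_mat_projection[of \<zero>] by (simp add: zero_proj_def unit_mat_def)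

text \<open>The projection \<open>q\<close> is absorbed into the auxiliary summand \<open>r\<close> of the relation \<open>K00_rel\<close>.\<close>

lemma K00_class_eq_zero:
  assumes p: "p \<in> carrier R" "p \<otimes> p = p" "star R p = p"
    and q: "q \<in> carrier R" "q \<otimes> q = q" "star R q = q"
    and a: "a \<in> carrier R" and b: "b \<in> carrier R"
    and rel: "star R a \<otimes> a = p" "star R a \<otimes> b = \<zero>" "star R b \<otimes> a = \<zero>" "star R b \<otimes> b = q"
      "a \<otimes> star R a \<oplus> b \<otimes> star R b = q"
  shows "K00_class R ((1, unit_mat p), zero_proj R) = K00_class R (zero_proj R, zero_proj R)"
proof -
  let ?X = "(1, unit_mat p)" and ?Z = "zero_proj R" and ?Q = "(1, unit_mat q)"
  note proj = unit_mat_projection[OF p] zero_proj_projection unit_mat_projection[OF q]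
  \<comment> \<open>Stated for arbitrary \<open>Y\<close> and \<open>Y'\<close> that become
    equivalent once \<open>?Q\<close> is added, so that it yields both directions of the comparison
    of classes.\<close>
  have step: "\<exists>r\<in>projections R. murray_von_neumann R (block_sum R (block_sum R Y s) r) (block_sum R (block_sum R t ?Z) r)"
    if sw: "\<And>s. s \<in> projections R \<Longrightarrow>
        murray_von_neumann R (block_sum R (block_sum R Y s) ?Q) (block_sum R (block_sum R Y' s) ?Q)"
      and Y: "Y \<in> projections R" and s: "s \<in> projections R" and t: "t \<in> projections R"
      and ex: "\<exists>r\<in>projections R. murray_von_neumann R (block_sum R (block_sum R Y' s) r) (block_sum R (block_sum R t ?Z) r)"
    for Y Y' s t
  proof -
    obtain r where r: "r \<in> projections R"
      "murray_von_neumann R (block_sum R (block_sum R Y' s) r) (block_sum R (block_sum R t ?Z) r)"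
      using ex by blast
    \<comment> \<open>The hypothesis is used with \<open>s\<close> and \<open>r\<close> together as
      the middle summand; associativity then leaves \<open>?Q\<close> behind \<open>r\<close>, where
      it joins the auxiliary projection.\<close>
    have "murray_von_neumann R (block_sum R (block_sum R Y (block_sum R s r)) ?Q)
        (block_sum R (block_sum R Y' (block_sum R s r)) ?Q)"
      by (intro sw block_sum_projections s r)
    moreover have "murray_von_neumann R (block_sum R (block_sum R (block_sum R Y' s) r) ?Q)
        (block_sum R (block_sum R (block_sum R t ?Z) r) ?Q)"
      by (rule murray_von_neumann_block_sum[OF r(2) proj(3)])
    ultimately have "murray_von_neumann R (block_sum R (block_sum R Y s) (block_sum R r ?Q))
        (block_sum R (block_sum R t ?Z) (block_sum R r ?Q))"
      unfolding block_sum_assoc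
      by (rule murray_von_neumann_trans) (intro block_sum_projections Y s r t proj)+
    then show ?thesis
      using block_sum_projections[OF r(1) proj(3)] by blast
  qed
  note sw = murray_von_neumann_swindle[OF p(1) q(1) a b rel]
  have eq: "(\<exists>r\<in>projections R. murray_von_neumann R (block_sum R (block_sum R ?X s) r) (block_sum R (block_sum R t ?Z) r))
      \<longleftrightarrow> (\<exists>r\<in>projections R. murray_von_neumann R (block_sum R (block_sum R ?Z s) r) (block_sum R (block_sum R t ?Z) r))"
    if "s \<in> projections R" "t \<in> projections R" for s t
  proof
    assume "\<exists>r\<in>projections R. murray_von_neumann R (block_sum R (block_sum R ?X s) r) (block_sum R (block_sum R t ?Z) r)"
    then show "\<exists>r\<in>projections R. murray_von_neumann R (block_sum R (block_sum R ?Z s) r) (block_sum R (block_sum R t ?Z) r)"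
      using murray_von_neumann_sym[OF sw] by - (rule step[OF _ proj(2) that])
  next
    assume "\<exists>r\<in>projections R. murray_von_neumann R (block_sum R (block_sum R ?Z s) r) (block_sum R (block_sum R t ?Z) r)"
    then show "\<exists>r\<in>projections R. murray_von_neumann R (block_sum R (block_sum R ?X s) r) (block_sum R (block_sum R t ?Z) r)"
      using sw by - (rule step[OF _ proj(1) that])
  qed
  have "K00_class R (Y, ?Z) = {x. fst x \<in> projections R \<and> snd x \<in> projections R \<and>
      (\<exists>r\<in>projections R. murray_von_neumann R
        (block_sum R (block_sum R Y (snd x)) r) (block_sum R (block_sum R (fst x) ?Z) r))}"
    if "Y \<in> projections R" for Y
    using that proj(2) by (auto simp: K00_class_def K00_rel_def)
  then show ?thesis
    using eq proj(1,2) by (simp only:) (intro Collect_cong conj_cong refl)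
qed

end

section \<open>Locally compact operators\<close>

lemma locally_compact_op_zero:
  assumes M: "sets M = sets borel"
  shows "locally_compact_op M (op_zero M)"
proof -
  have "op_comp M (op_zero M) (mult_op M f) = op_zero M" "op_comp M (mult_op M f) (op_zero M) = op_zero M"
    if "f \<in> C0" for f
    using mult_op_in[OF C0_bounded_fun[OF M that]] bounded_opD(5)[OF bounded_op_mult[OF C0_bounded_fun[OF M that]]]
    by (auto simp: compose_def fun_eq_iff restrict_def)
  then show ?thesis by (simp add: locally_compact_op_def compact_op_zero)
qed

lemma locally_compact_op_add:
  assumes M: "sets M = sets borel"
    and S: "bounded_op M S" "locally_compact_op M S" and T: "bounded_op M T" "locally_compact_op M T"
  shows "locally_compact_op M (op_add M S T)"
  unfolding locally_compact_op_def
proof (intro ballI conjI)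
  fix f :: "'a \<Rightarrow> complex" assume f: "f \<in> C0"
  note f' = bounded_op_mult[OF C0_bounded_fun[OF M f]]
  note [simp] = bounded_opD(1,2)[OF f'] bounded_opD(1)[OF S(1)] bounded_opD(1)[OF T(1)]
  have "op_comp M (op_add M S T) (mult_op M f) = op_add M (op_comp M S (mult_op M f)) (op_comp M T (mult_op M f))"
    by (auto simp: compose_def fun_eq_iff restrict_def)
  then show "compact_op M (op_comp M (op_add M S T) (mult_op M f))"
    using S T f by (simp add: locally_compact_op_def compact_op_add)
  have "op_comp M (mult_op M f) (op_add M S T) = op_add M (op_comp M (mult_op M f) S) (op_comp M (mult_op M f) T)"
    by (auto simp: compose_def fun_eq_iff restrict_def)
  then show "compact_op M (op_comp M (mult_op M f) (op_add M S T))"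
    using S T f by (simp add: locally_compact_op_def compact_op_add)
qed

lemma locally_compact_op_scale:
  assumes M: "sets M = sets borel" and T: "bounded_op M T" "locally_compact_op M T"
  shows "locally_compact_op M (op_scale M c T)"
  unfolding locally_compact_op_def
proof (intro ballI conjI)
  fix f :: "'a \<Rightarrow> complex" assume f: "f \<in> C0"
  note f' = bounded_op_mult[OF C0_bounded_fun[OF M f]]
  note [simp] = bounded_opD(1,3)[OF f'] bounded_opD(1)[OF T(1)]
  have "op_comp M (op_scale M c T) (mult_op M f) = op_scale M c (op_comp M T (mult_op M f))"
    by (auto simp: compose_def fun_eq_iff restrict_def)
  then show "compact_op M (op_comp M (op_scale M c T) (mult_op M f))"
    using T f by (simp add: locally_compact_op_def compact_op_scale)
  have "op_comp M (mult_op M f) (op_scale M c T) = op_scale M c (op_comp M (mult_op M f) T)"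
    by (auto simp: compose_def fun_eq_iff restrict_def)
  then show "compact_op M (op_comp M (mult_op M f) (op_scale M c T))"
    using T f by (simp add: locally_compact_op_def compact_op_scale)
qed

lemma locally_compact_op_compose:
  assumes M: "sets M = sets borel"
    and S: "bounded_op M S" "locally_compact_op M S" and T: "bounded_op M T" "locally_compact_op M T"
  shows "locally_compact_op M (op_comp M S T)"
  unfolding locally_compact_op_def
proof (intro ballI conjI)
  fix f :: "'a \<Rightarrow> complex" assume f: "f \<in> C0"
  note f' = bounded_op_mult[OF C0_bounded_fun[OF M f]]
  note [simp] = bounded_opD(1,3)[OF f'] bounded_opD(1)[OF S(1)] bounded_opD(1)[OF T(1)]
  have "op_comp M (op_comp M S T) (mult_op M f) = op_comp M S (op_comp M T (mult_op M f))"
    by (auto simp: compose_def fun_eq_iff restrict_def)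
  then show "compact_op M (op_comp M (op_comp M S T) (mult_op M f))"
    using S T f by (simp add: locally_compact_op_def compact_op_compose_left)
  have "op_comp M (mult_op M f) (op_comp M S T) = op_comp M (op_comp M (mult_op M f) S) T"
    by (auto simp: compose_def fun_eq_iff restrict_def)
  then show "compact_op M (op_comp M (mult_op M f) (op_comp M S T))"
    using S T f by (simp add: locally_compact_op_def compact_op_compose_right)
qed

text \<open>Taking adjoints exchanges the two conditions of local compactness and conjugates the
  multiplier; compactness survives by \<open>compact_op_adj\<close>.\<close>

lemma locally_compact_op_adj:
  assumes M: "sets M = sets borel" and T: "bounded_op M T" "locally_compact_op M T"
  shows "locally_compact_op M (op_adj M T)"
  unfolding locally_compact_op_def
proof (intro ballI conjI)
  fix f :: "'a \<Rightarrow> complex" assume f: "f \<in> C0"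
  note bf = C0_bounded_fun[OF M]
  note f' = bounded_op_mult[OF bf[OF C0_cnj[OF f]]]
  have adj: "op_adj M (mult_op M (\<lambda>x. cnj (f x))) = mult_op M f"
    using op_adj_mult[OF bf[OF C0_cnj[OF f]]] by simp
  have "op_comp M (op_adj M T) (mult_op M f) = op_adj M (op_comp M (mult_op M (\<lambda>x. cnj (f x))) T)"
    by (simp add: op_adj_algebra(3)[OF f' T(1)] adj)
  then show "compact_op M (op_comp M (op_adj M T) (mult_op M f))"
    using T C0_cnj[OF f] by (simp add: locally_compact_op_def compact_op_adj)
  have "op_comp M (mult_op M f) (op_adj M T) = op_adj M (op_comp M T (mult_op M (\<lambda>x. cnj (f x))))"
    by (simp add: op_adj_algebra(3)[OF T(1) f'] adj)
  then show "compact_op M (op_comp M (mult_op M f) (op_adj M T))"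
    using T C0_cnj[OF f] by (simp add: locally_compact_op_def compact_op_adj)
qed

section \<open>The Roe algebra as the closure of its generators\<close>

definition roe_generator :: "'a::metric_space measure \<Rightarrow> 'a l2_op \<Rightarrow> bool" where
  "roe_generator M S \<longleftrightarrow> bounded_op M S \<and> locally_compact_op M S \<and> finite_propagation M S"

lemma roe_generator_intros:
  assumes M: "proper_metric_measure_space M"
  shows "roe_generator M (op_zero M)"
    and "roe_generator M S \<Longrightarrow> roe_generator M T \<Longrightarrow> roe_generator M (op_add M S T)"
    and "roe_generator M T \<Longrightarrow> roe_generator M (op_scale M c T)"
    and "roe_generator M S \<Longrightarrow> roe_generator M T \<Longrightarrow> roe_generator M (op_comp M S T)"
    and "roe_generator M T \<Longrightarrow> roe_generator M (op_adj M T)"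
proof -
  have borel: "sets M = sets borel" using M by (simp add: proper_metric_measure_space_def)
  show "roe_generator M (op_zero M)"
    by (simp add: roe_generator_def bounded_op_zero locally_compact_op_zero finite_propagation_zero borel)
  show "roe_generator M S \<Longrightarrow> roe_generator M T \<Longrightarrow> roe_generator M (op_add M S T)"
    by (simp add: roe_generator_def bounded_op_add locally_compact_op_add finite_propagation_add borel)
  show "roe_generator M T \<Longrightarrow> roe_generator M (op_scale M c T)"
    by (simp add: roe_generator_def bounded_op_scale locally_compact_op_scale finite_propagation_scale borel)
  show "roe_generator M S \<Longrightarrow> roe_generator M T \<Longrightarrow> roe_generator M (op_comp M S T)"
    by (simp add: roe_generator_def bounded_op_compose locally_compact_op_compose finite_propagation_compose borel M)
  show "roe_generator M T \<Longrightarrow> roe_generator M (op_adj M T)"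
    by (simp add: roe_generator_def op_adj(1) locally_compact_op_adj finite_propagation_adj borel)
qed

lemma roe_algebra_simps [simp]:
  "x \<otimes>\<^bsub>roe_algebra M\<^esub> y = op_comp M x y"
  "\<zero>\<^bsub>roe_algebra M\<^esub> = op_zero M"
  "x \<oplus>\<^bsub>roe_algebra M\<^esub> y = op_add M x y"
  "c \<odot>\<^bsub>roe_algebra M\<^esub> x = op_scale M c x"
  "star (roe_algebra M) x = op_adj M x"
  by (simp_all add: roe_algebra_def bounded_ops_def)

text \<open>Trades the supremum in \<open>op_dist\<close> for an estimate at each vector, which can
  be added and composed directly. Passing through \<open>e / 2\<close> turns the weak estimate back
  into the strict one.\<close>

lemma roe_algebra_iff:
  "T \<in> carrier (roe_algebra M) \<longleftrightarrow> bounded_op M T \<and>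
    (\<forall>e>0. \<exists>S. roe_generator M S \<and> (\<forall>U\<in>L2 M. L2_dist M (T U) (S U) \<le> e * L2_norm M U))"
proof (cases "bounded_op M T")
  case T: True
  have "(\<forall>e>0. \<exists>S. roe_generator M S \<and> op_dist M T S < e) \<longleftrightarrow>
    (\<forall>e>0. \<exists>S. roe_generator M S \<and> (\<forall>U\<in>L2 M. L2_dist M (T U) (S U) \<le> e * L2_norm M U))"
  proof (intro iffI allI impI)
    fix e :: real assume "\<forall>e>0. \<exists>S. roe_generator M S \<and> op_dist M T S < e" "e > 0"
    then obtain S where S: "roe_generator M S" "op_dist M T S < e" by blast
    have "L2_dist M (T U) (S U) \<le> e * L2_norm M U" if "U \<in> L2 M" for U
    proof -
      have "L2_dist M (T U) (S U) \<le> op_dist M T S * L2_norm M U"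
        using S(1) by (intro L2_dist_op_le T that) (simp add: roe_generator_def)
      also have "\<dots> \<le> e * L2_norm M U"
        using S(2) by (intro mult_right_mono) auto
      finally show ?thesis .
    qed
    then show "\<exists>S. roe_generator M S \<and> (\<forall>U\<in>L2 M. L2_dist M (T U) (S U) \<le> e * L2_norm M U)"
      using S(1) by blast
  next
    fix e :: real
    assume "\<forall>e>0. \<exists>S. roe_generator M S \<and> (\<forall>U\<in>L2 M. L2_dist M (T U) (S U) \<le> e * L2_norm M U)" and e: "e > 0"
    then obtain S where S: "roe_generator M S" "\<forall>U\<in>L2 M. L2_dist M (T U) (S U) \<le> e / 2 * L2_norm M U"
      by (meson half_gt_zero)
    have "op_dist M T S \<le> e / 2"
      using S(2) e by (intro op_dist_le) auto
    then show "\<exists>S. roe_generator M S \<and> op_dist M T S < e"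
      using S(1) e by (intro exI[of _ S]) auto
  qed
  then show ?thesis
    using T by (simp add: roe_algebra_def roe_generator_def)
next
  case False
  then show ?thesis by (simp add: roe_algebra_def)
qed

lemma roe_generator_in: "roe_generator M T \<Longrightarrow> T \<in> carrier (roe_algebra M)"
  unfolding roe_algebra_iff
  by (intro conjI allI impI exI[of _ T])
    (auto simp: roe_generator_def bounded_opD(1) intro!: mult_nonneg_nonneg)

lemma roe_algebra_bounded: "T \<in> carrier (roe_algebra M) \<Longrightarrow> bounded_op M T"
  by (simp add: roe_algebra_iff)

lemma roe_approx:
  assumes "T \<in> carrier (roe_algebra M)" "e > 0"
  obtains S where "roe_generator M S" "bounded_op M S"
    "\<And>U. U \<in> L2 M \<Longrightarrow> L2_dist M (T U) (S U) \<le> e * L2_norm M U"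
  using assms unfolding roe_algebra_iff by (metis roe_generator_def)

lemma roe_algebra_zero:
  assumes M: "proper_metric_measure_space M"
  shows "op_zero M \<in> carrier (roe_algebra M)"
  by (intro roe_generator_in roe_generator_intros M)

lemma roe_algebra_add:
  assumes M: "proper_metric_measure_space M"
    and S: "S \<in> carrier (roe_algebra M)" and T: "T \<in> carrier (roe_algebra M)"
  shows "op_add M S T \<in> carrier (roe_algebra M)"
  unfolding roe_algebra_iff
proof (intro conjI allI impI)
  note b = roe_algebra_bounded[OF S] roe_algebra_bounded[OF T]
  show "bounded_op M (op_add M S T)" by (intro bounded_op_add b)
  fix e :: real assume "e > 0"
  then have e: "e / 2 > 0" by simp
  obtain S' where S': "roe_generator M S'" "bounded_op M S'"
      "\<And>U. U \<in> L2 M \<Longrightarrow> L2_dist M (S U) (S' U) \<le> e / 2 * L2_norm M U"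
    using roe_approx[OF S e] by blast
  obtain T' where T': "roe_generator M T'" "bounded_op M T'"
      "\<And>U. U \<in> L2 M \<Longrightarrow> L2_dist M (T U) (T' U) \<le> e / 2 * L2_norm M U"
    using roe_approx[OF T e] by blast
  note [simp] = b[THEN bounded_opD(1)] bounded_opD(1)[OF S'(2)] bounded_opD(1)[OF T'(2)]
  have "L2_dist M (op_add M S T U) (op_add M S' T' U) \<le> e * L2_norm M U" if U: "U \<in> L2 M" for U
  proof -
    have "L2_diff M (L2_add M (S U) (T U)) (L2_add M (S' U) (T' U))
        = L2_add M (L2_diff M (S U) (S' U)) (L2_diff M (T U) (T' U))"
      using U by (intro L2_ext[of _ M]) simp_all
    then have "L2_dist M (op_add M S T U) (op_add M S' T' U) \<le> L2_dist M (S U) (S' U) + L2_dist M (T U) (T' U)"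
      using U by (simp add: L2_dist_def L2_norm_triangle)
    then show ?thesis using S'(3)[OF U] T'(3)[OF U] by simp
  qed
  then show "\<exists>R. roe_generator M R \<and> (\<forall>U\<in>L2 M. L2_dist M (op_add M S T U) (R U) \<le> e * L2_norm M U)"
    using roe_generator_intros(2)[OF M S'(1) T'(1)] by blast
qed

lemma roe_algebra_scale:
  assumes M: "proper_metric_measure_space M" and T: "T \<in> carrier (roe_algebra M)"
  shows "op_scale M c T \<in> carrier (roe_algebra M)"
  unfolding roe_algebra_iff
proof (intro conjI allI impI)
  note b = roe_algebra_bounded[OF T]
  show "bounded_op M (op_scale M c T)" by (intro bounded_op_scale b)
  fix e :: real assume e: "e > 0"
  define d where "d = e / (cmod c + 1)"
  have d: "d > 0" "cmod c * d \<le> e"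
  proof -
    have "cmod c + 1 > 0" using norm_ge_zero[of c] by linarith
    then show "d > 0" "cmod c * d \<le> e"
      using e by (simp_all add: d_def pos_divide_le_eq algebra_simps)
  qed
  obtain T' where T': "roe_generator M T'" "bounded_op M T'"
      "\<And>U. U \<in> L2 M \<Longrightarrow> L2_dist M (T U) (T' U) \<le> d * L2_norm M U"
    using roe_approx[OF T d(1)] by blast
  note [simp] = bounded_opD(1)[OF b] bounded_opD(1)[OF T'(2)]
  have "L2_dist M (op_scale M c T U) (op_scale M c T' U) \<le> e * L2_norm M U" if U: "U \<in> L2 M" for U
  proof -
    have "L2_diff M (L2_scale M c (T U)) (L2_scale M c (T' U)) = L2_scale M c (L2_diff M (T U) (T' U))"
      using U by (intro L2_ext[of _ M]) (simp_all add: algebra_simps)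
    then have "L2_dist M (op_scale M c T U) (op_scale M c T' U) = cmod c * L2_dist M (T U) (T' U)"
      using U by (simp add: L2_dist_def)
    also have "\<dots> \<le> cmod c * (d * L2_norm M U)"
      by (intro mult_left_mono T'(3) U) auto
    also have "\<dots> \<le> e * L2_norm M U"
      using mult_right_mono[OF d(2), of "L2_norm M U"] by (simp add: mult.assoc)
    finally show ?thesis .
  qed
  then show "\<exists>R. roe_generator M R \<and> (\<forall>U\<in>L2 M. L2_dist M (op_scale M c T U) (R U) \<le> e * L2_norm M U)"
    using roe_generator_intros(3)[OF M T'(1)] by blast
qed

text \<open>An operator and its adjoint obey the same bound: the difference \<open>W\<close> of the
  two adjoints at \<open>U\<close> is paired with itself, the operators are moved to the other side,
  and one factor \<open>L2_norm M W\<close> is cancelled.\<close>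

lemma roe_algebra_adj:
  assumes M: "proper_metric_measure_space M" and T: "T \<in> carrier (roe_algebra M)"
  shows "op_adj M T \<in> carrier (roe_algebra M)"
  unfolding roe_algebra_iff
proof (intro conjI allI impI)
  note b = roe_algebra_bounded[OF T]
  show "bounded_op M (op_adj M T)" by (intro op_adj b)
  fix e :: real assume e: "e > 0"
  obtain S where S: "roe_generator M S" "bounded_op M S"
      "\<And>U. U \<in> L2 M \<Longrightarrow> L2_dist M (T U) (S U) \<le> e * L2_norm M U"
    using roe_approx[OF T e] by blast
  note [simp] = bounded_opD(1)[OF b] bounded_opD(1)[OF S(2)]
    bounded_opD(1)[OF op_adj(1)[OF b]] bounded_opD(1)[OF op_adj(1)[OF S(2)]]
  have "L2_dist M (op_adj M T U) (op_adj M S U) \<le> e * L2_norm M U" if U: "U \<in> L2 M" for U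
  proof -
    define W where "W = L2_diff M (op_adj M T U) (op_adj M S U)"
    have W: "W \<in> L2 M" using U by (simp add: W_def)
    have "(L2_norm M W)\<^sup>2 = Re (L2_inner M W W)" by (rule L2_norm_square)
    also have "L2_inner M W W = L2_inner M W (op_adj M T U) - L2_inner M W (op_adj M S U)"
      using U W by (subst (2) W_def) simp
    also have "\<dots> = L2_inner M (L2_diff M (T W) (S W)) U"
      using U W by (simp add: op_adj[OF b] op_adj[OF S(2)])
    also have "Re \<dots> \<le> L2_norm M (L2_diff M (T W) (S W)) * L2_norm M U"
      using L2_Cauchy_Schwarz[of "L2_diff M (T W) (S W)" M U] U W complex_Re_le_cmod order_trans by fastforce
    also have "\<dots> \<le> (e * L2_norm M W) * L2_norm M U"
      using S(3)[OF W] by (intro mult_right_mono) (auto simp: L2_dist_def)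
    finally have "L2_norm M W * L2_norm M W \<le> e * L2_norm M U * L2_norm M W"
      by (simp add: power2_eq_square mult_ac)
    then have "L2_norm M W \<le> e * L2_norm M U"
      using e L2_norm_nonneg[of M W] L2_norm_nonneg[of M U]
      by (cases "L2_norm M W = 0") (auto simp: mult_le_cancel_right)
    then show ?thesis by (simp add: L2_dist_def W_def)
  qed
  then show "\<exists>R. roe_generator M R \<and> (\<forall>U\<in>L2 M. L2_dist M (op_adj M T U) (R U) \<le> e * L2_norm M U)"
    using roe_generator_intros(5)[OF M S(1)] by blast
qed

lemma roe_algebra_compose:
  assumes M: "proper_metric_measure_space M"
    and S: "S \<in> carrier (roe_algebra M)" and T: "T \<in> carrier (roe_algebra M)"
  shows "op_comp M S T \<in> carrier (roe_algebra M)"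
  unfolding roe_algebra_iff
proof (intro conjI allI impI)
  note b = roe_algebra_bounded[OF S] roe_algebra_bounded[OF T]
  show "bounded_op M (op_comp M S T)" by (intro bounded_op_compose b)
  fix e :: real assume e: "e > 0"
  obtain C where C: "C \<ge> 0" "\<And>U V. U \<in> L2 M \<Longrightarrow> V \<in> L2 M \<Longrightarrow> L2_dist M (S U) (S V) \<le> C * L2_dist M U V"
    using bounded_op_dist[OF b(1)] by blast
  define d where "d = e / (2 * (C + 1))"
  have d: "d > 0" "C * d \<le> e / 2"
    using e C(1) by (simp_all add: d_def field_simps)
  obtain T' where T': "roe_generator M T'" "bounded_op M T'"
      "\<And>U. U \<in> L2 M \<Longrightarrow> L2_dist M (T U) (T' U) \<le> d * L2_norm M U"
    using roe_approx[OF T d(1)] by blast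
  obtain D where D: "D \<ge> 0" "\<And>U. U \<in> L2 M \<Longrightarrow> L2_norm M (T' U) \<le> D * L2_norm M U"
    using bounded_opD(7)[OF T'(2)] by blast
  \<comment> \<open>\<open>T'\<close> had to be fixed first: the accuracy required of
    \<open>S'\<close> depends on the norm bound \<open>D\<close> of \<open>T'\<close>.\<close>
  define d' where "d' = e / (2 * (D + 1))"
  have d': "d' > 0" "d' * D \<le> e / 2"
    using e D(1) by (simp_all add: d'_def field_simps)
  obtain S' where S': "roe_generator M S'" "bounded_op M S'"
      "\<And>U. U \<in> L2 M \<Longrightarrow> L2_dist M (S U) (S' U) \<le> d' * L2_norm M U"
    using roe_approx[OF S d'(1)] by blast
  note [simp] = b[THEN bounded_opD(1)] bounded_opD(1)[OF S'(2)] bounded_opD(1)[OF T'(2)]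
  have "L2_dist M (op_comp M S T U) (op_comp M S' T' U) \<le> e * L2_norm M U" if U: "U \<in> L2 M" for U
  proof -
    have "L2_dist M (S (T U)) (S' (T' U)) \<le> L2_dist M (S (T U)) (S (T' U)) + L2_dist M (S (T' U)) (S' (T' U))"
      using U by (intro L2.triangle) auto
    also have "\<dots> \<le> C * (d * L2_norm M U) + d' * (D * L2_norm M U)"
    proof (intro add_mono)
      have "L2_dist M (S (T U)) (S (T' U)) \<le> C * L2_dist M (T U) (T' U)"
        using U by (intro C) auto
      also have "\<dots> \<le> C * (d * L2_norm M U)"
        by (intro mult_left_mono T'(3) U C(1))
      finally show "L2_dist M (S (T U)) (S (T' U)) \<le> C * (d * L2_norm M U)" .
      have "L2_dist M (S (T' U)) (S' (T' U)) \<le> d' * L2_norm M (T' U)"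
        using U by (intro S'(3)) auto
      also have "\<dots> \<le> d' * (D * L2_norm M U)"
        using d'(1) by (intro mult_left_mono D(2) U) auto
      finally show "L2_dist M (S (T' U)) (S' (T' U)) \<le> d' * (D * L2_norm M U)" .
    qed
    also have "\<dots> = (C * d) * L2_norm M U + (d' * D) * L2_norm M U"
      by (simp add: mult.assoc)
    also have "\<dots> \<le> (e / 2) * L2_norm M U + (e / 2) * L2_norm M U"
      by (intro add_mono mult_right_mono d d') auto
    finally show ?thesis using U by (simp add: compose_def)
  qed
  then show "\<exists>R. roe_generator M R \<and> (\<forall>U\<in>L2 M. L2_dist M (op_comp M S T U) (R U) \<le> e * L2_norm M U)"
    using roe_generator_intros(4)[OF M S'(1) T'(1)] by blast
qed

section \<open>The unitization as a ring with involution\<close>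

lemma unitization_simps [simp]:
  "carrier (unitization A) = carrier A \<times> UNIV"
  "(a, s) \<otimes>\<^bsub>unitization A\<^esub> (b, t) =
    ((a \<otimes>\<^bsub>A\<^esub> b) \<oplus>\<^bsub>A\<^esub> ((s \<odot>\<^bsub>A\<^esub> b) \<oplus>\<^bsub>A\<^esub> (t \<odot>\<^bsub>A\<^esub> a)), s * t)"
  "\<one>\<^bsub>unitization A\<^esub> = (\<zero>\<^bsub>A\<^esub>, 1)"
  "\<zero>\<^bsub>unitization A\<^esub> = (\<zero>\<^bsub>A\<^esub>, 0)"
  "(a, s) \<oplus>\<^bsub>unitization A\<^esub> (b, t) = (a \<oplus>\<^bsub>A\<^esub> b, s + t)"
  "star (unitization A) (a, s) = (star A a, cnj s)"
  by (simp_all add: unitization_def)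

text \<open>Once the carrier is closed under the operations, each law is tested on inner products
  and becomes a scalar identity.\<close>

theorem star_ring_unitization_roe:
  assumes M: "proper_metric_measure_space M"
  shows "star_ring (unitization (roe_algebra M))"
proof -
  note closed [simp] = roe_algebra_zero[OF M] roe_algebra_add[OF M] roe_algebra_scale[OF M]
    roe_algebra_adj[OF M] roe_algebra_compose[OF M]
  have ext: "S = T"
    if "S \<in> carrier (roe_algebra M)" "T \<in> carrier (roe_algebra M)"
      and "\<And>U W. U \<in> L2 M \<Longrightarrow> W \<in> L2 M \<Longrightarrow> L2_inner M W (S U) = L2_inner M W (T U)" for S T
    using that(3) roe_algebra_bounded[OF that(1)] roe_algebra_bounded[OF that(2)]
    by (intro bounded_op_ext[of S M T]) (auto dest: bounded_opD(1,6))
  have [simp]: "a U \<in> L2 M" "a (L2_zero M) = L2_zero M" "a (L2_scale M c U) = L2_scale M c (a U)"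
    "V \<in> L2 M \<Longrightarrow> a (L2_add M U V) = L2_add M (a U) (a V)"
    if "a \<in> carrier (roe_algebra M)" "U \<in> L2 M" for a U V c
    using bounded_opD(1,2,3,5)[OF roe_algebra_bounded[OF that(1)]] that(2) by auto
  \<comment> \<open>Extensionality off \<open>L2 M\<close> is what qualifies both sides of a ring
    law for comparison by \<open>bounded_op_ext\<close>.\<close>
  have [simp]: "a U = undefined" if "a \<in> carrier (roe_algebra M)" "U \<notin> L2 M" for a U
    using bounded_opD(6)[OF roe_algebra_bounded[OF that(1)]] that(2) by (rule extensional_arb)
  have "ring (unitization (roe_algebra M))"
  proof (intro ringI abelian_groupI monoidI)
    fix x assume "x \<in> carrier (unitization (roe_algebra M))"
    then obtain a s where x: "x = (a, s)" "a \<in> carrier (roe_algebra M)" by auto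
    have "op_add M (op_scale M (- 1) a) a = op_zero M"
    proof (rule ext)
      show "op_add M (op_scale M (- 1) a) a \<in> carrier (roe_algebra M)" by (intro closed x)
      show "L2_inner M W (op_add M (op_scale M (- 1) a) a U) = L2_inner M W (op_zero M U)"
        if "U \<in> L2 M" "W \<in> L2 M" for U W
        using that x by simp
    qed simp
    then show "\<exists>y\<in>carrier (unitization (roe_algebra M)). y \<oplus>\<^bsub>unitization (roe_algebra M)\<^esub> x = \<zero>\<^bsub>unitization (roe_algebra M)\<^esub>"
      by (intro bexI[of _ "(op_scale M (- 1) a, - s)"])
        (simp_all only: x unitization_simps roe_algebra_simps, use x in auto)
  next
    fix x y assume "x \<in> carrier (unitization (roe_algebra M))" "y \<in> carrier (unitization (roe_algebra M))"
    then show "x \<oplus>\<^bsub>unitization (roe_algebra M)\<^esub> y \<in> carrier (unitization (roe_algebra M))"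
      "x \<otimes>\<^bsub>unitization (roe_algebra M)\<^esub> y \<in> carrier (unitization (roe_algebra M))"
      by (cases x; cases y; simp only: unitization_simps roe_algebra_simps mem_Times_iff fst_conv snd_conv
          UNIV_I simp_thms closed)+
  qed (auto simp: compose_def algebra_simps extensional_def intro!: bounded_op_ext[of _ M])
  moreover have "star_ring_axioms (unitization (roe_algebra M))"
  proof
    fix x y assume "x \<in> carrier (unitization (roe_algebra M))" "y \<in> carrier (unitization (roe_algebra M))"
    then obtain a s b t where x: "x = (a, s)" "a \<in> carrier (roe_algebra M)"
      and y: "y = (b, t)" "b \<in> carrier (roe_algebra M)" by auto
    note bd = roe_algebra_bounded[OF x(2)] roe_algebra_bounded[OF y(2)]
    show "star (unitization (roe_algebra M)) x \<in> carrier (unitization (roe_algebra M))"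
      by (simp add: x)
    show "star (unitization (roe_algebra M)) (star (unitization (roe_algebra M)) x) = x"
      by (simp add: x op_adj_algebra(4)[OF bd(1) bd(1)])
    show "star (unitization (roe_algebra M)) (x \<oplus>\<^bsub>unitization (roe_algebra M)\<^esub> y)
      = star (unitization (roe_algebra M)) x \<oplus>\<^bsub>unitization (roe_algebra M)\<^esub> star (unitization (roe_algebra M)) y"
      by (simp add: x y op_adj_algebra[OF bd])
    show "star (unitization (roe_algebra M)) (x \<otimes>\<^bsub>unitization (roe_algebra M)\<^esub> y)
      = star (unitization (roe_algebra M)) y \<otimes>\<^bsub>unitization (roe_algebra M)\<^esub> star (unitization (roe_algebra M)) x"
    proof -
      note bd' = bd bounded_op_intros
      have "op_adj M (op_add M (op_comp M a b) (op_add M (op_scale M s b) (op_scale M t a)))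
          = op_add M (op_comp M (op_adj M b) (op_adj M a)) (op_add M (op_scale M (cnj s) (op_adj M b)) (op_scale M (cnj t) (op_adj M a)))"
        by (simp only: bd' op_adj_algebra(1)[of M "op_comp M a b" "op_add M (op_scale M s b) (op_scale M t a)"]
            op_adj_algebra(1)[of M "op_scale M s b" "op_scale M t a"] op_adj_algebra(2)[of M a a] op_adj_algebra(2)[of M b b]
            op_adj_algebra(3)[of M a b])
      \<comment> \<open>The star reverses the product, so the two mixed terms come out in the
        opposite order from the one in the product of the stars.\<close>
      also have "\<dots> = op_add M (op_comp M (op_adj M b) (op_adj M a)) (op_add M (op_scale M (cnj t) (op_adj M a)) (op_scale M (cnj s) (op_adj M b)))"
      proof (rule ext)
        fix U W assume UW: "U \<in> L2 M" "W \<in> L2 M"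
        have [simp]: "op_adj M a V \<in> L2 M" "op_adj M b V \<in> L2 M" if "V \<in> L2 M" for V
          using bounded_opD(1)[OF op_adj(1)] bd that by blast+
        show "L2_inner M W (op_add M (op_comp M (op_adj M b) (op_adj M a)) (op_add M (op_scale M (cnj s) (op_adj M b)) (op_scale M (cnj t) (op_adj M a))) U)
          = L2_inner M W (op_add M (op_comp M (op_adj M b) (op_adj M a)) (op_add M (op_scale M (cnj t) (op_adj M a)) (op_scale M (cnj s) (op_adj M b))) U)"
          using UW by (simp add: compose_def)
      qed (intro closed x y)+
      finally show ?thesis
        by (simp only: x y unitization_simps roe_algebra_simps complex_cnj_mult mult.commute)
    qed
  qed
  ultimately show ?thesis by (rule star_ring.intro)
qed

section \<open>Partial isometries matching two orthonormal families\<close>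

abbreviation L2_lincomb :: "'a measure \<Rightarrow> ('i \<Rightarrow> ('a \<Rightarrow> complex) set) \<Rightarrow> 'i set \<Rightarrow> ('i \<Rightarrow> complex) \<Rightarrow> ('a \<Rightarrow> complex) set" where
  "L2_lincomb M \<psi> F c \<equiv> L2_class M (\<lambda>y. \<Sum>i\<in>F. c i * rep (\<psi> i) y)"

lemma L2_lincomb_in:
  assumes "\<And>i. i \<in> F \<Longrightarrow> \<psi> i \<in> L2 M"
  shows "L2_lincomb M \<psi> F c \<in> L2 M"
  using assms by (intro L2_class_in L2_fun_sum L2_fun_cmult rep_in_L2_fun)

lemma L2_inner_lincomb:
  assumes \<psi>: "\<And>i. i \<in> F \<Longrightarrow> \<psi> i \<in> L2 M" and W: "W \<in> L2 M"
  shows "L2_inner M W (L2_lincomb M \<psi> F c) = (\<Sum>i\<in>F. c i * L2_inner M W (\<psi> i))"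
proof -
  have int: "integrable M (\<lambda>x. c i * (cnj (rep W x) * rep (\<psi> i) x))" if "i \<in> F" for i
    using integrable_L2_fun_inner[OF rep_in_L2_fun[OF W] rep_in_L2_fun[OF \<psi>[OF that]]] by simp
  have "L2_inner M W (L2_lincomb M \<psi> F c) = (\<integral>x. cnj (rep W x) * (\<Sum>i\<in>F. c i * rep (\<psi> i) x) \<partial>M)"
    using \<psi> by (intro L2_inner_class W L2_fun_sum L2_fun_cmult rep_in_L2_fun)
  also have "\<dots> = (\<integral>x. (\<Sum>i\<in>F. c i * (cnj (rep W x) * rep (\<psi> i) x)) \<partial>M)"
    by (simp add: sum_distrib_left mult_ac)
  also have "\<dots> = (\<Sum>i\<in>F. \<integral>x. c i * (cnj (rep W x) * rep (\<psi> i) x) \<partial>M)"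
    by (rule Bochner_Integration.integral_sum[OF int])
  finally show ?thesis by (simp add: L2_inner_def)
qed

section \<open>Orthonormal families and Bessel's inequality\<close>

definition orthonormal_on :: "'a measure \<Rightarrow> 'i set \<Rightarrow> ('i \<Rightarrow> ('a \<Rightarrow> complex) set) \<Rightarrow> bool" where
  "orthonormal_on M I \<psi> \<longleftrightarrow> (\<forall>i\<in>I. \<psi> i \<in> L2 M) \<and>
     (\<forall>i\<in>I. \<forall>j\<in>I. L2_inner M (\<psi> i) (\<psi> j) = (if i = j then 1 else 0))"

lemma orthonormal_onD:
  assumes "orthonormal_on M I \<psi>" "i \<in> I"
  shows "\<psi> i \<in> L2 M" "j \<in> I \<Longrightarrow> L2_inner M (\<psi> i) (\<psi> j) = (if i = j then 1 else 0)"
  using assms by (auto simp: orthonormal_on_def)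

lemma orthonormal_on_subset: "orthonormal_on M I \<psi> \<Longrightarrow> J \<subseteq> I \<Longrightarrow> orthonormal_on M J \<psi>"
  unfolding orthonormal_on_def by blast

text \<open>Kept as an identity, because it also measures the distance to partial sums when the
  Wannier projection is computed.\<close>

lemma Bessel_diff:
  assumes \<psi>: "orthonormal_on M I \<psi>" and F: "finite F" "F \<subseteq> I" and U: "U \<in> L2 M"
  shows "(L2_norm M (L2_diff M U (L2_lincomb M \<psi> F (\<lambda>i. L2_inner M (\<psi> i) U))))\<^sup>2
    = (L2_norm M U)\<^sup>2 - (\<Sum>i\<in>F. (cmod (L2_inner M (\<psi> i) U))\<^sup>2)"
proof -
  define c where "c i = L2_inner M (\<psi> i) U" for i
  define V where "V = L2_lincomb M \<psi> F c"
  have \<psi>F: "\<psi> i \<in> L2 M" if "i \<in> F" for i using \<psi> F that by (auto simp: orthonormal_on_def)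
  have ortho: "L2_inner M (\<psi> i) (\<psi> j) = (if i = j then 1 else 0)" if "i \<in> F" "j \<in> F" for i j
    using orthonormal_onD(2)[OF \<psi>] subsetD[OF F(2)] that by blast
  have V: "V \<in> L2 M" unfolding V_def by (rule L2_lincomb_in[OF \<psi>F])
  have inner_\<psi>V: "L2_inner M (\<psi> i) V = c i" if "i \<in> F" for i
  proof -
    have "L2_inner M (\<psi> i) V = (\<Sum>j\<in>F. c j * L2_inner M (\<psi> i) (\<psi> j))"
      unfolding V_def by (rule L2_inner_lincomb[OF \<psi>F \<psi>F[OF that]])
    also have "\<dots> = (\<Sum>j\<in>F. if j = i then c i else 0)"
      using that by (intro sum.cong) (auto simp: ortho)
    finally show ?thesis using that F(1) by simp
  qed
  have UV: "L2_inner M U V = (\<Sum>i\<in>F. complex_of_real ((cmod (c i))\<^sup>2))"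
  proof -
    have "L2_inner M U V = (\<Sum>i\<in>F. c i * L2_inner M U (\<psi> i))"
      unfolding V_def by (rule L2_inner_lincomb[OF \<psi>F U])
    also have "\<dots> = (\<Sum>i\<in>F. complex_of_real ((cmod (c i))\<^sup>2))"
      by (rule sum.cong[OF refl]) (simp add: L2_inner_commute[of M U] c_def[symmetric] cmod_square_eq)
    finally show ?thesis .
  qed
  have VV: "L2_inner M V V = (\<Sum>i\<in>F. complex_of_real ((cmod (c i))\<^sup>2))"
  proof -
    have "L2_inner M V V = (\<Sum>i\<in>F. c i * L2_inner M V (\<psi> i))"
      by (subst (2) V_def) (rule L2_inner_lincomb[OF \<psi>F V])
    also have "\<dots> = (\<Sum>i\<in>F. complex_of_real ((cmod (c i))\<^sup>2))"
      by (rule sum.cong[OF refl]) (simp add: L2_inner_commute[of M V] inner_\<psi>V cmod_square_eq)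
    finally show ?thesis .
  qed
  have "L2_inner M V U = (\<Sum>i\<in>F. complex_of_real ((cmod (c i))\<^sup>2))"
    by (subst L2_inner_commute) (simp add: UV)
  then have "(L2_norm M (L2_diff M U V))\<^sup>2 = (L2_norm M U)\<^sup>2 - (\<Sum>i\<in>F. (cmod (c i))\<^sup>2)"
    using U V UV VV by (simp add: L2_norm_square)
  then show ?thesis by (simp add: V_def c_def)
qed

lemma Bessel:
  assumes "orthonormal_on M I \<psi>" "finite F" "F \<subseteq> I" "U \<in> L2 M"
  shows "(\<Sum>i\<in>F. (cmod (L2_inner M (\<psi> i) U))\<^sup>2) \<le> (L2_norm M U)\<^sup>2"
  using Bessel_diff[OF assms]
    zero_le_power2[of "L2_norm M (L2_diff M U (L2_lincomb M \<psi> F (\<lambda>i. L2_inner M (\<psi> i) U)))"]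
  by linarith

text \<open>Cauchy-Schwarz over \<open>F\<close>, then Bessel for each family. The bound is
  independent of \<open>F\<close>; this gives absolute summability of the matrix coefficients and
  the norm bound 1 for \<open>matching_op\<close>.\<close>

lemma Bessel_pair:
  assumes \<psi>: "orthonormal_on M I \<psi>" and \<eta>: "orthonormal_on M I \<eta>"
    and F: "finite F" "F \<subseteq> I" and U: "U \<in> L2 M" and W: "W \<in> L2 M"
  shows "(\<Sum>i\<in>F. cmod (L2_inner M W (\<eta> i) * L2_inner M (\<psi> i) U)) \<le> L2_norm M W * L2_norm M U"
proof -
  have "(\<Sum>i\<in>F. cmod (L2_inner M W (\<eta> i) * L2_inner M (\<psi> i) U))
      = (\<Sum>i\<in>F. \<bar>cmod (L2_inner M (\<eta> i) W)\<bar> * \<bar>cmod (L2_inner M (\<psi> i) U)\<bar>)"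
    by (simp add: norm_mult L2_inner_commute[of M W])
  \<comment> \<open>\<open>L2_set\<close> is the Euclidean norm over a finite index set and has
    nothing to do with the space \<open>L2\<close>.\<close>
  also have "\<dots> \<le> L2_set (\<lambda>i. cmod (L2_inner M (\<eta> i) W)) F * L2_set (\<lambda>i. cmod (L2_inner M (\<psi> i) U)) F"
    by (rule L2_set_mult_ineq)
  also have "\<dots> \<le> L2_norm M W * L2_norm M U"
    unfolding L2_set_def
    by (intro mult_mono real_le_lsqrt sum_nonneg real_sqrt_ge_zero Bessel[OF \<eta> F W] Bessel[OF \<psi> F U]) auto
  finally show ?thesis .
qed

lemma matching_summable:
  assumes \<psi>: "orthonormal_on M I \<psi>" and \<eta>: "orthonormal_on M I \<eta>"
    and U: "U \<in> L2 M" and W: "W \<in> L2 M"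
  shows "(\<lambda>i. L2_inner M W (\<eta> i) * L2_inner M (\<psi> i) U) summable_on I"
proof (rule abs_summable_summable, rule nonneg_bdd_above_summable_on)
  show "bdd_above (sum (\<lambda>i. cmod (L2_inner M W (\<eta> i) * L2_inner M (\<psi> i) U)) ` {F. F \<subseteq> I \<and> finite F})"
    using Bessel_pair[OF \<psi> \<eta> _ _ U W] by (intro bdd_aboveI2[where M = "L2_norm M W * L2_norm M U"]) auto
qed simp

text \<open>The partial isometry that sends each \<open>\<psi> i\<close> to \<open>\<eta> i\<close>
  and vanishes on the orthogonal complement of the first family. It is given weakly: the
  coefficients determine it, and the form theorem provides it.\<close>

definition matching_op :: "'a measure \<Rightarrow> 'i set \<Rightarrow> ('i \<Rightarrow> ('a \<Rightarrow> complex) set) \<Rightarrow> ('i \<Rightarrow> ('a \<Rightarrow> complex) set) \<Rightarrow> 'a l2_op" where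
  "matching_op M I \<psi> \<eta> = (SOME T. bounded_op M T \<and>
     (\<forall>U\<in>L2 M. \<forall>W\<in>L2 M. L2_inner M W (T U) = (\<Sum>\<^sub>\<infinity>i\<in>I. L2_inner M W (\<eta> i) * L2_inner M (\<psi> i) U)) \<and>
     (\<forall>U\<in>L2 M. L2_norm M (T U) \<le> L2_norm M U))"

lemma matching_op:
  assumes \<psi>: "orthonormal_on M I \<psi>" and \<eta>: "orthonormal_on M I \<eta>"
  shows "bounded_op M (matching_op M I \<psi> \<eta>)"
    and "U \<in> L2 M \<Longrightarrow> W \<in> L2 M \<Longrightarrow> L2_inner M W (matching_op M I \<psi> \<eta> U)
      = (\<Sum>\<^sub>\<infinity>i\<in>I. L2_inner M W (\<eta> i) * L2_inner M (\<psi> i) U)"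
    and "U \<in> L2 M \<Longrightarrow> L2_norm M (matching_op M I \<psi> \<eta> U) \<le> L2_norm M U"
proof -
  let ?B = "\<lambda>W U. \<Sum>\<^sub>\<infinity>i\<in>I. L2_inner M W (\<eta> i) * L2_inner M (\<psi> i) U"
  note summable = matching_summable[OF \<psi> \<eta>]
  have bound: "cmod (?B W U) \<le> 1 * L2_norm M W * L2_norm M U" if U: "U \<in> L2 M" and W: "W \<in> L2 M" for U W
  proof (rule Lim_norm_ubound[OF _ infsum_tendsto[OF summable[OF U W]]])
    show "\<forall>\<^sub>F F in finite_subsets_at_top I.
        cmod (\<Sum>i\<in>F. L2_inner M W (\<eta> i) * L2_inner M (\<psi> i) U) \<le> 1 * L2_norm M W * L2_norm M U"
      using Bessel_pair[OF \<psi> \<eta> _ _ U W]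
      by (intro eventually_finite_subsets_at_top_weakI) (auto intro: order_trans[OF norm_sum])
  qed simp
  have \<psi>': "\<psi> i \<in> L2 M" "\<eta> i \<in> L2 M" if "i \<in> I" for i
    using \<psi> \<eta> that by (auto simp: orthonormal_on_def)
  have "\<exists>T. bounded_op M T \<and> (\<forall>U\<in>L2 M. \<forall>W\<in>L2 M. L2_inner M W (T U) = ?B W U) \<and>
      (\<forall>U\<in>L2 M. L2_norm M (T U) \<le> L2_norm M U)"
  proof (rule bounded_op_from_form[of M ?B 1])
    fix W U V assume W: "W \<in> L2 M" and U: "U \<in> L2 M" and V: "V \<in> L2 M"
    show "?B W (L2_add M U V) = ?B W U + ?B W V"
      using W U V \<psi>' by (subst infsum_add[symmetric]) (auto simp: summable distrib_left intro!: infsum_cong)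
    show "?B (L2_add M U V) W = ?B U W + ?B V W"
      using W U V \<psi>' by (subst infsum_add[symmetric]) (auto simp: summable distrib_right intro!: infsum_cong)
  next
    fix W U c assume W: "W \<in> L2 M" and U: "U \<in> L2 M"
    show "?B W (L2_scale M c U) = c * ?B W U"
      using W U \<psi>' by (subst infsum_cmult_right[symmetric]) (auto simp: summable intro!: infsum_cong)
    show "?B (L2_scale M c U) W = cnj c * ?B U W"
      using W U \<psi>' by (subst infsum_cmult_right[symmetric]) (auto simp: summable intro!: infsum_cong)
  next
    fix S assume "bounded_op M S" "\<And>U W. U \<in> L2 M \<Longrightarrow> W \<in> L2 M \<Longrightarrow> L2_inner M W (S U) = ?B W U"
      "\<And>U. U \<in> L2 M \<Longrightarrow> L2_norm M (S U) \<le> 1 * L2_norm M U"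
    then show ?thesis by (intro exI[of _ S]) simp
  qed (rule bound)
  from someI_ex[OF this]
  show "bounded_op M (matching_op M I \<psi> \<eta>)"
    and "U \<in> L2 M \<Longrightarrow> W \<in> L2 M \<Longrightarrow> L2_inner M W (matching_op M I \<psi> \<eta> U) = ?B W U"
    and "U \<in> L2 M \<Longrightarrow> L2_norm M (matching_op M I \<psi> \<eta> U) \<le> L2_norm M U"
    unfolding matching_op_def[symmetric] by blast+
qed

lemma matching_op_inner_family:
  assumes \<psi>: "orthonormal_on M I \<psi>" and \<eta>: "orthonormal_on M I \<eta>" and j: "j \<in> I" and U: "U \<in> L2 M"
  shows "L2_inner M (\<eta> j) (matching_op M I \<psi> \<eta> U) = L2_inner M (\<psi> j) U"
proof -
  have "L2_inner M (\<eta> j) (matching_op M I \<psi> \<eta> U) = (\<Sum>\<^sub>\<infinity>i\<in>I. L2_inner M (\<eta> j) (\<eta> i) * L2_inner M (\<psi> i) U)"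
    by (rule matching_op(2)[OF \<psi> \<eta> U orthonormal_onD(1)[OF \<eta> j]])
  also have "\<dots> = (\<Sum>\<^sub>\<infinity>i\<in>{j}. L2_inner M (\<psi> i) U)"
    using orthonormal_onD(2)[OF \<eta> j] j by - (rule infsum_cong_neutral, auto)
  finally show ?thesis by simp
qed

lemma op_eqI:
  assumes S: "bounded_op M S" and T: "bounded_op M T"
    and eq: "\<And>U W. U \<in> L2 M \<Longrightarrow> W \<in> L2 M \<Longrightarrow> L2_inner M W (S U) = L2_inner M W (T U)"
  shows "S = T"
  by (rule bounded_op_ext[OF bounded_opD(6)[OF S] bounded_opD(6)[OF T] bounded_opD(1)[OF S] bounded_opD(1)[OF T] eq])

lemma matching_op_compose:
  assumes \<psi>: "orthonormal_on M I \<psi>" and \<eta>: "orthonormal_on M I \<eta>" and \<zeta>: "orthonormal_on M I \<zeta>"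
  shows "op_comp M (matching_op M I \<eta> \<zeta>) (matching_op M I \<psi> \<eta>) = matching_op M I \<psi> \<zeta>"
proof (rule op_eqI)
  note b = matching_op(1)[OF \<eta> \<zeta>] matching_op(1)[OF \<psi> \<eta>]
  show "bounded_op M (op_comp M (matching_op M I \<eta> \<zeta>) (matching_op M I \<psi> \<eta>))"
    by (intro bounded_op_compose b)
  show "bounded_op M (matching_op M I \<psi> \<zeta>)" by (rule matching_op(1)[OF \<psi> \<zeta>])
  fix U W assume "U \<in> L2 M" "W \<in> L2 M"
  then show "L2_inner M W (op_comp M (matching_op M I \<eta> \<zeta>) (matching_op M I \<psi> \<eta>) U)
      = L2_inner M W (matching_op M I \<psi> \<zeta> U)"
    by (auto simp: compose_def bounded_opD(1)[OF b(2)] matching_op(2)[OF \<eta> \<zeta>] matching_op(2)[OF \<psi> \<zeta>]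
        matching_op_inner_family[OF \<psi> \<eta>] intro!: infsum_cong)
qed

lemma matching_op_compose_orthogonal:
  assumes \<psi>: "orthonormal_on M I \<psi>" and \<eta>: "orthonormal_on M I \<eta>"
    and \<psi>': "orthonormal_on M J \<psi>'" and \<eta>': "orthonormal_on M J \<eta>'"
    and orth: "\<And>i j. i \<in> I \<Longrightarrow> j \<in> J \<Longrightarrow> L2_inner M (\<psi>' j) (\<eta> i) = 0"
  shows "op_comp M (matching_op M J \<psi>' \<eta>') (matching_op M I \<psi> \<eta>) = op_zero M"
proof (rule op_eqI)
  note b = matching_op(1)[OF \<psi>' \<eta>'] matching_op(1)[OF \<psi> \<eta>]
  show "bounded_op M (op_comp M (matching_op M J \<psi>' \<eta>') (matching_op M I \<psi> \<eta>))"
    by (intro bounded_op_compose b)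
  show "bounded_op M (op_zero M)" by (rule bounded_op_zero)
  fix U W assume UW: "U \<in> L2 M" "W \<in> L2 M"
  have "L2_inner M (\<psi>' j) (matching_op M I \<psi> \<eta> U) = 0" if "j \<in> J" for j
    using orth[OF _ that] by (simp add: matching_op(2)[OF \<psi> \<eta> UW(1) orthonormal_onD(1)[OF \<psi>' that]] infsum_0)
  then show "L2_inner M W (op_comp M (matching_op M J \<psi>' \<eta>') (matching_op M I \<psi> \<eta>) U)
      = L2_inner M W (op_zero M U)"
    using UW by (simp add: compose_def bounded_opD(1)[OF b(2)] matching_op(2)[OF \<psi>' \<eta>'] infsum_0)
qed

lemma matching_op_adj:
  assumes \<psi>: "orthonormal_on M I \<psi>" and \<eta>: "orthonormal_on M I \<eta>"
  shows "op_adj M (matching_op M I \<psi> \<eta>) = matching_op M I \<eta> \<psi>"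
proof (rule op_adj_unique)
  show "bounded_op M (matching_op M I \<eta> \<psi>)" by (rule matching_op(1)[OF \<eta> \<psi>])
  fix U V assume U: "U \<in> L2 M" and V: "V \<in> L2 M"
  have "L2_inner M (matching_op M I \<eta> \<psi> U) V = cnj (\<Sum>\<^sub>\<infinity>i\<in>I. L2_inner M V (\<psi> i) * L2_inner M (\<eta> i) U)"
    by (subst L2_inner_commute) (simp add: matching_op(2)[OF \<eta> \<psi> U V])
  also have "\<dots> = (\<Sum>\<^sub>\<infinity>i\<in>I. cnj (L2_inner M V (\<psi> i) * L2_inner M (\<eta> i) U))"
    by (rule infsum_cnj[symmetric])
  also have "\<dots> = L2_inner M U (matching_op M I \<psi> \<eta> V)"
    by (auto simp: matching_op(2)[OF \<psi> \<eta> V U] simp flip: L2_inner_commute intro!: infsum_cong)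
  finally show "L2_inner M (matching_op M I \<eta> \<psi> U) V = L2_inner M U (matching_op M I \<psi> \<eta> V)" .
qed

lemma matching_op_union:
  assumes \<psi>: "orthonormal_on M (I \<union> J) \<psi>" and \<eta>: "orthonormal_on M (I \<union> J) \<eta>" and IJ: "I \<inter> J = {}"
  shows "op_add M (matching_op M I \<psi> \<eta>) (matching_op M J \<psi> \<eta>) = matching_op M (I \<union> J) \<psi> \<eta>"
proof (rule op_eqI)
  have \<psi>\<eta>: "orthonormal_on M I \<psi>" "orthonormal_on M I \<eta>" "orthonormal_on M J \<psi>" "orthonormal_on M J \<eta>"
    using \<psi> \<eta> orthonormal_on_subset by blast+
  note b = matching_op(1)[OF \<psi>\<eta>(1,2)] matching_op(1)[OF \<psi>\<eta>(3,4)]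
  show "bounded_op M (op_add M (matching_op M I \<psi> \<eta>) (matching_op M J \<psi> \<eta>))"
    by (intro bounded_op_add b)
  show "bounded_op M (matching_op M (I \<union> J) \<psi> \<eta>)" by (rule matching_op(1)[OF \<psi> \<eta>])
  fix U W assume "U \<in> L2 M" "W \<in> L2 M"
  then show "L2_inner M W (op_add M (matching_op M I \<psi> \<eta>) (matching_op M J \<psi> \<eta>) U)
      = L2_inner M W (matching_op M (I \<union> J) \<psi> \<eta> U)"
    using matching_summable[OF \<psi>\<eta>(1,2)] matching_summable[OF \<psi>\<eta>(3,4)]
    by (simp add: b[THEN bounded_opD(1)] matching_op(2)[OF \<psi>\<eta>(1,2)] matching_op(2)[OF \<psi>\<eta>(3,4)]
        matching_op(2)[OF \<psi> \<eta>] infsum_Un_disjoint IJ)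
qed

lemma matching_op_reindex:
  assumes h: "inj_on h I"
    and \<psi>: "orthonormal_on M (h ` I) \<psi>" and \<eta>: "orthonormal_on M (h ` I) \<eta>"
  shows "matching_op M I (\<lambda>i. \<psi> (h i)) (\<lambda>i. \<eta> (h i)) = matching_op M (h ` I) \<psi> \<eta>"
    and "orthonormal_on M I (\<lambda>i. \<psi> (h i))"
proof -
  have comp: "orthonormal_on M I (\<lambda>i. \<xi> (h i))" if "orthonormal_on M (h ` I) \<xi>" for \<xi>
    using that h unfolding orthonormal_on_def by (auto simp: inj_on_eq_iff)
  show "orthonormal_on M I (\<lambda>i. \<psi> (h i))" by (rule comp[OF \<psi>])
  show "matching_op M I (\<lambda>i. \<psi> (h i)) (\<lambda>i. \<eta> (h i)) = matching_op M (h ` I) \<psi> \<eta>"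
  proof (rule op_eqI)
    show "bounded_op M (matching_op M I (\<lambda>i. \<psi> (h i)) (\<lambda>i. \<eta> (h i)))"
      by (intro matching_op comp \<psi> \<eta>)
    show "bounded_op M (matching_op M (h ` I) \<psi> \<eta>)" by (intro matching_op \<psi> \<eta>)
  qed (simp add: matching_op(2)[OF \<psi> \<eta>] matching_op(2)[OF comp[OF \<psi>] comp[OF \<eta>]] infsum_reindex[OF h] o_def)
qed

text \<open>A finite sum of rank-one operators; in rank one, Bolzano-Weierstrass is applied to the
  scalar coefficients.\<close>

lemma compact_matching_op:
  assumes "finite I" and \<psi>: "orthonormal_on M I \<psi>" and \<eta>: "orthonormal_on M I \<eta>"
  shows "compact_op M (matching_op M I \<psi> \<eta>)"
  using assms
proof (induction I rule: finite_induct)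
  case empty
  have "matching_op M {} \<psi> \<eta> = op_zero M"
    by (rule op_eqI[OF matching_op(1)[OF empty] bounded_op_zero]) (simp add: matching_op(2)[OF empty])
  then show ?case by (simp only: compact_op_zero)
next
  case (insert k F)
  have k: "orthonormal_on M {k} \<psi>" "orthonormal_on M {k} \<eta>"
    and F: "orthonormal_on M F \<psi>" "orthonormal_on M F \<eta>"
    using insert.prems orthonormal_on_subset by blast+
  have k': "\<psi> k \<in> L2 M" "\<eta> k \<in> L2 M" using k by (auto simp: orthonormal_on_def)
  have "compact_op M (matching_op M {k} \<psi> \<eta>)"
    unfolding compact_op_iff
  proof (intro conjI allI impI matching_op k)
    have eq: "matching_op M {k} \<psi> \<eta> U = L2_scale M (L2_inner M (\<psi> k) U) (\<eta> k)" if "U \<in> L2 M" for U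
      using that k' bounded_opD(1)[OF matching_op(1)[OF k]]
      by (intro L2_ext[of _ M]) (simp_all add: matching_op(2)[OF k] mult.commute)
    fix U assume U: "\<forall>n::nat. U n \<in> L2 M \<and> L2_norm M (U n) \<le> 1"
    define c where "c n = L2_inner M (\<psi> k) (U n)" for n
    have "cmod (c n) \<le> L2_norm M (\<psi> k) * 1" for n
      unfolding c_def using U
      by (intro order_trans[OF L2_Cauchy_Schwarz] mult_left_mono k') auto
    then have "bounded (range c)"
      by (auto simp: bounded_iff)
    then obtain l s where s: "strict_mono s" "(c \<circ> s) \<longlonglongrightarrow> l"
      using bounded_imp_convergent_subsequence by blast
    then have "Cauchy (c \<circ> s)"
      by (intro LIMSEQ_imp_Cauchy)
    have "L2_norm M (\<eta> k) = 1"
      using orthonormal_onD(2)[OF k(2), of k k] L2_norm_square[of M "\<eta> k"] L2_norm_nonneg[of M "\<eta> k"]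
      by (simp add: power2_eq_1_iff)
    have dist: "L2_dist M (L2_scale M (c n) (\<eta> k)) (L2_scale M (c m) (\<eta> k)) = dist (c n) (c m)" for n m
    proof -
      have "L2_diff M (L2_scale M (c n) (\<eta> k)) (L2_scale M (c m) (\<eta> k)) = L2_scale M (c n - c m) (\<eta> k)"
        using k' by (intro L2_ext[of _ M]) (simp_all add: algebra_simps)
      then show ?thesis
        using k' \<open>L2_norm M (\<eta> k) = 1\<close> by (simp add: L2_dist_def dist_norm)
    qed
    have "L2.MCauchy M (\<lambda>n. L2_scale M (c (s n)) (\<eta> k))"
      using \<open>Cauchy (c \<circ> s)\<close> k' unfolding L2_MCauchy_iff dist by (simp add: Cauchy_def)
    then show "\<exists>s. strict_mono s \<and> L2.MCauchy M (\<lambda>n. matching_op M {k} \<psi> \<eta> (U (s n)))"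
      using s(1) U by (intro exI[of _ s]) (simp add: eq c_def)
  qed
  then have "compact_op M (op_add M (matching_op M {k} \<psi> \<eta>) (matching_op M F \<psi> \<eta>))"
    by (intro compact_op_add insert.IH F)
  then show ?case
    using matching_op_union[of M "{k}" F \<psi> \<eta>] insert by simp
qed

section \<open>Localized families and their partial isometries\<close>

definition vanishes_off :: "'a measure \<Rightarrow> ('a \<Rightarrow> complex) set \<Rightarrow> 'a set \<Rightarrow> bool" where
  "vanishes_off M U A \<longleftrightarrow> (AE x in M. x \<notin> A \<longrightarrow> rep U x = 0)"

lemma L2_inner_eq_0_if_disjoint:
  assumes "vanishes_off M U A" "vanishes_off M V B" "A \<inter> B = {}" "U \<in> L2 M" "V \<in> L2 M"
  shows "L2_inner M U V = 0"
proof -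
  have "AE x in M. cnj (rep U x) * rep V x = 0"
    using assms(1,2) unfolding vanishes_off_def
    by eventually_elim (use \<open>A \<inter> B = {}\<close> in auto)
  then have "(\<integral>x. cnj (rep U x) * rep V x \<partial>M) = (\<integral>x. 0 \<partial>M)"
    using integrable_L2_fun_inner[OF rep_in_L2_fun[OF assms(4)] rep_in_L2_fun[OF assms(5)]]
    by (intro integral_cong_AE) (auto dest: borel_measurable_integrable)
  then show ?thesis by (simp add: L2_inner_def)
qed

lemma vanishes_off_mult_op:
  assumes "bounded_fun M h" "U \<in> L2 M"
  shows "vanishes_off M (mult_op M h U) {x. h x \<noteq> 0}"
  using AE_rep_mult_op[OF assms] unfolding vanishes_off_def by eventually_elim auto

text \<open>The finiteness condition counts indices and not centres, since rays may meet and several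
  vectors may then share a centre. Local compactness rests on it.\<close>

definition localized :: "'a::metric_space measure \<Rightarrow> 'i set \<Rightarrow> ('i \<Rightarrow> 'a) \<Rightarrow> real \<Rightarrow> ('i \<Rightarrow> ('a \<Rightarrow> complex) set) \<Rightarrow> bool" where
  "localized M I c R \<psi> \<longleftrightarrow> orthonormal_on M I \<psi> \<and>
     (\<forall>i\<in>I. vanishes_off M (\<psi> i) (cball (c i) R)) \<and> (\<forall>z r. finite {i \<in> I. dist z (c i) \<le> r})"

lemma localized_subset: "localized M I c R \<psi> \<Longrightarrow> J \<subseteq> I \<Longrightarrow> localized M J c R \<psi>"
  unfolding localized_def
  by (auto intro: orthonormal_on_subset finite_subset[of "{i \<in> J. _ i}" "{i \<in> I. _ i}"])

text \<open>Outside a large ball \<open>f\<close> is small, and only finitely many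
  \<open>\<psi> i\<close> meet that ball; so the operator is a norm limit of operators of finite
  rank.\<close>

lemma compact_op_matching_op_mult:
  fixes M :: "'a::metric_space measure"
  assumes M: "proper_metric_measure_space M" and \<psi>: "localized M I c R \<psi>" and \<eta>: "orthonormal_on M I \<eta>"
    and f: "f \<in> C0"
  shows "compact_op M (op_comp M (matching_op M I \<psi> \<eta>) (mult_op M f))"
proof (rule compact_op_limit)
  have borel: "sets M = sets borel" using M by (simp add: proper_metric_measure_space_def)
  have \<psi>o: "orthonormal_on M I \<psi>" using \<psi> by (simp add: localized_def)
  note bf = C0_bounded_fun[OF borel f]
  show "bounded_op M (op_comp M (matching_op M I \<psi> \<eta>) (mult_op M f))"
    by (intro bounded_op_compose matching_op \<psi>o \<eta> bounded_op_mult bf)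
  fix e :: real assume e: "e > 0"
  then obtain K where K: "compact K" "\<And>x. x \<notin> K \<Longrightarrow> cmod (f x) < e"
    using f unfolding C0_def by blast
  obtain z r where zr: "K \<subseteq> cball z r"
    using compact_imp_bounded[OF K(1)] unfolding bounded_subset_cball by (metis bounded_def mem_cball subset_eq)
  \<comment> \<open>An index outside \<open>F\<close> has its centre farther than
    \<open>r + R\<close> from \<open>z\<close>, so the support of its vector misses
    \<open>cball z r\<close>.\<close>
  define F where "F = {i \<in> I. dist z (c i) \<le> r + R}"
  have F: "finite F" "F \<subseteq> I" using \<psi> by (auto simp: F_def localized_def)
  define G where "G = I - F"
  have FG: "I = F \<union> G" "F \<inter> G = {}" using F by (auto simp: G_def)
  have oF: "orthonormal_on M F \<psi>" "orthonormal_on M F \<eta>" and oG: "orthonormal_on M G \<psi>" "orthonormal_on M G \<eta>"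
    using \<psi>o \<eta> FG orthonormal_on_subset by blast+
  \<comment> \<open>The truncation is not continuous, but it is bounded by \<open>e\<close>
    everywhere.\<close>
  define g where "g x = (if x \<in> cball z r then 0 else f x)" for x
  have g: "bounded_fun M g"
  proof -
    have [measurable]: "cball z r \<in> sets M" "f \<in> borel_measurable M"
      using bf by (auto simp: borel bounded_fun_def)
    have "g \<in> borel_measurable M" unfolding g_def by measurable
    moreover obtain C where "\<And>x. cmod (f x) \<le> C" using bf by (auto simp: bounded_fun_def)
    then have "cmod (g x) \<le> max C 0" for x by (auto simp: g_def le_max_iff_disj)
    ultimately show ?thesis by (auto simp: bounded_fun_def)
  qed
  have g_le: "cmod (g x) \<le> e" for x
    using K(2)[of x] zr e by (cases "x \<in> K") (auto simp: g_def less_imp_le)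
  have "L2_dist M (op_comp M (matching_op M I \<psi> \<eta>) (mult_op M f) U)
      (op_comp M (matching_op M F \<psi> \<eta>) (mult_op M f) U) \<le> e * L2_norm M U" if U: "U \<in> L2 M" for U
  proof -
    define V where "V = mult_op M f U"
    have V: "V \<in> L2 M" unfolding V_def by (rule mult_op_in[OF bf U])
    have gU: "mult_op M g U \<in> L2 M" by (rule mult_op_in[OF g U])
    note b = bounded_opD(1)[OF matching_op(1)[OF \<psi>o \<eta>]] bounded_opD(1)[OF matching_op(1)[OF oF]]
      bounded_opD(1)[OF matching_op(1)[OF oG]]
    \<comment> \<open>\<open>\<psi> i\<close> vanishes almost everywhere on the ball, while
      \<open>f U\<close> and \<open>g U\<close> differ only there.\<close>
    have same: "L2_inner M (\<psi> i) V = L2_inner M (\<psi> i) (mult_op M g U)" if i: "i \<in> G" for i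
    proof -
      have \<psi>i: "\<psi> i \<in> L2 M" by (rule orthonormal_onD(1)[OF oG(1) i])
      have far: "cball (c i) R \<inter> cball z r = {}"
      proof -
        have "r + R < dist z (c i)" using i by (auto simp: G_def F_def)
        then show ?thesis
          by (auto simp: dist_commute) (metis add.commute add_mono dist_commute dist_triangle2 leD order_trans)
      qed
      have "vanishes_off M (L2_diff M V (mult_op M g U)) (cball z r)"
        using AE_rep(4)[OF V gU] AE_rep_mult_op[OF bf U] AE_rep_mult_op[OF g U]
        unfolding vanishes_off_def V_def by eventually_elim (auto simp: g_def)
      moreover have "vanishes_off M (\<psi> i) (cball (c i) R)"
        using \<psi> i by (auto simp: localized_def G_def)
      ultimately have "L2_inner M (\<psi> i) (L2_diff M V (mult_op M g U)) = 0"
        using far \<psi>i V gU by (intro L2_inner_eq_0_if_disjoint) auto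
      then show ?thesis using \<psi>i V gU by simp
    qed
    have "matching_op M I \<psi> \<eta> V = L2_add M (matching_op M F \<psi> \<eta> V) (matching_op M G \<psi> \<eta> V)"
      using matching_op_union[of M F G \<psi> \<eta>] \<psi>o \<eta> FG V by (metis (no_types, lifting) restrict_apply')
    then have "L2_diff M (matching_op M I \<psi> \<eta> V) (matching_op M F \<psi> \<eta> V) = matching_op M G \<psi> \<eta> V"
      using V b by (intro L2_ext[of _ M]) simp_all
    also have "\<dots> = matching_op M G \<psi> \<eta> (mult_op M g U)"
      using V gU b by (intro L2_ext[of _ M]) (simp_all add: matching_op(2)[OF oG] same cong: infsum_cong)
    finally have "L2_dist M (matching_op M I \<psi> \<eta> V) (matching_op M F \<psi> \<eta> V) \<le> L2_norm M (mult_op M g U)"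
      using matching_op(3)[OF oG gU] by (simp add: L2_dist_def)
    also have "\<dots> \<le> e * L2_norm M U"
      using e by (intro L2_norm_mult_op_le g U g_le) auto
    finally show ?thesis using U by (simp add: compose_def V_def)
  qed
  moreover have "compact_op M (op_comp M (matching_op M F \<psi> \<eta>) (mult_op M f))"
    by (intro compact_op_compose_right bounded_op_mult bf compact_matching_op F oF)
  ultimately show "\<exists>S. compact_op M S \<and> (\<forall>U\<in>L2 M. L2_dist M
      (op_comp M (matching_op M I \<psi> \<eta>) (mult_op M f) U) (S U) \<le> e * L2_norm M U)"
    by blast
qed

text \<open>Both families must be localized: the first gives compactness of the product with a
  multiplier on the right, and the second, through the adjoint, that with a multiplier on the
  left.\<close>

lemma roe_generator_matching_op:
  fixes M :: "'a::metric_space measure"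
  assumes M: "proper_metric_measure_space M" and \<psi>: "localized M I c R \<psi>" and \<eta>: "localized M I d R \<eta>"
    and near: "\<And>i. i \<in> I \<Longrightarrow> dist (c i) (d i) \<le> K"
  shows "roe_generator M (matching_op M I \<psi> \<eta>)"
proof -
  have borel: "sets M = sets borel" using M by (simp add: proper_metric_measure_space_def)
  note bf = C0_bounded_fun[OF borel]
  have o: "orthonormal_on M I \<psi>" "orthonormal_on M I \<eta>" using \<psi> \<eta> by (auto simp: localized_def)
  note T = matching_op(1)[OF o]
  have "locally_compact_op M (matching_op M I \<psi> \<eta>)"
    unfolding locally_compact_op_def
  proof (intro ballI conjI)
    fix f :: "'a \<Rightarrow> complex" assume f: "f \<in> C0"
    show "compact_op M (op_comp M (matching_op M I \<psi> \<eta>) (mult_op M f))"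
      by (rule compact_op_matching_op_mult[OF M \<psi> o(2) f])
    have "compact_op M (op_adj M (op_comp M (matching_op M I \<eta> \<psi>) (mult_op M (\<lambda>x. cnj (f x)))))"
      by (intro compact_op_adj compact_op_matching_op_mult[OF M \<eta> o(1)] C0_cnj f)
    also have "op_adj M (op_comp M (matching_op M I \<eta> \<psi>) (mult_op M (\<lambda>x. cnj (f x))))
        = op_comp M (mult_op M f) (matching_op M I \<psi> \<eta>)"
      using op_adj_algebra(3)[OF matching_op(1)[OF o(2,1)] bounded_op_mult[OF bf[OF C0_cnj[OF f]]]]
      by (simp add: matching_op_adj[OF o(2,1)] op_adj_mult[OF bf[OF C0_cnj[OF f]]])
    finally show "compact_op M (op_comp M (mult_op M f) (matching_op M I \<psi> \<eta>))" .
  qed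
  \<comment> \<open>A non-zero term of the series puts a point of the support of \<open>f\<close>
    within \<open>R\<close> of \<open>d i\<close> and one of \<open>g\<close> within
    \<open>R\<close> of \<open>c i\<close>, hence the bound \<open>2 * R + K\<close>; the maximum
    with 1 keeps it positive.\<close>
  moreover have "finite_propagation M (matching_op M I \<psi> \<eta>)"
    unfolding finite_propagation_iff[OF borel T]
  proof (intro exI[of _ "max 1 (2 * R + K)"] conjI ballI impI)
    fix f g :: "'a \<Rightarrow> complex" and U
    assume f: "f \<in> C0" and g: "g \<in> C0" and U: "U \<in> L2 M"
      and far: "\<forall>x y. f x \<noteq> 0 \<longrightarrow> g y \<noteq> 0 \<longrightarrow> max 1 (2 * R + K) < dist x y"
    define V where "V = mult_op M g U"
    have V: "V \<in> L2 M" unfolding V_def by (rule mult_op_in[OF bf[OF g] U])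
    have TV: "matching_op M I \<psi> \<eta> V \<in> L2 M" by (rule bounded_opD(1)[OF T V])
    note cf = bf[OF C0_cnj[OF f]]
    have "mult_op M f (matching_op M I \<psi> \<eta> V) = L2_zero M"
    proof (rule L2_ext[of _ M])
      fix W assume W: "W \<in> L2 M"
      define W' where "W' = mult_op M (\<lambda>x. cnj (f x)) W"
      have W': "W' \<in> L2 M" unfolding W'_def by (rule mult_op_in[OF cf W])
      have "L2_inner M W (mult_op M f (matching_op M I \<psi> \<eta> V)) = L2_inner M W' (matching_op M I \<psi> \<eta> V)"
        using L2_inner_mult_op_left[OF cf TV W] by (simp add: W'_def)
      also have "\<dots> = (\<Sum>\<^sub>\<infinity>i\<in>I. L2_inner M W' (\<eta> i) * L2_inner M (\<psi> i) V)"
        by (rule matching_op(2)[OF o V W'])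
      also have "\<dots> = 0"
      proof (rule infsum_0)
        fix i assume i: "i \<in> I"
        have i': "\<psi> i \<in> L2 M" "\<eta> i \<in> L2 M" using o i by (auto simp: orthonormal_on_def)
        have "L2_inner M W' (\<eta> i) = 0 \<or> L2_inner M (\<psi> i) V = 0"
        proof (rule ccontr)
          assume "\<not> ?thesis"
          then have "{x. cnj (f x) \<noteq> 0} \<inter> cball (d i) R \<noteq> {}" "cball (c i) R \<inter> {x. g x \<noteq> 0} \<noteq> {}"
            using L2_inner_eq_0_if_disjoint[OF vanishes_off_mult_op[OF cf W], of "\<eta> i" "cball (d i) R"]
              L2_inner_eq_0_if_disjoint[OF _ vanishes_off_mult_op[OF bf[OF g] U], of "\<psi> i" "cball (c i) R"]
              \<psi> \<eta> i i' V W' by (auto simp: localized_def V_def W'_def)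
          then obtain x y where xy: "f x \<noteq> 0" "dist (d i) x \<le> R" "dist (c i) y \<le> R" "g y \<noteq> 0"
            by auto
          have "dist x y \<le> dist x (d i) + dist (d i) y" by (rule dist_triangle)
          also have "dist (d i) y \<le> dist (d i) (c i) + dist (c i) y" by (rule dist_triangle)
          finally have "dist x y \<le> 2 * R + K"
            using xy near[OF i] by (simp add: dist_commute)
          then show False using far xy by fastforce
        qed
        then show "L2_inner M W' (\<eta> i) * L2_inner M (\<psi> i) V = 0" by auto
      qed
      finally show "L2_inner M W (mult_op M f (matching_op M I \<psi> \<eta> V)) = L2_inner M W (L2_zero M)"
        using W by simp
    qed (auto intro: mult_op_in bf f TV)
    then show "mult_op M f (matching_op M I \<psi> \<eta> (mult_op M g U)) = L2_zero M"
      by (simp add: V_def)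
  qed simp
  ultimately show ?thesis using T by (simp add: roe_generator_def)
qed

text \<open>\<open>orth_proj\<close> is a definite description, so the vector given by the matching
  operator must lie in the closed span, leave an orthogonal remainder, and be unique with these
  properties. From here on only matching operators are used.\<close>

lemma wannier_projection_eq:
  assumes \<phi>: "orthonormal_on M D \<phi>"
  shows "wannier_projection M D \<phi> = matching_op M D \<phi> \<phi>"
proof
  fix U
  note T = matching_op(1)[OF \<phi> \<phi>]
  have \<phi>': "\<phi> i \<in> L2 M" if "i \<in> D" for i using \<phi> that by (auto simp: orthonormal_on_def)
  show "wannier_projection M D \<phi> U = matching_op M D \<phi> \<phi> U"
  proof (cases "U \<in> L2 M")
    case U: True
    define V where "V = matching_op M D \<phi> \<phi> U"
    have V: "V \<in> L2 M" unfolding V_def by (rule bounded_opD(1)[OF T U])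
    have comm: "L2_inner M (\<phi> i) V = L2_inner M (\<phi> i) U" if "i \<in> D" for i
      unfolding V_def by (rule matching_op_inner_family[OF \<phi> \<phi> that U])
    have V_in: "V \<in> closed_span M \<phi> D"
      unfolding closed_span_def L2_closure_def
    proof (intro CollectI conjI allI impI V)
      fix e :: real assume e: "e > 0"
      \<comment> \<open>The squared norm of \<open>V\<close> is the sum of its squared coefficients,
        so by \<open>Bessel_diff\<close> a good partial sum of this series is a good approximation
        by a linear combination.\<close>
      have summable: "(\<lambda>i. complex_of_real ((cmod (L2_inner M (\<phi> i) U))\<^sup>2)) summable_on D"
        and VV: "L2_inner M V V = (\<Sum>\<^sub>\<infinity>i\<in>D. complex_of_real ((cmod (L2_inner M (\<phi> i) U))\<^sup>2))"
      proof -
        have eq: "L2_inner M V (\<phi> i) * L2_inner M (\<phi> i) U = complex_of_real ((cmod (L2_inner M (\<phi> i) U))\<^sup>2)"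
          if "i \<in> D" for i
          using comm[OF that] by (simp add: L2_inner_commute[of M V] cmod_square_eq mult.commute)
        show "(\<lambda>i. complex_of_real ((cmod (L2_inner M (\<phi> i) U))\<^sup>2)) summable_on D"
          using matching_summable[OF \<phi> \<phi> U V] by (rule summable_on_cong[THEN iffD1, rotated]) (rule eq)
        show "L2_inner M V V = (\<Sum>\<^sub>\<infinity>i\<in>D. complex_of_real ((cmod (L2_inner M (\<phi> i) U))\<^sup>2))"
          unfolding V_def matching_op(2)[OF \<phi> \<phi> U V[unfolded V_def]]
          by (rule infsum_cong) (use eq V_def in auto)
      qed
      obtain F where F: "finite F" "F \<subseteq> D"
        "dist (\<Sum>i\<in>F. complex_of_real ((cmod (L2_inner M (\<phi> i) U))\<^sup>2)) (L2_inner M V V) \<le> e\<^sup>2 / 2"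
        using infsum_finite_approximation[OF summable, of "e\<^sup>2 / 2"] e unfolding VV by auto
      let ?L = "L2_lincomb M \<phi> F (\<lambda>i. L2_inner M (\<phi> i) V)"
      have "(L2_dist M V ?L)\<^sup>2 = (L2_norm M V)\<^sup>2 - (\<Sum>i\<in>F. (cmod (L2_inner M (\<phi> i) V))\<^sup>2)"
        unfolding L2_dist_def by (rule Bessel_diff[OF \<phi> F(1,2) V])
      also have "(\<Sum>i\<in>F. (cmod (L2_inner M (\<phi> i) V))\<^sup>2) = (\<Sum>i\<in>F. (cmod (L2_inner M (\<phi> i) U))\<^sup>2)"
        using F(2) comm by (intro sum.cong) auto
      also have "(L2_norm M V)\<^sup>2 - \<dots> \<le> dist (\<Sum>i\<in>F. complex_of_real ((cmod (L2_inner M (\<phi> i) U))\<^sup>2)) (L2_inner M V V)"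
        unfolding L2_inner_self dist_norm
        by (simp flip: of_real_sum of_real_diff of_real_power)
      also have "\<dots> < e\<^sup>2" using F(3) e by (smt (verit) field_sum_of_halves zero_less_power)
      finally have "L2_dist M V ?L < e"
        using e by (simp add: power2_less_imp_less)
      then show "\<exists>W\<in>{L2_class M (\<lambda>y. \<Sum>i\<in>F. c i * rep (\<phi> i) y) |F c. finite F \<and> F \<subseteq> D}. L2_dist M V W < e"
        using F(1,2) by (intro bexI[of _ ?L] CollectI exI[of _ F] exI[of _ "\<lambda>i. L2_inner M (\<phi> i) V"] conjI refl)
    qed
    have orth: "L2_inner M W (L2_diff M U V) = 0" if W: "W \<in> closed_span M \<phi> D" for W
    proof (rule ccontr)
      assume ne: "L2_inner M W (L2_diff M U V) \<noteq> 0"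
      have W': "W \<in> L2 M" using W by (simp add: closed_span_def L2_closure_def)
      define n where "n = L2_norm M (L2_diff M U V)"
      have UV: "L2_diff M U V \<in> L2 M" using U V by simp
      \<comment> \<open>Division by \<open>n + 1\<close>, as \<open>n\<close> may be 0.\<close>
      have "0 < cmod (L2_inner M W (L2_diff M U V)) / (n + 1)"
        using ne by (intro divide_pos_pos) (auto simp: n_def add_nonneg_pos)
      then obtain F c where F: "finite F" "F \<subseteq> D"
        "L2_dist M W (L2_lincomb M \<phi> F c) < cmod (L2_inner M W (L2_diff M U V)) / (n + 1)"
        using W unfolding closed_span_def L2_closure_def by blast
      let ?L = "L2_lincomb M \<phi> F c"
      have L: "?L \<in> L2 M" using F \<phi>' by (intro L2_lincomb_in) auto
      have "L2_inner M (L2_diff M U V) ?L = (\<Sum>i\<in>F. c i * L2_inner M (L2_diff M U V) (\<phi> i))"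
        using F \<phi>' by (intro L2_inner_lincomb UV) auto
      also have "\<dots> = 0"
      proof (rule sum.neutral, rule ballI)
        fix i assume "i \<in> F"
        then have "L2_inner M (\<phi> i) (L2_diff M U V) = 0"
          using F(2) comm[of i] \<phi>'[of i] U V by auto
        then show "c i * L2_inner M (L2_diff M U V) (\<phi> i) = 0"
          by (simp add: L2_inner_commute[of M "L2_diff M U V"])
      qed
      finally have "L2_inner M ?L (L2_diff M U V) = 0"
        by (simp add: L2_inner_commute[of M ?L])
      then have "cmod (L2_inner M W (L2_diff M U V)) = cmod (L2_inner M (L2_diff M W ?L) (L2_diff M U V))"
        using W' L U V by simp
      also have "\<dots> \<le> L2_dist M W ?L * n"
        unfolding L2_dist_def n_def using W' L UV by (intro L2_Cauchy_Schwarz) auto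
      also have "\<dots> \<le> L2_dist M W ?L * (n + 1)"
        by (intro mult_left_mono) auto
      also have "\<dots> < cmod (L2_inner M W (L2_diff M U V))"
      proof -
        have "0 < n + 1" by (simp add: n_def add_nonneg_pos)
        then show ?thesis using F(3) by (simp add: pos_less_divide_eq)
      qed
      finally show False by simp
    qed
    have "wannier_projection M D \<phi> U = (THE V. V \<in> closed_span M \<phi> D \<and>
        (\<forall>W\<in>closed_span M \<phi> D. L2_inner M W (L2_diff M U V) = 0))"
      using U by (simp add: wannier_projection_def orth_proj_def)
    also have "\<dots> = V"
    proof (rule the_equality)
      show "V \<in> closed_span M \<phi> D \<and> (\<forall>W\<in>closed_span M \<phi> D. L2_inner M W (L2_diff M U V) = 0)"
        using V_in orth by blast
      fix V' assume V': "V' \<in> closed_span M \<phi> D \<and> (\<forall>W\<in>closed_span M \<phi> D. L2_inner M W (L2_diff M U V') = 0)"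
      then have V'_in: "V' \<in> L2 M" by (simp add: closed_span_def L2_closure_def)
      have "L2_inner M W (L2_diff M V' V) = 0" if "W \<in> closed_span M \<phi> D" for W
      proof -
        have "W \<in> L2 M" using that by (simp add: closed_span_def L2_closure_def)
        moreover have "L2_inner M W (L2_diff M U V') = 0" using V' that by blast
        ultimately show ?thesis using orth[OF that] U V V'_in by simp
      qed
      from this[of V] this[of V'] have "L2_inner M (L2_diff M V' V) (L2_diff M V' V) = 0"
        using V_in V' V V'_in by simp
      then have "L2_dist M V' V = 0"
        by (simp add: L2_inner_self L2_dist_def)
      then show "V' = V" using L2.zero[OF V'_in V] by simp
    qed
    finally show ?thesis by (simp add: V_def)
  next
    case False
    then show ?thesis
      using extensional_arb[OF bounded_opD(6)[OF T] False]
      by (simp add: wannier_projection_def orth_proj_def)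
  qed
qed

section \<open>Rays to infinity\<close>

text \<open>Coarse geometry with base point \<open>z\<close>: connectedness provides chains of unit
  steps, properness makes bounded regions finite up to unit balls, and non-compactness leaves room
  to escape.\<close>

locale unbounded_proper_space =
  fixes z :: "'a::metric_space"
  assumes compact_cball: "\<And>x r. compact (cball (x :: 'a) r)"
    and connected: "connected (UNIV :: 'a set)"
    and not_compact: "\<not> compact (UNIV :: 'a set)"
begin

definition edge :: "nat \<Rightarrow> 'a \<Rightarrow> 'a \<Rightarrow> bool" where
  "edge n x y \<longleftrightarrow> real n \<le> dist z x \<and> real n \<le> dist z y \<and> dist x y \<le> 1"

text \<open>That is, \<open>x\<close> lies in an unbounded component, for chains of unit steps, of
  the complement of the open ball of radius \<open>n\<close>: infinity can be reached without
  entering that ball.\<close>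

definition good :: "nat \<Rightarrow> 'a \<Rightarrow> bool" where
  "good n x \<longleftrightarrow> real n \<le> dist z x \<and> (\<forall>r. \<exists>y. (edge n)\<^sup>*\<^sup>* x y \<and> r < dist z y)"

lemma edge_sym: "edge n x y \<Longrightarrow> edge n y x"
  by (simp add: edge_def dist_commute)

lemma edges_sym: "(edge n)\<^sup>*\<^sup>* x y \<Longrightarrow> (edge n)\<^sup>*\<^sup>* y x"
  by (induction rule: rtranclp_induct) (auto intro: converse_rtranclp_into_rtranclp edge_sym)

lemma good_edges:
  assumes "good n x" "(edge n)\<^sup>*\<^sup>* x y"
  shows "good n y"
proof -
  have "real n \<le> dist z y"
    using assms(2,1) by (induction rule: rtranclp_induct) (auto simp: good_def edge_def)
  then show ?thesis
    using assms edges_sym[OF assms(2)] unfolding good_def by (meson rtranclp_trans)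
qed

text \<open>The set of reachable points and its complement are unions of unit balls, hence open.
  Level 0 puts no restriction on the points of a chain.\<close>

lemma chain_connected: "(edge 0)\<^sup>*\<^sup>* x y"
proof -
  define S where "S = {y. (edge 0)\<^sup>*\<^sup>* x y}"
  have near: "y \<in> S \<longleftrightarrow> w \<in> S" if "dist y w \<le> 1" for y w
  proof -
    have "edge 0 y w" using that by (simp add: edge_def)
    then show ?thesis
      unfolding S_def by (auto intro: rtranclp.rtrancl_into_rtrancl edge_sym)
  qed
  have "open S" "open (- S)"
    unfolding open_dist using near[OF less_imp_le] by (intro ballI exI[of _ 1]; auto)+
  then have "S \<inter> UNIV = {} \<or> - S \<inter> UNIV = {}"
    by (intro connectedD[OF connected]) auto
  moreover have "x \<in> S" by (simp add: S_def)
  ultimately have "S = UNIV" by auto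
  then show ?thesis by (auto simp: S_def)
qed

lemma unbounded: "\<exists>y. r < dist z y"
proof (rule ccontr)
  assume "\<nexists>y. r < dist z y"
  then have "UNIV = cball z r" by (auto simp: not_less)
  then show False using not_compact compact_cball[of z r] by simp
qed

lemma good_0: "good 0 x"
  using unbounded chain_connected by (auto simp: good_def)

text \<open>Every chain component of the complement of a ball meets a compact shell around that ball,
  and the shell is covered by finitely many balls of radius 1.\<close>

lemma bad_bounded: "\<exists>s. \<forall>y. real n \<le> dist z y \<longrightarrow> s < dist z y \<longrightarrow> good n y"
proof -
  \<comment> \<open>The shell is as thick as a step is long, so a chain cannot jump over it.\<close>
  define C where "C = cball z (real n + 1) - ball z (real n)"
  have "compact C" unfolding C_def by (intro compact_diff compact_cball open_ball)
  then obtain F where F: "F \<subseteq> C" "finite F" "C \<subseteq> (\<Union>f\<in>F. ball f 1)"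
    by (rule compactE_image[of C C "\<lambda>f. ball f 1"]) (auto intro: that)
  have C: "w \<in> C \<longleftrightarrow> real n \<le> dist z w \<and> dist z w \<le> real n + 1" for w
    by (auto simp: C_def)
  \<comment> \<open>As long as the chain has not met the shell it is beyond radius
    \<open>n + 1\<close>, and the next step is still an edge of level \<open>n\<close>.\<close>
  have reach: "((edge n)\<^sup>*\<^sup>* y v \<and> real n \<le> dist z v) \<or> (\<exists>w\<in>C. (edge n)\<^sup>*\<^sup>* y w)"
    if "(edge 0)\<^sup>*\<^sup>* y v" "real n \<le> dist z y" for y v
    using that
  proof (induction rule: rtranclp_induct)
    case (step v v')
    have "dist v v' \<le> 1" using step by (simp add: edge_def)
    show ?case
    proof (cases "\<exists>w\<in>C. (edge n)\<^sup>*\<^sup>* y w")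
      case False
      then have v: "(edge n)\<^sup>*\<^sup>* y v" "real n \<le> dist z v" "v \<notin> C" using step by auto
      then have "real n + 1 < dist z v" by (simp add: C)
      then have "real n \<le> dist z v'"
        using dist_triangle[of z v v'] \<open>dist v v' \<le> 1\<close> by (simp add: dist_commute)
      then have "edge n v v'" using v(2) \<open>dist v v' \<le> 1\<close> by (simp add: edge_def)
      then show ?thesis using v(1) \<open>real n \<le> dist z v'\<close> by (auto intro: rtranclp.rtrancl_into_rtrancl)
    qed blast
  qed simp
  have to_F: "\<exists>f\<in>F. (edge n)\<^sup>*\<^sup>* y f" if y: "real n \<le> dist z y" for y
  proof -
    have "\<exists>w\<in>C. (edge n)\<^sup>*\<^sup>* y w"
      using reach[OF chain_connected[of y z] y]
    proof
      \<comment> \<open>This case forces \<open>n = 0\<close>, and then \<open>z\<close> itself lies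
        in the shell.\<close>
      assume "(edge n)\<^sup>*\<^sup>* y z \<and> real n \<le> dist z z"
      then show ?thesis by (intro bexI[of _ z]) (auto simp: C)
    qed
    then obtain w where w: "w \<in> C" "(edge n)\<^sup>*\<^sup>* y w" by blast
    then obtain f where f: "f \<in> F" "dist f w < 1" using F(3) by auto
    then have "edge n w f" using w(1) F(1) by (auto simp: edge_def C dist_commute)
    then show ?thesis using f(1) w(2) by (auto intro: rtranclp.rtrancl_into_rtrancl)
  qed
  have "\<forall>f\<in>F. \<exists>r. \<not> good n f \<longrightarrow> (\<forall>y. (edge n)\<^sup>*\<^sup>* f y \<longrightarrow> dist z y \<le> r)"
    using F(1) by (auto simp: good_def C not_less subset_iff)
  then obtain r where r: "\<And>f y. f \<in> F \<Longrightarrow> \<not> good n f \<Longrightarrow> (edge n)\<^sup>*\<^sup>* f y \<Longrightarrow> dist z y \<le> r f"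
    by metis
  \<comment> \<open>Each bad component meets \<open>F\<close> and is bounded by the value of
    \<open>r\<close> there; the sum of absolute values dominates these finitely many bounds, also
    when \<open>F\<close> is empty.\<close>
  have "good n y" if y: "real n \<le> dist z y" "(\<Sum>f\<in>F. \<bar>r f\<bar>) < dist z y" for y
  proof (rule ccontr)
    assume bad: "\<not> good n y"
    obtain f where f: "f \<in> F" "(edge n)\<^sup>*\<^sup>* y f" using to_F[OF y(1)] by blast
    have "\<not> good n f" using bad good_edges[OF _ edges_sym[OF f(2)]] by blast
    then have "dist z y \<le> r f" using r[OF f(1)] edges_sym[OF f(2)] by blast
    also have "r f \<le> \<bar>r f\<bar>" by simp
    also have "\<dots> \<le> (\<Sum>f\<in>F. \<bar>r f\<bar>)"
      using F(2) f(1) by (intro member_le_sum) auto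
    finally show False using y(2) by simp
  qed
  then show ?thesis by blast
qed

text \<open>An unbounded component contains points as far out as desired, and far points are good
  for the next level by \<open>bad_bounded\<close>. The number of steps is recorded because
  \<open>rank\<close> minimizes it.\<close>

lemma good_climb:
  assumes "good n x"
  shows "\<exists>k y. (edge n ^^ k) x y \<and> good (Suc n) y"
proof -
  obtain s where s: "\<And>y. real (Suc n) \<le> dist z y \<Longrightarrow> s < dist z y \<Longrightarrow> good (Suc n) y"
    using bad_bounded[of "Suc n"] by blast
  obtain y where "(edge n)\<^sup>*\<^sup>* x y" "max s (real (Suc n)) < dist z y"
    using assms unfolding good_def by blast
  then show ?thesis
    using s[of y] unfolding rtranclp_power by auto
qed

text \<open>The termination measure that keeps a ray from lingering at one level for ever.\<close>

definition rank :: "nat \<Rightarrow> 'a \<Rightarrow> nat" where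
  "rank n x = (LEAST k. \<exists>y. (edge n ^^ k) x y \<and> good (Suc n) y)"

text \<open>A state is a level with a point. Either the level rises, possibly without a move, or the
  rank at the same level falls; so the level must rise again and again.\<close>

definition advance :: "nat \<times> 'a \<Rightarrow> nat \<times> 'a \<Rightarrow> bool" where
  "advance = (\<lambda>(n, x) (m, y). good m y \<and> dist x y \<le> 1 \<and>
     (m = Suc n \<or> m = n \<and> rank n y < rank n x))"

lemma advance_exists:
  assumes "good n x"
  shows "\<exists>t. advance (n, x) t"
proof -
  obtain y where y: "(edge n ^^ rank n x) x y" "good (Suc n) y"
    using LeastI_ex[OF good_climb[OF assms]] unfolding rank_def by blast
  show ?thesis
  proof (cases "rank n x")
    case 0
    then show ?thesis
      using y by (intro exI[of _ "(Suc n, x)"]) (simp add: advance_def)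
  next
    case (Suc k)
    then obtain w where w: "edge n x w" "(edge n ^^ k) w y"
      using y(1) relpowp_Suc_D2[of k "edge n" x y] by auto
    have "rank n w \<le> k"
      unfolding rank_def by (rule Least_le) (use w(2) y(2) in blast)
    then show ?thesis
      using w(1) Suc good_edges[OF assms r_into_rtranclp[of "edge n", OF w(1)]]
      by (intro exI[of _ "(n, w)"]) (simp add: advance_def edge_def)
  qed
qed

text \<open>The choice of successive states is iterated. The level never falls and is unbounded, and
  a point of level \<open>m\<close> is outside the open ball of radius \<open>m\<close>; so the ray
  leaves every ball for good.\<close>

lemma ray_from:
  assumes "good n x"
  shows "\<exists>\<gamma>. \<gamma> 0 = x \<and> (\<forall>k. dist (\<gamma> k) (\<gamma> (Suc k)) \<le> 1) \<and> (\<forall>k. real n \<le> dist z (\<gamma> k)) \<and>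
    (\<forall>r. finite {k. dist z (\<gamma> k) \<le> r})"
proof -
  define next_state where "next_state t = (SOME t'. advance t t')" for t
  define st where "st k = (next_state ^^ k) (n, x)" for k
  define lev where "lev k = fst (st k)" for k
  define \<gamma> where "\<gamma> k = snd (st k)" for k
  have st: "st k = (lev k, \<gamma> k)" for k by (simp add: lev_def \<gamma>_def)
  have next_state: "advance (m, y) (next_state (m, y))" if "good m y" for m y
    unfolding next_state_def by (rule someI_ex[OF advance_exists[OF that]])
  have good: "good (lev k) (\<gamma> k)" for k
  proof (induction k)
    case 0
    then show ?case using assms by (simp add: lev_def \<gamma>_def st_def)
  next
    case (Suc k)
    have "advance (st k) (st (Suc k))"
      using next_state[OF Suc] by (simp add: st_def flip: st)
    then show ?case by (auto simp: st advance_def)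
  qed
  have adv: "advance (lev k, \<gamma> k) (lev (Suc k), \<gamma> (Suc k))" for k
    using next_state[OF good[of k]] st[of k] st[of "Suc k"] by (simp add: st_def)
  have mono: "lev k \<le> lev (k + j)" for k j
  proof (induction j)
    case (Suc j)
    then show ?case using adv[of "k + j"] by (auto simp: advance_def)
  qed simp
  \<comment> \<open>Strong induction on the rank, which falls as long as the level stays the
    same.\<close>
  have climb: "\<exists>j. lev k < lev (k + j)" for k
  proof (induction "rank (lev k) (\<gamma> k)" arbitrary: k rule: less_induct)
    case less
    show ?case
    proof (cases "lev (Suc k) = lev k")
      case True
      then have "rank (lev (Suc k)) (\<gamma> (Suc k)) < rank (lev k) (\<gamma> k)"
        using adv[of k] by (auto simp: advance_def)
      then obtain j where "lev (Suc k) < lev (Suc k + j)" using less by blast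
      then show ?thesis using True by (intro exI[of _ "Suc j"]) simp
    next
      case False
      then show ?thesis using mono[of k 1] by (intro exI[of _ 1]) simp
    qed
  qed
  have high: "\<exists>k. m \<le> lev k" for m
  proof (induction m)
    case (Suc m)
    then obtain k where "m \<le> lev k" by blast
    then show ?case using climb[of k] by (meson Suc_leI le_less_trans)
  qed simp
  have far: "real (lev k) \<le> dist z (\<gamma> k)" for k
    using good[of k] by (simp add: good_def)
  have "finite {k. dist z (\<gamma> k) \<le> r}" for r
  proof -
    obtain m :: nat where m: "r < real m" using reals_Archimedean2 by blast
    obtain k where k: "m \<le> lev k" using high by blast
    have "{k. dist z (\<gamma> k) \<le> r} \<subseteq> {..<k}"
    proof
      fix i assume i: "i \<in> {k. dist z (\<gamma> k) \<le> r}"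
      have "i < k"
      proof (rule ccontr)
        assume "\<not> i < k"
        then have "lev k \<le> lev i" using mono[of k "i - k"] by simp
        then have "real m \<le> dist z (\<gamma> i)" using k far[of i] by linarith
        then show False using i m by simp
      qed
      then show "i \<in> {..<k}" by simp
    qed
    then show ?thesis by (rule finite_subset) simp
  qed
  moreover have "real n \<le> dist z (\<gamma> k)" for k
    using mono[of 0 k] far[of k] by (simp add: lev_def st_def)
  moreover have "\<gamma> 0 = x" by (simp add: \<gamma>_def st_def)
  moreover have "dist (\<gamma> k) (\<gamma> (Suc k)) \<le> 1" for k
    using adv[of k] by (auto simp: advance_def)
  ultimately show ?thesis by blast
qed

text \<open>Each ray starts at the greatest level for which its starting point is good. Points far
  out are good for high levels, hence rays from far away stay far away; this uniformity is the last
  property, and local finiteness needs it besides the escape of each single ray.\<close>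

lemma rays:
  obtains \<gamma> :: "'a \<Rightarrow> nat \<Rightarrow> 'a" where "\<And>x. \<gamma> x 0 = x" "\<And>x k. dist (\<gamma> x k) (\<gamma> x (Suc k)) \<le> 1"
    "\<And>x r. finite {k. dist z (\<gamma> x k) \<le> r}"
    "\<And>r. \<exists>s. \<forall>x k. s < dist z x \<longrightarrow> r < dist z (\<gamma> x k)"
proof -
  define lev where "lev x = Max {n. good n x}" for x
  \<comment> \<open>A point that is good for level \<open>n\<close> has distance at least
    \<open>n\<close> from \<open>z\<close>, so the maximum exists.\<close>
  have fin: "finite {n. good n x}" for x
  proof (rule finite_subset)
    show "{n. good n x} \<subseteq> {..nat \<lceil>dist z x\<rceil>}"
      by (auto simp: good_def) (meson nat_ceiling_le_eq linorder_le_cases of_nat_le_iff order_trans real_nat_ceiling_ge)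
  qed simp
  have good: "good (lev x) x" for x
    using Max_in[OF fin] good_0 unfolding lev_def by blast
  obtain \<gamma> where \<gamma>: "\<And>x. \<gamma> x 0 = x" "\<And>x k. dist (\<gamma> x k) (\<gamma> x (Suc k)) \<le> 1"
    "\<And>x k. real (lev x) \<le> dist z (\<gamma> x k)" "\<And>x r. finite {k. dist z (\<gamma> x k) \<le> r}"
    using ray_from[OF good] by metis
  have "\<exists>s. \<forall>x k. s < dist z x \<longrightarrow> r < dist z (\<gamma> x k)" for r
  proof -
    obtain m :: nat where m: "r < real m" using reals_Archimedean2 by blast
    obtain s where s: "\<And>y. real m \<le> dist z y \<Longrightarrow> s < dist z y \<Longrightarrow> good m y"
      using bad_bounded[of m] by blast
    have "r < dist z (\<gamma> x k)" if "max s (real m) < dist z x" for x k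
    proof -
      have "good m x" using that by (intro s) auto
      then have "m \<le> lev x" unfolding lev_def using fin by (intro Max_ge) auto
      then show ?thesis using m \<gamma>(3)[of x k] by linarith
    qed
    then show ?thesis by blast
  qed
  with \<gamma> that show ?thesis by blast
qed

end

section \<open>Choice of the orthonormal vectors along the rays\<close>

text \<open>The open sets in \<open>ess_supp\<close> may form an uncountable family, so their
  exceptional null sets cannot simply be united. Countably many compact shells exhaust the
  complement of the ball, and each is covered by finitely many of these sets.\<close>

lemma vanishes_off_ess_supp:
  fixes M :: "'a::metric_space measure"
  assumes M: "proper_metric_measure_space M" and supp: "ess_supp M U \<subseteq> cball x R"
  shows "vanishes_off M U (cball x R)"
proof -
  \<comment> \<open>The inner radii decrease to \<open>R\<close> and the outer radii increase to
    infinity; properness makes the shells compact.\<close>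
  define C where "C n = cball x (real n) - ball x (R + 1 / real (Suc n))" for n
  have compact: "compact (C n)" for n
    using M unfolding C_def proper_metric_measure_space_def by (intro compact_diff open_ball) auto
  define \<G> where "\<G> = {G. open G \<and> (AE y in M. y \<in> G \<longrightarrow> rep U y = 0)}"
  have "AE y in M. y \<in> C n \<longrightarrow> rep U y = 0" for n
  proof -
    define t where "t = 1 / real (Suc n)"
    have "0 < t" by (simp add: t_def)
    then have "C n \<inter> cball x R = {}" unfolding C_def t_def[symmetric] by auto
    then have "C n \<subseteq> \<Union>\<G>"
      using supp unfolding ess_supp_def \<G>_def[symmetric] by blast
    then obtain F where F: "F \<subseteq> \<G>" "finite F" "C n \<subseteq> \<Union>F"
      by (rule compactE[OF compact]) (auto simp: \<G>_def)
    have "AE y in M. \<forall>G\<in>F. y \<in> G \<longrightarrow> rep U y = 0"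
      using F(1,2) by (intro AE_finite_allI) (auto simp: \<G>_def)
    then show ?thesis
      by eventually_elim (use F(3) in blast)
  qed
  then have "AE y in M. \<forall>n. y \<in> C n \<longrightarrow> rep U y = 0"
    unfolding AE_all_countable by blast
  then show ?thesis
    unfolding vanishes_off_def
  proof eventually_elim
    case (elim y)
    show ?case
    proof
      assume "y \<notin> cball x R"
      then have "R < dist x y" by simp
      then obtain n where n: "1 / real (Suc n) < dist x y - R"
        using nat_approx_posE[of "dist x y - R"] by auto
      obtain m :: nat where m: "dist x y \<le> real m" using real_arch_simple by blast
      have "1 / real (Suc (max n m)) \<le> 1 / real (Suc n)" by (intro divide_left_mono) auto
      then have "y \<in> C (max n m)" using n m by (auto simp: C_def)
      then show "rep U y = 0" using elim by blast
    qed
  qed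
qed

text \<open>On a null ball a non-zero function of \<open>C0\<close> would act as the zero operator,
  which is compact, against ampleness.\<close>

lemma emeasure_ball_pos:
  fixes M :: "'a::metric_space measure"
  assumes M: "proper_metric_measure_space M" and ample: "ample M" and r: "0 < r"
  shows "0 < emeasure M (ball x r)"
proof (rule ccontr)
  assume "\<not> 0 < emeasure M (ball x r)"
  moreover have borel: "sets M = sets borel" using M by (simp add: proper_metric_measure_space_def)
  ultimately have "ball x r \<in> null_sets M" by (auto simp: null_sets_def)
  then have null: "AE y in M. y \<notin> ball x r" by (rule AE_not_in)
  \<comment> \<open>Radius \<open>r - 1\<close>, possibly negative, makes the ramp vanish from
    distance \<open>r\<close> on, while its value at the centre is still positive.\<close>
  define f where "f = cutoff x (r - 1)"
  have f: "f \<in> C0" unfolding f_def by (rule cutoff_C0[OF M])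
  note bf = C0_bounded_fun[OF borel f]
  have "mult_op M f U = L2_zero M" if U: "U \<in> L2 M" for U
  proof -
    have "mult_op M f U = mult_op M (\<lambda>_. 0) U"
    proof (rule mult_op_eqI[OF bf bounded_fun_const U U])
      show "AE y in M. f y * rep U y = 0 * rep U y"
        using null by eventually_elim (simp add: f_def cutoff)
    qed
    then show ?thesis by (simp add: mult_op_zero U)
  qed
  then have "mult_op M f = op_zero M"
    by (intro extensionalityI[OF bounded_opD(6)[OF bounded_op_mult[OF bf]] restrict_extensional]) simp
  then have "f = (\<lambda>x. 0)"
    using ample f compact_op_zero[of M] by (auto simp: ample_def)
  moreover have "f x \<noteq> 0" using r by (simp add: f_def cutoff_def)
  ultimately show False by simp
qed

text \<open>The strict inequality of measures yields two things: the remainder has positive measure,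
  and \<open>B\<close> has finite measure even if \<open>A\<close> has not.\<close>

lemma non_atomic_split:
  assumes "non_atomic M" "A \<in> sets M" "0 < emeasure M A"
  obtains B where "B \<in> sets M" "B \<subseteq> A" "0 < emeasure M B" "emeasure M B < \<infinity>" "0 < emeasure M (A - B)"
proof -
  obtain B where B: "B \<in> sets M" "B \<subseteq> A" "0 < emeasure M B" "emeasure M B < emeasure M A"
    using assms unfolding non_atomic_def by blast
  have "emeasure M A = emeasure M B + emeasure M (A - B)"
    using plus_emeasure[of B M "A - B"] B assms(2) by (simp add: Un_absorb1)
  then have "0 < emeasure M (A - B)"
    using B(4) by (metis add.right_neutral gr_zeroI less_irrefl)
  with B that show ?thesis by (simp add: order_less_le_trans)
qed

lemma vanishes_off_subset: "vanishes_off M U A \<Longrightarrow> A \<subseteq> B \<Longrightarrow> vanishes_off M U B"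
  unfolding vanishes_off_def by (auto elim!: eventually_mono)

lemma vanishes_off_scale:
  assumes "U \<in> L2 M" "vanishes_off M U A"
  shows "vanishes_off M (L2_scale M c U) A"
  using AE_rep(2)[OF assms(1), of c] assms(2) unfolding vanishes_off_def by eventually_elim simp

lemma vanishes_off_add:
  assumes "U \<in> L2 M" "V \<in> L2 M" "vanishes_off M U A" "vanishes_off M V A"
  shows "vanishes_off M (L2_add M U V) A"
  using AE_rep(3)[OF assms(1,2)] assms(3,4) unfolding vanishes_off_def by eventually_elim simp

lemma L2_normalize:
  assumes "U \<in> L2 M" "L2_norm M U \<noteq> 0"
  shows "L2_norm M (L2_scale M (of_real (1 / L2_norm M U)) U) = 1"
proof -
  have "L2_norm M U > 0"
    using assms(2) L2_norm_nonneg[of M U] by linarith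
  then have "cmod (of_real (1 / L2_norm M U)) * L2_norm M U = 1"
    unfolding norm_of_real by simp
  then show ?thesis by (simp only: L2_norm_scale[OF assms(1)])
qed

text \<open>Induction on the number of constraints: split \<open>A\<close> into two pieces of positive measure, solve
  the smaller problem on both pieces, and combine the two solutions.\<close>

lemma orthogonal_unit_vector:
  assumes M: "non_atomic M" and F: "finite F" "F \<subseteq> L2 M" and A: "A \<in> sets M" "0 < emeasure M A"
  obtains U where "U \<in> L2 M" "L2_norm M U = 1" "vanishes_off M U A" "\<And>V. V \<in> F \<Longrightarrow> L2_inner M V U = 0"
proof -
  have "\<exists>U\<in>L2 M. L2_norm M U = 1 \<and> vanishes_off M U A \<and> (\<forall>V\<in>F. L2_inner M V U = 0)"
    using F A
  proof (induction F arbitrary: A rule: finite_induct)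
    case empty
    \<comment> \<open>\<open>A\<close> may have infinite measure; the indicator of the piece
      \<open>B\<close> is square integrable.\<close>
    obtain B where B: "B \<in> sets M" "B \<subseteq> A" "0 < emeasure M B" "emeasure M B < \<infinity>" "0 < emeasure M (A - B)"
      by (rule non_atomic_split[OF M empty(2,3)])
    define f where "f x = (indicator B x :: complex)" for x
    have f2: "(cmod (f x))\<^sup>2 = indicator B x" for x by (simp add: f_def indicator_def)
    have f: "f \<in> L2_fun M"
      using B by (simp add: L2_fun_def f2) (simp add: f_def[abs_def])
    define U where "U = L2_class M f"
    have U: "U \<in> L2 M" unfolding U_def by (rule L2_class_in[OF f])
    have "L2_norm M U = sqrt (measure M B)"
      using B by (simp add: U_def L2_norm_class[OF f] f2)
    moreover have "0 < measure M B"
      using B by (simp add: measure_def enn2real_positive_iff)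
    ultimately have norm: "L2_norm M U \<noteq> 0" by simp
    have "vanishes_off M U A"
      using AE_rep_class[OF f] unfolding vanishes_off_def U_def[symmetric]
      by eventually_elim (use B(2) in \<open>auto simp: f_def indicator_def\<close>)
    then show ?case
      using U L2_normalize[OF U norm] by (intro bexI[of _ "L2_scale M (of_real (1 / L2_norm M U)) U"] conjI)
        (simp_all only: vanishes_off_scale L2_closed ball_simps simp_thms)
  next
    case (insert V F)
    obtain B where B: "B \<in> sets M" "B \<subseteq> A" "0 < emeasure M B" "emeasure M B < \<infinity>" "0 < emeasure M (A - B)"
      by (rule non_atomic_split[OF M insert.prems(2,3)])
    obtain U where U: "U \<in> L2 M" "L2_norm M U = 1" "vanishes_off M U B" "\<forall>V\<in>F. L2_inner M V U = 0"
      using insert.IH[of B] insert.prems B by auto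
    obtain W where W: "W \<in> L2 M" "L2_norm M W = 1" "vanishes_off M W (A - B)" "\<forall>V\<in>F. L2_inner M V W = 0"
      using insert.IH[of "A - B"] insert.prems B by auto
    have UW: "L2_inner M U W = 0" "L2_inner M W U = 0"
      using L2_inner_eq_0_if_disjoint[OF U(3) W(3)] L2_inner_eq_0_if_disjoint[OF W(3) U(3)] U(1) W(1) by auto
    have V: "V \<in> L2 M" "F \<subseteq> L2 M" using insert.prems by auto
    define \<alpha> where "\<alpha> = L2_inner M V U"
    define \<beta> where "\<beta> = L2_inner M V W"
    \<comment> \<open>The coefficients are chosen so that the two contributions to the inner product
      with \<open>V\<close> cancel. As \<open>U\<close> and \<open>W\<close> have disjoint supports,
      the inner product of \<open>W\<close> with \<open>X\<close> is \<open>- \<alpha>\<close>, so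
      that \<open>X\<close> is not zero if \<open>\<alpha>\<close> is not.\<close>
    define X where "X = (if \<alpha> = 0 then U else L2_add M (L2_scale M \<beta> U) (L2_scale M (- \<alpha>) W))"
    have X: "X \<in> L2 M" using U W by (simp add: X_def)
    have orth: "L2_inner M V' X = 0" if "V' \<in> insert V F" for V'
      using that U W V by (auto simp: X_def \<alpha>_def \<beta>_def subset_iff)
    have norm: "L2_norm M X \<noteq> 0"
    proof (cases "\<alpha> = 0")
      case False
      then have "L2_inner M W X = - \<alpha>"
        using U W UW by (simp add: X_def L2_inner_self)
      then have "X \<noteq> L2_zero M" using False W(1) by auto
      then show ?thesis using L2_norm_eq_0[OF X] by simp
    qed (simp add: X_def U)
    have "vanishes_off M U A" "vanishes_off M W A"
      using U(3) W(3) B(2) by (auto elim: vanishes_off_subset)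
    then have "vanishes_off M X A"
      using U(1) W(1) by (simp add: X_def vanishes_off_add vanishes_off_scale)
    moreover have "L2_inner M V' (L2_scale M c X) = 0" if "V' \<in> insert V F" for V' c
      using orth[OF that] that V X by auto
    ultimately show ?case
      using X L2_normalize[OF X norm] by (intro bexI[of _ "L2_scale M (of_real (1 / L2_norm M X)) X"] conjI ballI)
        (simp_all only: vanishes_off_scale L2_closed)
  qed
  then show ?thesis using that by blast
qed

section \<open>Uniformly discrete sets and the choice of vectors\<close>

lemma finite_uniform_discrete_cball:
  fixes D :: "'a::metric_space set"
  assumes compact: "compact (cball z r)" and D: "uniform_discrete D"
  shows "finite {x \<in> D. dist z x \<le> r}"
proof -
  obtain e where e: "e > 0" "\<And>x y. x \<in> D \<Longrightarrow> y \<in> D \<Longrightarrow> dist x y < e \<Longrightarrow> x = y"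
    using D unfolding uniform_discrete_def by blast
  have "cball z r \<subseteq> (\<Union>c\<in>cball z r. ball c (e / 2))" using e by auto
  then obtain F where F: "F \<subseteq> cball z r" "finite F" "cball z r \<subseteq> (\<Union>c\<in>F. ball c (e / 2))"
    by (rule compactE_image[OF compact, rotated]) auto
  then have "\<forall>x\<in>{x \<in> D. dist z x \<le> r}. \<exists>c\<in>F. x \<in> ball c (e / 2)"
    unfolding subset_iff mem_cball by blast
  then obtain c where c: "\<And>x. x \<in> {x \<in> D. dist z x \<le> r} \<Longrightarrow> c x \<in> F \<and> x \<in> ball (c x) (e / 2)" by metis
  have "inj_on c {x \<in> D. dist z x \<le> r}"
  proof (rule inj_onI)
    fix x y assume xy: "x \<in> {x \<in> D. dist z x \<le> r}" "y \<in> {x \<in> D. dist z x \<le> r}" "c x = c y"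
    then have "dist x y < e"
      using c[OF xy(1)] c[OF xy(2)] dist_triangle_half_r[of "c x" x e y] by simp
    then show "x = y" using e(2) xy by auto
  qed
  moreover have "c ` {x \<in> D. dist z x \<le> r} \<subseteq> F" using c by blast
  ultimately show ?thesis using F(2) by (meson finite_imageD finite_subset)
qed

lemma countable_uniform_discrete:
  fixes D :: "'a::metric_space set"
  assumes compact: "\<And>x r. compact (cball (x :: 'a) r)" and D: "uniform_discrete D"
  shows "countable D"
proof -
  have "D = (\<Union>n. {x \<in> D. dist undefined x \<le> real n})"
    using real_arch_simple by blast
  moreover have "countable (\<Union>n. {x \<in> D. dist undefined x \<le> real n})"
    by (intro countable_UN countableI_type countable_finite finite_uniform_discrete_cball compact D)
  ultimately show ?thesis by simp
qed

text \<open>Recursion along an enumeration of \<open>J\<close>: each vector has to be orthogonal to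
  finitely many others, namely those in \<open>\<Phi> i\<close> and all that were chosen before, and
  a ball of positive non-atomic measure has room for it.\<close>

lemma extend_orthonormal:
  fixes M :: "'a::metric_space measure" and c :: "'i \<Rightarrow> 'a"
  assumes M: "proper_metric_measure_space M" "ample M" "non_atomic M"
    and J: "countable J" and \<Phi>: "\<And>i. i \<in> J \<Longrightarrow> finite (\<Phi> i) \<and> \<Phi> i \<subseteq> L2 M"
  obtains \<psi> where "orthonormal_on M J \<psi>" "\<And>i. i \<in> J \<Longrightarrow> vanishes_off M (\<psi> i) (cball (c i) 1)"
    "\<And>i V. i \<in> J \<Longrightarrow> V \<in> \<Phi> i \<Longrightarrow> L2_inner M V (\<psi> i) = 0"
proof -
  define e where "e = to_nat_on J"
  have inj: "inj_on e J" unfolding e_def by (rule inj_on_to_nat_on[OF J])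
  \<comment> \<open>Vacuous off \<open>J\<close>, so that the recursion can run over the whole index
    type.\<close>
  define Q where "Q = (\<lambda>f i U. i \<in> J \<longrightarrow> U \<in> L2 M \<and> L2_norm M U = 1 \<and> vanishes_off M U (cball (c i) 1) \<and>
    (\<forall>V\<in>\<Phi> i. L2_inner M V U = 0) \<and> (\<forall>j\<in>J. e j < e i \<longrightarrow> L2_inner M (f j) U = 0))"
  have "\<exists>f. \<forall>i. Q f i (f i)"
  proof (rule dependent_wf_choice[OF wf_inv_image[OF wf_less_than, of e]])
    show "Q f i U = Q g i U" if "\<And>j. (j, i) \<in> inv_image less_than e \<Longrightarrow> f j = g j" for f g i U
      using that unfolding Q_def by auto
    fix i f assume prev: "\<And>j. (j, i) \<in> inv_image less_than e \<Longrightarrow> Q f j (f j)"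
    show "\<exists>U. Q f i U"
    proof (cases "i \<in> J")
      case True
      define F where "F = \<Phi> i \<union> f ` {j \<in> J. e j < e i}"
      have "finite (e ` {j \<in> J. e j < e i})"
        by (rule finite_subset[of _ "{..<e i}"]) auto
      then have "finite {j \<in> J. e j < e i}"
        by (rule finite_imageD) (rule inj_on_subset[OF inj], blast)
      then have F: "finite F" "F \<subseteq> L2 M"
        using \<Phi>[OF True] prev by (auto simp: F_def Q_def)
      have "ball (c i) 1 \<in> sets M" using M(1) by (simp add: proper_metric_measure_space_def)
      then obtain U where "U \<in> L2 M" "L2_norm M U = 1" "vanishes_off M U (ball (c i) 1)"
        "\<And>V. V \<in> F \<Longrightarrow> L2_inner M V U = 0"
        using orthogonal_unit_vector[OF M(3) F _ emeasure_ball_pos[OF M(1,2) zero_less_one]] by blast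
      then show ?thesis
        by (intro exI[of _ U]) (auto simp: Q_def F_def elim: vanishes_off_subset[OF _ ball_subset_cball])
    qed (simp add: Q_def)
  qed
  then obtain \<psi> where \<psi>: "\<And>i. Q \<psi> i (\<psi> i)" by blast
  have ortho: "L2_inner M (\<psi> i) (\<psi> j) = 0" if "i \<in> J" "j \<in> J" "e i < e j" for i j
    using \<psi>[of j] that by (auto simp: Q_def)
  have "L2_inner M (\<psi> i) (\<psi> j) = (if i = j then 1 else 0)" if ij: "i \<in> J" "j \<in> J" for i j
  proof (cases "i = j")
    case True
    then show ?thesis using \<psi>[of j] ij by (simp add: Q_def L2_inner_self)
  next
    case False
    then consider "e i < e j" | "e j < e i"
      using inj ij by (metis inj_on_eq_iff linorder_neqE_nat)
    then show ?thesis
    proof cases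
      case 1
      then show ?thesis using False ortho[OF ij 1] by simp
    next
      case 2
      then show ?thesis
        using False ortho[OF ij(2,1) 2] L2_inner_commute[of M "\<psi> i" "\<psi> j"] by simp
    qed
  qed
  then have "orthonormal_on M J \<psi>"
    using \<psi> by (auto simp: orthonormal_on_def Q_def)
  with that[of \<psi>] \<psi> show ?thesis by (auto simp: Q_def)
qed

section \<open>The swindle\<close>

lemma localized_reindex:
  assumes h: "inj_on h I" and \<psi>: "localized M (h ` I) c R \<psi>"
  shows "localized M I (\<lambda>i. c (h i)) R (\<lambda>i. \<psi> (h i))"
  unfolding localized_def
proof (intro conjI ballI allI)
  show "orthonormal_on M I (\<lambda>i. \<psi> (h i))"
    using matching_op_reindex(2)[OF h] \<psi> by (auto simp: localized_def)
  show "vanishes_off M (\<psi> (h i)) (cball (c (h i)) R)" if "i \<in> I" for i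
    using \<psi> that by (auto simp: localized_def)
  fix z r
  have "finite {j \<in> h ` I. dist z (c j) \<le> r}"
    using \<psi> by (auto simp: localized_def)
  moreover have "h ` {i \<in> I. dist z (c (h i)) \<le> r} \<subseteq> {j \<in> h ` I. dist z (c j) \<le> r}" by auto
  ultimately have "finite (h ` {i \<in> I. dist z (c (h i)) \<le> r})" by (rule rev_finite_subset)
  then show "finite {i \<in> I. dist z (c (h i)) \<le> r}"
    by (rule finite_imageD) (rule inj_on_subset[OF h], blast)
qed

text \<open>\<open>s\<close> plays the shift, and \<open>p\<close> projects onto the vectors it
  misses. The shift carries \<open>N\<close> and \<open>J\<close> together onto \<open>J\<close>;
  its restrictions \<open>a\<close> to \<open>N\<close> and \<open>b\<close> to \<open>J\<close>
  satisfy the relations required by \<open>K00_class_eq_zero\<close>.\<close>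

lemma K0_class_swindle:
  fixes M :: "'a::metric_space measure" and c :: "'i \<Rightarrow> 'a"
  assumes M: "proper_metric_measure_space M"
    and \<psi>: "localized M I c R \<psi>" and inj: "inj_on s I" and sI: "s ` I \<subseteq> I"
    and near: "\<And>i. i \<in> I \<Longrightarrow> dist (c i) (c (s i)) \<le> K"
    and p_eq: "p = matching_op M (I - s ` I) \<psi> \<psi>"
  shows "K0_class (roe_algebra M) p = \<one>\<^bsub>K0 (roe_algebra M)\<^esub>"
proof -
  let ?A = "roe_algebra M"
  define J where "J = s ` I"
  define N where "N = I - J"
  define \<psi>s where "\<psi>s i = \<psi> (s i)" for i
  have NJ: "N \<subseteq> I" "J \<subseteq> I" "N \<inter> J = {}" "N \<union> J = I"
    using sI by (auto simp: N_def J_def)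
  have \<psi>N: "localized M N c R \<psi>" and \<psi>J: "localized M J c R \<psi>"
    using localized_subset[OF \<psi>] NJ by auto
  have \<psi>sI: "localized M I (\<lambda>i. c (s i)) R \<psi>s"
    unfolding \<psi>s_def using localized_reindex[OF inj] \<psi>J by (simp add: J_def)
  have \<psi>sN: "localized M N (\<lambda>i. c (s i)) R \<psi>s" and \<psi>sJ: "localized M J (\<lambda>i. c (s i)) R \<psi>s"
    using localized_subset[OF \<psi>sI] NJ by auto
  have o: "orthonormal_on M N \<psi>" "orthonormal_on M J \<psi>" "orthonormal_on M N \<psi>s" "orthonormal_on M J \<psi>s"
    "orthonormal_on M I \<psi>s"
    using \<psi>N \<psi>J \<psi>sN \<psi>sJ \<psi>sI by (auto simp: localized_def)
  define q where "q = matching_op M J \<psi> \<psi>"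
  define a where "a = matching_op M N \<psi> \<psi>s"
  define b where "b = matching_op M J \<psi> \<psi>s"
  have p: "p = matching_op M N \<psi> \<psi>" by (simp add: p_eq N_def J_def)
  have near': "dist (c i) (c (s i)) \<le> max 0 K" if "i \<in> I" for i
    using near[OF that] by simp
  have in_A: "p \<in> carrier ?A" "q \<in> carrier ?A" "a \<in> carrier ?A" "b \<in> carrier ?A"
    unfolding p q_def a_def b_def
    by (intro roe_generator_in roe_generator_matching_op[OF M \<psi>N \<psi>N, of 0] roe_generator_matching_op[OF M \<psi>J \<psi>J, of 0]
        roe_generator_matching_op[OF M \<psi>N \<psi>sN, of "max 0 K"] roe_generator_matching_op[OF M \<psi>J \<psi>sJ, of "max 0 K"];
      use near' NJ in auto)+
  have adj: "op_adj M p = p" "op_adj M q = q"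
    "op_adj M a = matching_op M N \<psi>s \<psi>" "op_adj M b = matching_op M J \<psi>s \<psi>"
    by (simp_all add: p q_def a_def b_def matching_op_adj o)
  have rel: "op_comp M p p = p" "op_comp M q q = q"
    "op_comp M (op_adj M a) a = p" "op_comp M (op_adj M b) b = q"
    unfolding adj unfolding p q_def a_def b_def by (intro matching_op_compose o)+
  have rel0: "op_comp M (op_adj M a) b = op_zero M" "op_comp M (op_adj M b) a = op_zero M"
    unfolding adj unfolding a_def b_def
    using orthonormal_onD(2)[OF o(5)] NJ
    by (intro matching_op_compose_orthogonal o; auto)+
  \<comment> \<open>The ranges of \<open>a\<close> and \<open>b\<close> together are spanned by the
    shifted family over all of \<open>I\<close>, which is the original family over \<open>J\<close>
    reindexed.\<close>
  have "op_add M (op_comp M a (op_adj M a)) (op_comp M b (op_adj M b))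
      = op_add M (matching_op M N \<psi>s \<psi>s) (matching_op M J \<psi>s \<psi>s)"
    unfolding adj unfolding a_def b_def by (simp only: matching_op_compose o)
  also have "\<dots> = matching_op M I \<psi>s \<psi>s"
    using matching_op_union[of M N J \<psi>s \<psi>s] o(5) NJ by simp
  also have "\<dots> = q"
    unfolding q_def J_def \<psi>s_def using matching_op_reindex(1)[OF inj, of M \<psi> \<psi>] o(2) by (simp add: J_def)
  finally have rel_sum: "op_add M (op_comp M a (op_adj M a)) (op_comp M b (op_adj M b)) = q" .
  \<comment> \<open>A product in the unitization of two elements with scalar part 0 carries two
    summands with factor 0.\<close>
  have drop: "op_add M x (op_add M (op_scale M 0 y) (op_scale M 0 w)) = x"
    if "x \<in> carrier ?A" "y \<in> carrier ?A" "w \<in> carrier ?A" for x y w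
  proof (rule op_eqI)
    note bd = that[THEN roe_algebra_bounded]
    show "bounded_op M (op_add M x (op_add M (op_scale M 0 y) (op_scale M 0 w)))"
      by (intro bounded_op_add bounded_op_scale bd)
    show "bounded_op M x" by (rule bd)
  qed (simp add: that[THEN roe_algebra_bounded, THEN bounded_opD(1)])
  interpret star_ring "unitization ?A" by (rule star_ring_unitization_roe[OF M])
  note closed = in_A roe_algebra_adj[OF M] roe_algebra_compose[OF M]
  have "K00_class (unitization ?A) ((1, unit_mat (p, 0)), zero_proj (unitization ?A))
      = K00_class (unitization ?A) (zero_proj (unitization ?A), zero_proj (unitization ?A))"
  proof (rule K00_class_eq_zero[of "(p, 0)" "(q, 0)" "(a, 0)" "(b, 0)"])
  qed (simp_all only: unitization_simps roe_algebra_simps drop closed mem_Times_iff fst_conv snd_conv UNIV_I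
      simp_thms rel rel0 rel_sum adj(1,2) mult_zero_left complex_cnj_zero add_0 roe_algebra_zero[OF M])
  then show ?thesis
    by (simp add: K0_class_def K0_def K00_def unit_mat_def)
qed

theorem mainTheorem1:
  fixes M :: "'a::metric_space measure"
    and D0 :: "'a set"
    and \<phi> :: "'a \<Rightarrow> ('a \<Rightarrow> complex) set"
  assumes "proper_metric_measure_space M"
    and "ample M"
    and "connected (UNIV :: 'a set)"
    and "\<not> compact (UNIV :: 'a set)"
    and "bounded_geometry (UNIV :: 'a set)"
    and "non_atomic M"
    and "uniform_discrete D0"
    and "wannier_basis M D0 \<phi>"
  shows "K0_class (roe_algebra M) (wannier_projection M D0 \<phi>) = \<one>\<^bsub>K0 (roe_algebra M)\<^esub>"
proof -
  have cball: "compact (cball (x :: 'a) r)" for x r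
    using assms(1) by (simp add: proper_metric_measure_space_def)
  define z :: 'a where "z = undefined"
  interpret unbounded_proper_space z
    by unfold_locales (rule cball assms)+
  obtain \<gamma> :: "'a \<Rightarrow> nat \<Rightarrow> 'a" where \<gamma>: "\<And>x. \<gamma> x 0 = x" "\<And>x k. dist (\<gamma> x k) (\<gamma> x (Suc k)) \<le> 1"
    "\<And>x r. finite {k. dist z (\<gamma> x k) \<le> r}"
    "\<And>r. \<exists>s. \<forall>x k. s < dist z x \<longrightarrow> r < dist z (\<gamma> x k)"
    by (rule rays) blast
  have \<phi>: "orthonormal_on M D0 \<phi>"
    using assms(8) by (simp add: wannier_basis_def orthonormal_on_def)
  have \<phi>_in: "\<phi> x \<in> L2 M" if "x \<in> D0" for x
    by (rule orthonormal_onD(1)[OF \<phi> that])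
  obtain R0 where R0: "\<And>x. x \<in> D0 \<Longrightarrow> vanishes_off M (\<phi> x) (cball x R0)"
    using assms(8) vanishes_off_ess_supp[OF assms(1)] unfolding wannier_basis_def by blast
  define c where "c = (\<lambda>(x, k). \<gamma> x k)"
  define J where "J = D0 \<times> {1 :: nat..}"
  \<comment> \<open>Supports of radii \<open>R0\<close> and 1 are disjoint unless the centres are
    within \<open>R0 + 1\<close>; all other \<open>\<phi> x\<close> are orthogonal for free.
    Properness and uniform discreteness leave finitely many constraints.\<close>
  define \<Phi> where "\<Phi> i = \<phi> ` {x \<in> D0. dist (c i) x \<le> R0 + 1}" for i
  have "countable J"
    unfolding J_def by (intro countable_SIGMA countable_uniform_discrete cball assms(7) countableI_type)
  moreover have "finite (\<Phi> i) \<and> \<Phi> i \<subseteq> L2 M" for i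
    using finite_uniform_discrete_cball[OF cball assms(7)] \<phi>_in by (auto simp: \<Phi>_def)
  ultimately obtain \<psi>' where \<psi>': "orthonormal_on M J \<psi>'" "\<And>i. i \<in> J \<Longrightarrow> vanishes_off M (\<psi>' i) (cball (c i) 1)"
    "\<And>i V. i \<in> J \<Longrightarrow> V \<in> \<Phi> i \<Longrightarrow> L2_inner M V (\<psi>' i) = 0"
    using extend_orthonormal[OF assms(1,2,6), of J \<Phi> c] by metis
  have cross: "L2_inner M (\<phi> x) (\<psi>' i) = 0" if x: "x \<in> D0" and i: "i \<in> J" for x i
  proof (cases "dist (c i) x \<le> R0 + 1")
    case True
    then show ?thesis using \<psi>'(3)[OF i] x by (simp add: \<Phi>_def)
  next
    case False
    have "cball x R0 \<inter> cball (c i) 1 = {}"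
    proof (rule equals0I)
      fix y assume "y \<in> cball x R0 \<inter> cball (c i) 1"
      then have "dist x y \<le> R0" "dist (c i) y \<le> 1" by auto
      then show False using False dist_triangle2[of "c i" x y] by linarith
    qed
    then show ?thesis
      using R0[OF x] \<psi>'(2)[OF i] \<phi>_in[OF x] orthonormal_onD(1)[OF \<psi>'(1) i]
      by (intro L2_inner_eq_0_if_disjoint)
  qed
  define I where "I = D0 \<times> (UNIV :: nat set)"
  define \<psi> where "\<psi> = (\<lambda>(x, k). if k = 0 then \<phi> x else \<psi>' (x, k))"
  define R where "R = max R0 1"
  have I: "(\<exists>x\<in>D0. i = (x, 0)) \<or> i \<in> J" if "i \<in> I" for i
    using that by (cases i; cases "snd i") (auto simp: I_def J_def)
  have \<psi>0: "\<psi> (x, 0) = \<phi> x" for x by (simp add: \<psi>_def)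
  have \<psi>J: "\<psi> i = \<psi>' i" if "i \<in> J" for i using that by (auto simp: \<psi>_def J_def)
  have J0: "(x, 0) \<notin> J" for x by (simp add: J_def)
  have "L2_inner M (\<psi> i) (\<psi> j) = (if i = j then 1 else 0)" if "i \<in> I" "j \<in> I" for i j
  proof -
    have cross': "L2_inner M (\<psi>' k) (\<phi> x) = 0" if "x \<in> D0" "k \<in> J" for x k
      using cross[OF that] L2_inner_commute[of M "\<psi>' k" "\<phi> x"] by simp
    show ?thesis
      using I[OF that(1)] I[OF that(2)] orthonormal_onD(2)[OF \<phi>] orthonormal_onD(2)[OF \<psi>'(1)]
      by (elim disjE bexE) (auto simp: \<psi>0 \<psi>J cross cross' J0)
  qed
  moreover have "\<psi> i \<in> L2 M \<and> vanishes_off M (\<psi> i) (cball (c i) R)" if "i \<in> I" for i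
    using I[OF that]
  proof (elim disjE bexE)
    fix x assume "x \<in> D0" "i = (x, 0)"
    then show ?thesis
      using R0[of x] \<phi>_in[of x] by (auto simp: \<psi>0 c_def \<gamma>(1) R_def elim!: vanishes_off_subset)
  next
    assume "i \<in> J"
    then show ?thesis
      using \<psi>'(2)[of i] orthonormal_onD(1)[OF \<psi>'(1), of i]
      by (auto simp: \<psi>J R_def elim!: vanishes_off_subset)
  qed
  \<comment> \<open>\<open>rays\<close> measures distances from \<open>z\<close>, so the ball around
    \<open>w\<close> is enlarged to radius \<open>dist z w + r\<close> around \<open>z\<close>.
    Uniform escape confines the starting points, and the escape of the single ray confines
    \<open>k\<close>.\<close>
  moreover have "finite {i \<in> I. dist w (c i) \<le> r}" for w r
  proof -
    obtain s where s: "\<And>x k. s < dist z x \<Longrightarrow> dist z w + r < dist z (\<gamma> x k)"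
      using \<gamma>(4) by blast
    have near: "dist z (\<gamma> x k) \<le> dist z w + r" if "dist w (\<gamma> x k) \<le> r" for x k
      using dist_triangle[of z "\<gamma> x k" w] that by linarith
    have "{i \<in> I. dist w (c i) \<le> r} \<subseteq> Sigma {x \<in> D0. dist z x \<le> s} (\<lambda>x. {k. dist z (\<gamma> x k) \<le> dist z w + r})"
      using near s by (force simp: I_def c_def not_le[symmetric])
    then show ?thesis
      by (rule finite_subset)
        (intro finite_SigmaI finite_uniform_discrete_cball cball assms(7) \<gamma>(3))
  qed
  ultimately have loc: "localized M I c R \<psi>"
    by (simp add: localized_def orthonormal_on_def)
  define s where "s = (\<lambda>(x :: 'a, k). (x, Suc k))"
  have s: "inj_on s I" "s ` I \<subseteq> I"
    by (auto simp: s_def I_def inj_on_def)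
  \<comment> \<open>The shift misses exactly the indices with \<open>k = 0\<close>, whose vectors
    are the given Wannier basis.\<close>
  have rest: "I - s ` I = (\<lambda>x. (x, 0)) ` D0"
  proof (intro equalityI subsetI)
    fix i assume i: "i \<in> I - s ` I"
    obtain x k where xk: "i = (x, k)" by (cases i)
    have "k = 0"
    proof (cases k)
      case (Suc m)
      then have "i = s (x, m)" "(x, m) \<in> I" using i xk by (auto simp: s_def I_def)
      then show ?thesis using i by blast
    qed simp
    then show "i \<in> (\<lambda>x. (x, 0)) ` D0" using i xk by (auto simp: I_def)
  qed (auto simp: s_def I_def)
  show ?thesis
  proof (rule K0_class_swindle[OF assms(1) loc s])
    show "dist (c i) (c (s i)) \<le> 1" if "i \<in> I" for i
      using \<gamma>(2) by (simp add: c_def s_def split: prod.split)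
    have o: "orthonormal_on M ((\<lambda>x. (x, 0)) ` D0) \<psi>"
      unfolding rest[symmetric] using loc by (auto simp: localized_def intro: orthonormal_on_subset)
    show "wannier_projection M D0 \<phi> = matching_op M (I - s ` I) \<psi> \<psi>"
      using matching_op_reindex(1)[OF _ o o] by (simp add: wannier_projection_eq[OF \<phi>] rest \<psi>0 inj_on_def)
  qed
qed

end
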